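(* Let $M$ be a pointwise $k$-slant submanifold of a Kähler manifold $(\bar M,\varphi,g)$, with associated orthogonal decomposition $TM=\mathcal D_0\oplus\mathcal D_1\oplus\dots\oplus\mathcal D_k$ and slant functions $\theta_0=0,\theta_1,\dots,\theta_k$. If $\nabla N=0$, then: (i) $M$ is a $(\mathcal D_0,\mathcal D_i)$-mixed totally geodesic submanifold of $\bar M$ (i.e., $h(X,Y)=0$ for all $X\in\Gamma(\mathcal D_0)$ and $Y\in\Gamma(\mathcal D_i)$) for $i\in\{1,\dots,k\}$; (ii) for $i\in\{0,\dots,k\}$, either $M$ is a $(\mathcal D_i,\mathcal D_i)$-totally geodesic submanifold of $\bar M$ (i.e., $h(X,Y)=0$ for all $X,Y\in\Gamma(\mathcal D_i)$), or $-\cos^2\theta_i$ is an eigenvalue function of $n^2$, and, for $X,Y\in\Gamma(\mathcal D_i)$, any nonzero $h(X,Y)$ is an eigenvector for it; (iii) for $i\in\{0,\dots,k\}$, either $h(X,Y)=0$ for any $X\in\Gamma(\mathcal D_i)$ and $Y\in\Gamma(TM)$, or $-\cos^2\theta_i$ is an eigenvalue function of $T^2$, and, for $X\in\Gamma(\mathcal D_i)$ and $V\in\Gamma(T^\bot M)$, any nonzero $A_VX$ is an eigenvector for it.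
   Context: An almost Hermitian manifold $(\bar M,\varphi,g)$ is a Riemannian manifold $(\bar M,g)$ with a $(1,1)$-tensor field $\varphi$ such that $\varphi^2=-I$ and $g(\varphi\cdot,\varphi\cdot)=g$. Here it is called Kähler if $\bar\nabla\varphi=0$, where $\bar\nabla$ is the Levi-Civita connection of $g$. Let $M$ be a submanifold of $\bar M$ defined by an injective immersion, with induced metric also denoted $g$ and Levi-Civita connection $\nabla$. The second fundamental form $h$, shape operator $A$ and normal connection $\nabla^\bot$ are given by $\bar\nabla_XY=\nabla_XY+h(X,Y)$ and $\bar\nabla_XV=-A_VX+\nabla^\bot_XV$ for $X,Y\in\Gamma(TM)$, $V\in\Gamma(T^\bot M)$; they satisfy $g(h(X,Y),V)=g(A_VX,Y)$. For $X\in\Gamma(TM)$ and $V\in\Gamma(T^\bot M)$ write $\varphi X=TX+NX$ and $\varphi V=tV+nV$, with $TX,tV$ tangent and $NX,nV$ normal to $M$. Put $(\nabla_XN)Y:=\nabla^\bot_XNY-N(\nabla_XY)$; $\nabla N=0$ means $(\nabla_XN)Y=0$ for all $X,Y\in\Gamma(TM)$. A distribution $\mathcal D\subseteq TM$ is pointwise slant if, at each $p\in M$, the angle $\theta(p)$ between $\varphi X_p$ and $\mathcal D_p$ is nonzero and independent of the choice of $X_p\in\mathcal D_p\setminus\{0\}$; $\theta$ is its slant function. $M$ is a pointwise $k$-slant submanifold of $\bar M$ ($k\in\mathbb N$, $k\ge1$) if there exist mutually orthogonal smooth regular (constant rank) distributions $\mathcal D_0,\dots,\mathcal D_k$ on $M$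 such that: $TM=\mathcal D_0\oplus\mathcal D_1\oplus\dots\oplus\mathcal D_k$; $T(\mathcal D_i)\subseteq\mathcal D_i$ for $i\in\{1,\dots,k\}$; $\mathcal D_0$ is invariant ($\varphi(\mathcal D_0)\subseteq\mathcal D_0$), possibly trivial; and $\mathcal D_1,\dots,\mathcal D_k$ are nontrivial pointwise slant distributions with slant functions $\theta_i(p)\in(0,\frac{\pi}{2}]$ that are pointwise distinct ($\theta_i(p)\ne\theta_j(p)$ for all $p\in M$ and $i\ne j$). By convention $\theta_0=0$. A function $\lambda$ on $M$ is an eigenvalue function of a field of endomorphisms $B$ of a vector bundle $E\to M$ (here $B=n^2$ on $E=T^\bot M$, or $B=T^2$ on $E=TM$), with eigenvector $W$, if $W\in\Gamma(E)$ is a nonzero section with $BW=\lambda W$. *)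

theory Defs
  imports "HOL-Analysis.Analysis" "HOL-Library.Function_Algebras"
begin

text \<open>Pointwise scalar multiplication on functions; together with the pointwise operations of
  \<^theory>\<open>HOL-Library.Function_Algebras\<close> it makes operators on functions, in particular
  tangent vectors, elements of a real vector space.\<close>

instantiation "fun" :: (type, real_vector) real_vector
begin

definition scaleR_fun :: "real \<Rightarrow> ('a \<Rightarrow> 'b) \<Rightarrow> 'a \<Rightarrow> 'b"
  where "scaleR_fun r f = (\<lambda>x. r *\<^sub>R f x)"

instance
  by standard (auto simp: scaleR_fun_def fun_eq_iff algebra_simps)

end


section \<open>Smooth manifolds\<close>

primrec Ck_on :: "nat \<Rightarrow> 'a::euclidean_space set \<Rightarrow> ('a \<Rightarrow> 'b::real_normed_vector) \<Rightarrow> bool"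
  where
    "Ck_on 0 S f \<longleftrightarrow> continuous_on S f"
  | "Ck_on (Suc k) S f \<longleftrightarrow> (\<forall>x\<in>S. f differentiable (at x)) \<and>
      (\<forall>v. Ck_on k S (\<lambda>x. frechet_derivative f (at x) v))"

text \<open>Only used for open \<open>S\<close>.\<close>

definition smooth_on :: "'a::euclidean_space set \<Rightarrow> ('a \<Rightarrow> 'b::real_normed_vector) \<Rightarrow> bool"
  where "smooth_on S f \<longleftrightarrow> (\<forall>k. Ck_on k S f)"

text \<open>A chart is a pair of its domain and its coordinate map. A manifold is a whole Hausdorff,
  second countable type with an atlas, which need not be maximal.\<close>

type_synonym ('m, 'e) atlas = "('m set \<times> ('m \<Rightarrow> 'e)) set"

definition smooth_atlas ::
    "('m::{t2_space,second_countable_topology}, 'e::euclidean_space) atlas \<Rightarrow> bool"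
  where "smooth_atlas A \<longleftrightarrow>
    (\<Union>(U, c)\<in>A. U) = UNIV \<and>
    (\<forall>(U, c)\<in>A. open U \<and> open (c ` U) \<and> homeomorphism U (c ` U) c (inv_into U c)) \<and>
    (\<forall>(U, c)\<in>A. \<forall>(V, d)\<in>A. smooth_on (c ` (U \<inter> V)) (d \<circ> inv_into U c))"

definition smooth_map ::
    "('m::topological_space, 'e::euclidean_space) atlas \<Rightarrow>
     ('n::topological_space, 'd::euclidean_space) atlas \<Rightarrow> ('m \<Rightarrow> 'n) \<Rightarrow> bool"
  where "smooth_map A B F \<longleftrightarrow> continuous_on UNIV F \<and>
    (\<forall>(U, c)\<in>A. \<forall>(V, d)\<in>B. smooth_on (c ` (U \<inter> F -` V)) (d \<circ> F \<circ> inv_into U c))"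

definition smooth_fun ::
    "('m::topological_space, 'e::euclidean_space) atlas \<Rightarrow> 'm set \<Rightarrow> ('m \<Rightarrow> real) \<Rightarrow> bool"
  where "smooth_fun A S f \<longleftrightarrow> (\<forall>(U, c)\<in>A. smooth_on (c ` (U \<inter> S)) (f \<circ> inv_into U c))"

definition smooth_at ::
    "('m::topological_space, 'e::euclidean_space) atlas \<Rightarrow> 'm \<Rightarrow> ('m \<Rightarrow> real) \<Rightarrow> bool"
  where "smooth_at A p f \<longleftrightarrow> (\<exists>S. open S \<and> p \<in> S \<and> smooth_fun A S f)"

text \<open>Tangent vectors are point derivations on the functions that are smooth near the point.
  (They depend on the germ only, since the Leibniz rule makes them vanish on functions that
  vanish near the point.) The value 0 on all other functions is a convention that makes
  equality of tangent vectors coincide with HOL equality.\<close>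

type_synonym 'm tvec = "('m \<Rightarrow> real) \<Rightarrow> real"

definition tangent_space ::
    "('m::topological_space, 'e::euclidean_space) atlas \<Rightarrow> 'm \<Rightarrow> 'm tvec set"
  where "tangent_space A p = {v.
    (\<forall>f. \<not> smooth_at A p f \<longrightarrow> v f = 0) \<and>
    (\<forall>f r. smooth_at A p f \<longrightarrow> v (\<lambda>x. r * f x) = r * v f) \<and>
    (\<forall>f f'. smooth_at A p f \<and> smooth_at A p f' \<longrightarrow>
       v (\<lambda>x. f x + f' x) = v f + v f' \<and>
       v (\<lambda>x. f x * f' x) = f p * v f' + f' p * v f)}"

definition push ::
    "('n::topological_space, 'd::euclidean_space) atlas \<Rightarrow> ('m \<Rightarrow> 'n) \<Rightarrow> 'm \<Rightarrow> 'm tvec \<Rightarrow> 'n tvec"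
  where "push B F p v = (\<lambda>f. if smooth_at B (F p) f then v (f \<circ> F) else 0)"

text \<open>Smooth sections over \<open>S\<close> of the pullback bundle of the tangent bundle under \<open>F\<close>;
  ordinary vector fields are the case \<open>F = id\<close>.\<close>

definition field_along ::
    "('m::topological_space, 'e::euclidean_space) atlas \<Rightarrow>
     ('n::topological_space, 'd::euclidean_space) atlas \<Rightarrow> ('m \<Rightarrow> 'n) \<Rightarrow> 'm set \<Rightarrow>
     ('m \<Rightarrow> 'n tvec) \<Rightarrow> bool"
  where "field_along A B F S W \<longleftrightarrow>
    (\<forall>p\<in>S. W p \<in> tangent_space B (F p)) \<and>
    (\<forall>V f. open V \<and> smooth_fun B V f \<longrightarrow> smooth_fun A (S \<inter> F -` V) (\<lambda>p. W p f))"

abbreviation vector_field ::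
    "('m::topological_space, 'e::euclidean_space) atlas \<Rightarrow> 'm set \<Rightarrow> ('m \<Rightarrow> 'm tvec) \<Rightarrow> bool"
  where "vector_field A \<equiv> field_along A A id"

definition field_near ::
    "('m::topological_space, 'e::euclidean_space) atlas \<Rightarrow>
     ('n::topological_space, 'd::euclidean_space) atlas \<Rightarrow> ('m \<Rightarrow> 'n) \<Rightarrow> 'm \<Rightarrow>
     ('m \<Rightarrow> 'n tvec) \<Rightarrow> bool"
  where "field_near A B F p W \<longleftrightarrow> (\<exists>S. open S \<and> p \<in> S \<and> field_along A B F S W)"


section \<open>Metrics and connections\<close>

definition riemannian_metric ::
    "('m::topological_space, 'e::euclidean_space) atlas \<Rightarrow>
     ('m \<Rightarrow> 'm tvec \<Rightarrow> 'm tvec \<Rightarrow> real) \<Rightarrow> bool"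
  where "riemannian_metric A g \<longleftrightarrow>
    (\<forall>p. \<forall>u\<in>tangent_space A p. \<forall>v\<in>tangent_space A p. \<forall>w\<in>tangent_space A p. \<forall>r s.
       g p u v = g p v u \<and>
       g p (r *\<^sub>R u + s *\<^sub>R v) w = r * g p u w + s * g p v w \<and>
       (u \<noteq> 0 \<longrightarrow> g p u u > 0)) \<and>
    (\<forall>S X Y. open S \<and> vector_field A S X \<and> vector_field A S Y \<longrightarrow>
       smooth_fun A S (\<lambda>p. g p (X p) (Y p)))"

text \<open>Covariant derivatives of fields along \<open>F\<close>, that is, connections on the pullback bundle:
  \<open>D p v W\<close> is the derivative at \<open>p\<close> of the field \<open>W\<close>, smooth near \<open>p\<close>, in the direction of
  the tangent vector \<open>v\<close> at \<open>p\<close>. As for tangent vectors, the Leibniz rule forces it to depend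
  on the germ of \<open>W\<close> only. Affine connections are the case \<open>F = id\<close>.\<close>

type_synonym ('m, 'n) conn = "'m \<Rightarrow> 'm tvec \<Rightarrow> ('m \<Rightarrow> 'n tvec) \<Rightarrow> 'n tvec"

definition connection_along ::
    "('m::topological_space, 'e::euclidean_space) atlas \<Rightarrow>
     ('n::topological_space, 'd::euclidean_space) atlas \<Rightarrow> ('m \<Rightarrow> 'n) \<Rightarrow> ('m, 'n) conn \<Rightarrow> bool"
  where "connection_along A B F D \<longleftrightarrow>
    (\<forall>p W. field_near A B F p W \<longrightarrow>
       (\<forall>v\<in>tangent_space A p. D p v W \<in> tangent_space B (F p)) \<and>
       (\<forall>v\<in>tangent_space A p. \<forall>w\<in>tangent_space A p. \<forall>r s.
          D p (r *\<^sub>R v + s *\<^sub>R w) W = r *\<^sub>R D p v W + s *\<^sub>R D p w W) \<and>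
       (\<forall>v\<in>tangent_space A p. \<forall>Z. field_near A B F p Z \<longrightarrow>
          D p v (\<lambda>q. W q + Z q) = D p v W + D p v Z) \<and>
       (\<forall>v\<in>tangent_space A p. \<forall>f. smooth_at A p f \<longrightarrow>
          D p v (\<lambda>q. f q *\<^sub>R W q) = v f *\<^sub>R W p + f p *\<^sub>R D p v W)) \<and>
    (\<forall>S X W. open S \<and> vector_field A S X \<and> field_along A B F S W \<longrightarrow>
       field_along A B F S (\<lambda>p. D p (X p) W))"

definition levi_civita ::
    "('m::topological_space, 'e::euclidean_space) atlas \<Rightarrow>
     ('m \<Rightarrow> 'm tvec \<Rightarrow> 'm tvec \<Rightarrow> real) \<Rightarrow> ('m, 'm) conn \<Rightarrow> bool"
  where "levi_civita A g nab \<longleftrightarrow>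
    connection_along A A id nab \<and>
    (\<forall>p X Y f. field_near A A id p X \<and> field_near A A id p Y \<and> smooth_at A p f \<longrightarrow>
       (nab p (X p) Y - nab p (Y p) X) f = X p (\<lambda>q. Y q f) - Y p (\<lambda>q. X q f)) \<and>
    (\<forall>p. \<forall>v\<in>tangent_space A p. \<forall>Y Z. field_near A A id p Y \<and> field_near A A id p Z \<longrightarrow>
       v (\<lambda>q. g q (Y q) (Z q)) = g p (nab p v Y) (Z p) + g p (Y p) (nab p v Z))"

text \<open>The (unique) connection along \<open>F\<close> induced by a connection \<open>nabb\<close> of the target. It gives
  a meaning to the derivative by \<open>nabb\<close> of fields that are only defined along a submanifold;
  it agrees with differentiating an arbitrary local extension, if there is one.\<close>

definition induced_connection ::
    "('m::topological_space, 'e::euclidean_space) atlas \<Rightarrow>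
     ('n::topological_space, 'd::euclidean_space) atlas \<Rightarrow> ('m \<Rightarrow> 'n) \<Rightarrow>
     ('n, 'n) conn \<Rightarrow> ('m, 'n) conn \<Rightarrow> bool"
  where "induced_connection A B F nabb D \<longleftrightarrow>
    connection_along A B F D \<and>
    (\<forall>p. \<forall>v\<in>tangent_space A p. \<forall>Z. field_near B B id (F p) Z \<longrightarrow>
       D p v (\<lambda>q. Z (F q)) = nabb (F p) (push B F p v) Z)"


section \<open>Kaehler manifolds\<close>

definition tensor11 ::
    "('m::topological_space, 'e::euclidean_space) atlas \<Rightarrow> ('m \<Rightarrow> 'm tvec \<Rightarrow> 'm tvec) \<Rightarrow> bool"
  where "tensor11 A \<phi> \<longleftrightarrow>
    (\<forall>p. \<forall>v\<in>tangent_space A p. \<phi> p v \<in> tangent_space A p) \<and>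
    (\<forall>p. \<forall>v\<in>tangent_space A p. \<forall>w\<in>tangent_space A p. \<forall>r s.
       \<phi> p (r *\<^sub>R v + s *\<^sub>R w) = r *\<^sub>R \<phi> p v + s *\<^sub>R \<phi> p w) \<and>
    (\<forall>S X. open S \<and> vector_field A S X \<longrightarrow> vector_field A S (\<lambda>p. \<phi> p (X p)))"

definition almost_hermitian ::
    "('m::{t2_space,second_countable_topology}, 'e::euclidean_space) atlas \<Rightarrow>
     ('m \<Rightarrow> 'm tvec \<Rightarrow> 'm tvec) \<Rightarrow> ('m \<Rightarrow> 'm tvec \<Rightarrow> 'm tvec \<Rightarrow> real) \<Rightarrow> bool"
  where "almost_hermitian A \<phi> g \<longleftrightarrow>
    smooth_atlas A \<and> riemannian_metric A g \<and> tensor11 A \<phi> \<and>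
    (\<forall>p. \<forall>v\<in>tangent_space A p. \<phi> p (\<phi> p v) = - v) \<and>
    (\<forall>p. \<forall>v\<in>tangent_space A p. \<forall>w\<in>tangent_space A p. g p (\<phi> p v) (\<phi> p w) = g p v w)"

text \<open>The last argument is the Levi-Civita connection.\<close>

definition kaehler ::
    "('m::{t2_space,second_countable_topology}, 'e::euclidean_space) atlas \<Rightarrow>
     ('m \<Rightarrow> 'm tvec \<Rightarrow> 'm tvec) \<Rightarrow> ('m \<Rightarrow> 'm tvec \<Rightarrow> 'm tvec \<Rightarrow> real) \<Rightarrow> ('m, 'm) conn \<Rightarrow> bool"
  where "kaehler A \<phi> g nab \<longleftrightarrow>
    almost_hermitian A \<phi> g \<and> levi_civita A g nab \<and>
    (\<forall>p. \<forall>v\<in>tangent_space A p. \<forall>Y. field_near A A id p Y \<longrightarrow>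
       nab p v (\<lambda>q. \<phi> q (Y q)) - \<phi> p (nab p v Y) = 0)"


section \<open>Submanifolds\<close>

text \<open>In the following, \<open>F\<close> is an injective immersion of the manifold with atlas \<open>A\<close> into the
  one with atlas \<open>B\<close>. Vectors tangent to the submanifold are represented in the tangent spaces
  of \<open>A\<close>, normal vectors in the tangent spaces of \<open>B\<close> at points \<open>F p\<close>.\<close>

definition injective_immersion ::
    "('m::topological_space, 'e::euclidean_space) atlas \<Rightarrow>
     ('n::topological_space, 'd::euclidean_space) atlas \<Rightarrow> ('m \<Rightarrow> 'n) \<Rightarrow> bool"
  where "injective_immersion A B F \<longleftrightarrow> smooth_map A B F \<and> inj F \<and>
    (\<forall>p. inj_on (push B F p) (tangent_space A p))"

definition induced_metric ::
    "('n::topological_space, 'd::euclidean_space) atlas \<Rightarrow> ('m \<Rightarrow> 'n) \<Rightarrow>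
     ('n \<Rightarrow> 'n tvec \<Rightarrow> 'n tvec \<Rightarrow> real) \<Rightarrow> 'm \<Rightarrow> 'm tvec \<Rightarrow> 'm tvec \<Rightarrow> real"
  where "induced_metric B F g p v w = g (F p) (push B F p v) (push B F p w)"

definition normal_space ::
    "('m::topological_space, 'e::euclidean_space) atlas \<Rightarrow>
     ('n::topological_space, 'd::euclidean_space) atlas \<Rightarrow> ('m \<Rightarrow> 'n) \<Rightarrow>
     ('n \<Rightarrow> 'n tvec \<Rightarrow> 'n tvec \<Rightarrow> real) \<Rightarrow> 'm \<Rightarrow> 'n tvec set"
  where "normal_space A B F g p =
    {w \<in> tangent_space B (F p). \<forall>v\<in>tangent_space A p. g (F p) w (push B F p v) = 0}"

definition tangent_part ::
    "('m::topological_space, 'e::euclidean_space) atlas \<Rightarrow>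
     ('n::topological_space, 'd::euclidean_space) atlas \<Rightarrow> ('m \<Rightarrow> 'n) \<Rightarrow>
     ('n \<Rightarrow> 'n tvec \<Rightarrow> 'n tvec \<Rightarrow> real) \<Rightarrow> 'm \<Rightarrow> 'n tvec \<Rightarrow> 'm tvec"
  where "tangent_part A B F g p w =
    (THE v. v \<in> tangent_space A p \<and> w - push B F p v \<in> normal_space A B F g p)"

definition normal_part ::
    "('m::topological_space, 'e::euclidean_space) atlas \<Rightarrow>
     ('n::topological_space, 'd::euclidean_space) atlas \<Rightarrow> ('m \<Rightarrow> 'n) \<Rightarrow>
     ('n \<Rightarrow> 'n tvec \<Rightarrow> 'n tvec \<Rightarrow> real) \<Rightarrow> 'm \<Rightarrow> 'n tvec \<Rightarrow> 'n tvec"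
  where "normal_part A B F g p w = w - push B F p (tangent_part A B F g p w)"

definition T_op ::
    "('m::topological_space, 'e::euclidean_space) atlas \<Rightarrow>
     ('n::topological_space, 'd::euclidean_space) atlas \<Rightarrow> ('m \<Rightarrow> 'n) \<Rightarrow>
     ('n \<Rightarrow> 'n tvec \<Rightarrow> 'n tvec) \<Rightarrow> ('n \<Rightarrow> 'n tvec \<Rightarrow> 'n tvec \<Rightarrow> real) \<Rightarrow> 'm \<Rightarrow> 'm tvec \<Rightarrow> 'm tvec"
  where "T_op A B F \<phi> g p v = tangent_part A B F g p (\<phi> (F p) (push B F p v))"

definition N_op ::
    "('m::topological_space, 'e::euclidean_space) atlas \<Rightarrow>
     ('n::topological_space, 'd::euclidean_space) atlas \<Rightarrow> ('m \<Rightarrow> 'n) \<Rightarrow>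
     ('n \<Rightarrow> 'n tvec \<Rightarrow> 'n tvec) \<Rightarrow> ('n \<Rightarrow> 'n tvec \<Rightarrow> 'n tvec \<Rightarrow> real) \<Rightarrow> 'm \<Rightarrow> 'm tvec \<Rightarrow> 'n tvec"
  where "N_op A B F \<phi> g p v = normal_part A B F g p (\<phi> (F p) (push B F p v))"

text \<open>The operator \<open>n\<close> on normal vectors.\<close>

definition n_op ::
    "('m::topological_space, 'e::euclidean_space) atlas \<Rightarrow>
     ('n::topological_space, 'd::euclidean_space) atlas \<Rightarrow> ('m \<Rightarrow> 'n) \<Rightarrow>
     ('n \<Rightarrow> 'n tvec \<Rightarrow> 'n tvec) \<Rightarrow> ('n \<Rightarrow> 'n tvec \<Rightarrow> 'n tvec \<Rightarrow> real) \<Rightarrow> 'm \<Rightarrow> 'n tvec \<Rightarrow> 'n tvec"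
  where "n_op A B F \<phi> g p w = normal_part A B F g p (\<phi> (F p) w)"

definition normal_field ::
    "('m::topological_space, 'e::euclidean_space) atlas \<Rightarrow>
     ('n::topological_space, 'd::euclidean_space) atlas \<Rightarrow> ('m \<Rightarrow> 'n) \<Rightarrow>
     ('n \<Rightarrow> 'n tvec \<Rightarrow> 'n tvec \<Rightarrow> real) \<Rightarrow> ('m \<Rightarrow> 'n tvec) \<Rightarrow> bool"
  where "normal_field A B F g V \<longleftrightarrow>
    field_along A B F UNIV V \<and> (\<forall>p. V p \<in> normal_space A B F g p)"

text \<open>Gauss formula. Here \<open>nab\<close> is the connection of the submanifold and \<open>D\<close> the connection
  along \<open>F\<close> induced by the one of the ambient manifold.\<close>

definition second_ff ::
    "('n::topological_space, 'd::euclidean_space) atlas \<Rightarrow> ('m \<Rightarrow> 'n) \<Rightarrow>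
     ('m, 'n) conn \<Rightarrow> ('m, 'm) conn \<Rightarrow> ('m \<Rightarrow> 'm tvec) \<Rightarrow> ('m \<Rightarrow> 'm tvec) \<Rightarrow> 'm \<Rightarrow> 'n tvec"
  where "second_ff B F D nab X Y p =
    D p (X p) (\<lambda>q. push B F q (Y q)) - push B F p (nab p (X p) Y)"

text \<open>Weingarten formula.\<close>

definition shape_op ::
    "('m::topological_space, 'e::euclidean_space) atlas \<Rightarrow>
     ('n::topological_space, 'd::euclidean_space) atlas \<Rightarrow> ('m \<Rightarrow> 'n) \<Rightarrow>
     ('n \<Rightarrow> 'n tvec \<Rightarrow> 'n tvec \<Rightarrow> real) \<Rightarrow> ('m, 'n) conn \<Rightarrow>
     ('m \<Rightarrow> 'n tvec) \<Rightarrow> ('m \<Rightarrow> 'm tvec) \<Rightarrow> 'm \<Rightarrow> 'm tvec"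
  where "shape_op A B F g D V X p = - tangent_part A B F g p (D p (X p) V)"

definition normal_conn ::
    "('m::topological_space, 'e::euclidean_space) atlas \<Rightarrow>
     ('n::topological_space, 'd::euclidean_space) atlas \<Rightarrow> ('m \<Rightarrow> 'n) \<Rightarrow>
     ('n \<Rightarrow> 'n tvec \<Rightarrow> 'n tvec \<Rightarrow> real) \<Rightarrow> ('m, 'n) conn \<Rightarrow>
     ('m \<Rightarrow> 'm tvec) \<Rightarrow> ('m \<Rightarrow> 'n tvec) \<Rightarrow> 'm \<Rightarrow> 'n tvec"
  where "normal_conn A B F g D X V p = normal_part A B F g p (D p (X p) V)"

definition nabla_N ::
    "('m::topological_space, 'e::euclidean_space) atlas \<Rightarrow>
     ('n::topological_space, 'd::euclidean_space) atlas \<Rightarrow> ('m \<Rightarrow> 'n) \<Rightarrow>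
     ('n \<Rightarrow> 'n tvec \<Rightarrow> 'n tvec) \<Rightarrow> ('n \<Rightarrow> 'n tvec \<Rightarrow> 'n tvec \<Rightarrow> real) \<Rightarrow>
     ('m, 'n) conn \<Rightarrow> ('m, 'm) conn \<Rightarrow> ('m \<Rightarrow> 'm tvec) \<Rightarrow> ('m \<Rightarrow> 'm tvec) \<Rightarrow> 'm \<Rightarrow> 'n tvec"
  where "nabla_N A B F \<phi> g D nab X Y p =
    normal_conn A B F g D X (\<lambda>q. N_op A B F \<phi> g q (Y q)) p -
    N_op A B F \<phi> g p (nab p (X p) Y)"

text \<open>The manifold with atlas \<open>A\<close>, with its immersion \<open>F\<close>, the induced metric, its Levi-Civita
  connection \<open>nab\<close>, and the connection \<open>D\<close> along \<open>F\<close> induced by \<open>nabb\<close>.\<close>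

definition submanifold ::
    "('m::{t2_space,second_countable_topology}, 'e::euclidean_space) atlas \<Rightarrow>
     ('n::{t2_space,second_countable_topology}, 'd::euclidean_space) atlas \<Rightarrow> ('m \<Rightarrow> 'n) \<Rightarrow>
     ('n \<Rightarrow> 'n tvec \<Rightarrow> 'n tvec \<Rightarrow> real) \<Rightarrow> ('n, 'n) conn \<Rightarrow> ('m, 'n) conn \<Rightarrow> ('m, 'm) conn \<Rightarrow> bool"
  where "submanifold A B F g nabb D nab \<longleftrightarrow>
    smooth_atlas A \<and> injective_immersion A B F \<and>
    induced_connection A B F nabb D \<and>
    levi_civita A (induced_metric B F g) nab"


section \<open>Pointwise slant distributions\<close>

definition smooth_distribution ::
    "('m::topological_space, 'e::euclidean_space) atlas \<Rightarrow> ('m \<Rightarrow> 'm tvec set) \<Rightarrow> bool"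
  where "smooth_distribution A \<D> \<longleftrightarrow> (\<exists>r. \<forall>p. dim (\<D> p) = r \<and>
    (\<exists>S (X :: nat \<Rightarrow> 'm \<Rightarrow> 'm tvec). open S \<and> p \<in> S \<and> (\<forall>j<r. vector_field A S (X j)) \<and>
       (\<forall>q\<in>S. \<D> q = span ((\<lambda>j. X j q) ` {..<r}))))"

definition section_of ::
    "('m::topological_space, 'e::euclidean_space) atlas \<Rightarrow> ('m \<Rightarrow> 'm tvec set) \<Rightarrow>
     ('m \<Rightarrow> 'm tvec) \<Rightarrow> bool"
  where "section_of A \<D> X \<longleftrightarrow> vector_field A UNIV X \<and> (\<forall>p. X p \<in> \<D> p)"

definition vec_angle :: "('v \<Rightarrow> 'v \<Rightarrow> real) \<Rightarrow> 'v \<Rightarrow> 'v \<Rightarrow> real"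
  where "vec_angle b v w = arccos (b v w / (sqrt (b v v) * sqrt (b w w)))"

text \<open>The angle between a nonzero vector and a nontrivial linear subspace.\<close>

definition subspace_angle :: "('v \<Rightarrow> 'v \<Rightarrow> real) \<Rightarrow> 'v::zero \<Rightarrow> 'v set \<Rightarrow> real"
  where "subspace_angle b v S = (INF w\<in>S - {0}. vec_angle b v w)"

definition pointwise_slant ::
    "('n::topological_space, 'd::euclidean_space) atlas \<Rightarrow> ('m \<Rightarrow> 'n) \<Rightarrow>
     ('n \<Rightarrow> 'n tvec \<Rightarrow> 'n tvec) \<Rightarrow> ('n \<Rightarrow> 'n tvec \<Rightarrow> 'n tvec \<Rightarrow> real) \<Rightarrow>
     ('m \<Rightarrow> 'm tvec set) \<Rightarrow> ('m \<Rightarrow> real) \<Rightarrow> bool"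
  where "pointwise_slant B F \<phi> g \<D> \<theta> \<longleftrightarrow>
    (\<forall>p. \<theta> p \<noteq> 0 \<and> (\<forall>v\<in>\<D> p - {0}.
       subspace_angle (g (F p)) (\<phi> (F p) (push B F p v)) (push B F p ` \<D> p) = \<theta> p))"

text \<open>The sum of the \<open>\<D> i p\<close> is direct because they are mutually orthogonal.\<close>

definition pointwise_k_slant ::
    "('m::topological_space, 'e::euclidean_space) atlas \<Rightarrow>
     ('n::topological_space, 'd::euclidean_space) atlas \<Rightarrow> ('m \<Rightarrow> 'n) \<Rightarrow>
     ('n \<Rightarrow> 'n tvec \<Rightarrow> 'n tvec) \<Rightarrow> ('n \<Rightarrow> 'n tvec \<Rightarrow> 'n tvec \<Rightarrow> real) \<Rightarrow>
     nat \<Rightarrow> (nat \<Rightarrow> 'm \<Rightarrow> 'm tvec set) \<Rightarrow> (nat \<Rightarrow> 'm \<Rightarrow> real) \<Rightarrow> bool"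
  where "pointwise_k_slant A B F \<phi> g k \<D> \<theta> \<longleftrightarrow>
    k \<ge> 1 \<and>
    (\<forall>i\<le>k. smooth_distribution A (\<D> i)) \<and>
    (\<forall>i\<le>k. \<forall>j\<le>k. i \<noteq> j \<longrightarrow>
       (\<forall>p. \<forall>v\<in>\<D> i p. \<forall>w\<in>\<D> j p. induced_metric B F g p v w = 0)) \<and>
    (\<forall>p. tangent_space A p = {\<Sum>i\<le>k. u i | u. \<forall>i\<le>k. u i \<in> \<D> i p}) \<and>
    (\<forall>i\<in>{1..k}. \<forall>p. T_op A B F \<phi> g p ` \<D> i p \<subseteq> \<D> i p) \<and>
    (\<forall>p. \<phi> (F p) ` push B F p ` \<D> 0 p \<subseteq> push B F p ` \<D> 0 p) \<and>
    (\<forall>i\<in>{1..k}. (\<forall>p. \<D> i p \<noteq> {0}) \<and> pointwise_slant B F \<phi> g (\<D> i) (\<theta> i) \<and>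
       (\<forall>p. \<theta> i p \<in> {0<..pi/2})) \<and>
    (\<forall>i\<in>{1..k}. \<forall>j\<in>{1..k}. i \<noteq> j \<longrightarrow> (\<forall>p. \<theta> i p \<noteq> \<theta> j p)) \<and>
    (\<forall>p. \<theta> 0 p = 0)"


section \<open>Eigenvalue functions\<close>

text \<open>\<open>E\<close> is the set of smooth sections of the bundle. A nonzero section is one that does not
  vanish identically.\<close>

definition eigen_section ::
    "('m \<Rightarrow> 'v::real_vector) set \<Rightarrow> ('m \<Rightarrow> 'v \<Rightarrow> 'v) \<Rightarrow> ('m \<Rightarrow> real) \<Rightarrow> ('m \<Rightarrow> 'v) \<Rightarrow> bool"
  where "eigen_section E L \<mu> W \<longleftrightarrow>
    W \<in> E \<and> (\<exists>p. W p \<noteq> 0) \<and> (\<forall>p. L p (W p) = \<mu> p *\<^sub>R W p)"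

definition eigenvalue_function ::
    "('m \<Rightarrow> 'v::real_vector) set \<Rightarrow> ('m \<Rightarrow> 'v \<Rightarrow> 'v) \<Rightarrow> ('m \<Rightarrow> real) \<Rightarrow> bool"
  where "eigenvalue_function E L \<mu> \<longleftrightarrow> (\<exists>W. eigen_section E L \<mu> W)"

end

theory Submission
  imports Defs
begin

text \<open>Comparing normal parts in \<open>D\<^sub>X (\<phi> Y) = \<phi> (D\<^sub>X Y)\<close> gives
  \<open>(\<nabla>\<^sub>X N) Y = n h(X, Y) - h(X, T Y)\<close>, so \<open>\<nabla>N = 0\<close> means \<open>n h(X, Y) = h(X, T Y)\<close>. Applying this
  twice, \<open>n\<^sup>2 h(X, Y) = h(X, T\<^sup>2 Y)\<close>. Polarizing the slant condition gives \<open>T\<^sup>2 = - cos\<^sup>2 \<theta>\<^sub>i\<close> on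
  the \<open>i\<close>-th distribution, and the symmetry of \<open>h\<close> yields (i) and (ii); (iii) is dual, via
  \<open>g (A\<^sub>V X) Y = g (h(X, Y)) V\<close> and the skew-symmetry of \<open>T\<close>.

  Since the ambient fields are only given along the immersion, the rules of calculus for the induced
  connection are reduced to those of the ambient connection by expanding fields in coordinate
  frames, which span the spaces of point derivations by Hadamard's lemma.\<close>

section \<open>Calculus of \<open>C\<^sup>k\<close> functions\<close>

text \<open>For (i), the second iterate of \<open>n\<close> on \<open>h(X, Y)\<close> can be read
  off from either slot of \<open>h\<close>: from \<open>\<D> 0\<close> the factor is -1, from
  \<open>\<D> i\<close> it is minus the squared cosine of \<open>\<theta> i\<close>. These differ at
  every point, so \<open>h(X, Y)\<close> vanishes. Two circumstances shape the proof. The slant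
  functions carry no smoothness assumption, so they cannot multiply a smooth field; every identity
  is taken at one point \<open>p\<close>, with the value there as a constant \<open>c\<close>, and
  facts known only at \<open>p\<close> are fed into \<open>h\<close> through linearity of a
  connection in its direction. Moreover \<open>h\<close> is the difference of two connections, one
  along the immersion and one intrinsic, and the tangent part is a definite description. That
  \<open>h\<close> is symmetric and normal has to be derived from torsion-freeness and metric
  compatibility; that tangent parts exist and are smooth comes from a Gram-Schmidt process with
  smooth coefficients.\<close>

lemma Ck_on_subset: "Ck_on k S f \<Longrightarrow> S' \<subseteq> S \<Longrightarrow> Ck_on k S' f"
  by (induction k arbitrary: f) (auto intro: continuous_on_subset)

lemma Ck_on_cong_imp:
  assumes "open S"
  shows "(\<And>x. x \<in> S \<Longrightarrow> f x = g x) \<Longrightarrow> Ck_on k S f \<Longrightarrow> Ck_on k S g"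
proof (induction k arbitrary: f g)
  case 0
  then show ?case using continuous_on_cong by (metis Ck_on.simps(1))
next
  case (Suc k)
  have d: "(g has_derivative frechet_derivative f (at x)) (at x)" if "x \<in> S" for x
    using Suc.prems that assms
    by (auto simp: frechet_derivative_works intro: has_derivative_transform_within_open)
  then have "frechet_derivative f (at x) v = frechet_derivative g (at x) v" if "x \<in> S" for x v
    using that frechet_derivative_at by metis
  then have "Ck_on k S (\<lambda>x. frechet_derivative g (at x) v)" for v
    by (rule Suc.IH) (use Suc.prems in auto)
  then show ?case
    using d by (auto simp: differentiable_def)
qed

text \<open>In an induction step any formula for the derivative may be used: uniqueness of
  derivatives identifies it with \<open>frechet_derivative\<close> on \<open>S\<close>, and
  \<open>Ck_on_cong_imp\<close> transfers the regularity, for which \<open>S\<close> has to be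
  open.\<close>

lemma Ck_on_Suc_deriv:
  assumes d: "\<And>x. x \<in> S \<Longrightarrow> (f has_derivative f' x) (at x)"
    and f': "\<And>v. Ck_on k S (\<lambda>x. f' x v)" and S: "open S"
  shows "Ck_on (Suc k) S f"
proof -
  have "f' x v = frechet_derivative f (at x) v" if "x \<in> S" for x v
    using d[OF that] frechet_derivative_at by metis
  then have "Ck_on k S (\<lambda>x. frechet_derivative f (at x) v)" for v
    by (rule Ck_on_cong_imp[OF S _ f'])
  then show ?thesis using d by (auto simp: differentiable_def)
qed

lemma Ck_on_Suc_D: "Ck_on (Suc k) S f \<Longrightarrow> Ck_on k S f"
proof (induction k arbitrary: f)
  case 0
  then show ?case
    by (auto intro!: continuous_at_imp_continuous_on differentiable_imp_continuous_within)
next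
  case (Suc k)
  then show ?case by (metis Ck_on.simps(2))
qed

lemma Ck_on_has_derivative:
  "Ck_on (Suc k) S f \<Longrightarrow> x \<in> S \<Longrightarrow> (f has_derivative frechet_derivative f (at x)) (at x)"
  by (simp add: frechet_derivative_works)

lemma Ck_on_imp_continuous_on: "Ck_on k S f \<Longrightarrow> continuous_on S f"
proof (induction k)
  case (Suc k)
  then show ?case using Ck_on_Suc_D by blast
qed simp

lemma Ck_on_local:
  assumes "\<And>x. x \<in> S \<Longrightarrow> \<exists>T. open T \<and> x \<in> T \<and> Ck_on k T f"
  shows "Ck_on k S f"
  using assms
proof (induction k arbitrary: f)
  case 0
  then show ?case
    by (metis Ck_on.simps(1) continuous_at_imp_continuous_on continuous_on_eq_continuous_at)
next
  case (Suc k)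
  then show ?case by (metis Ck_on.simps(2))
qed

lemma Ck_on_const: "Ck_on k S (\<lambda>x. c)"
  by (induction k arbitrary: c) auto

lemma Ck_on_add:
  assumes "open S"
  shows "Ck_on k S f \<Longrightarrow> Ck_on k S g \<Longrightarrow> Ck_on k S (\<lambda>x. f x + g x)"
proof (induction k arbitrary: f g)
  case (Suc k)
  have "((\<lambda>x. f x + g x) has_derivative
      (\<lambda>v. frechet_derivative f (at x) v + frechet_derivative g (at x) v)) (at x)" if "x \<in> S" for x
    using Suc.prems that by (intro has_derivative_add Ck_on_has_derivative)
  then show ?case
    by (rule Ck_on_Suc_deriv[OF _ Suc.IH assms]) (use Suc.prems in auto)
qed (auto intro: continuous_on_add)

lemma Ck_on_sum:
  assumes "open S" and "\<And>i. i \<in> I \<Longrightarrow> Ck_on k S (f i)"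
  shows "Ck_on k S (\<lambda>x. \<Sum>i\<in>I. f i x)"
  using assms(2)
  by (induction I rule: infinite_finite_induct) (auto intro!: Ck_on_const Ck_on_add assms(1))

lemma Ck_on_bounded_linear:
  assumes "open S" "bounded_linear L"
  shows "Ck_on k S f \<Longrightarrow> Ck_on k S (\<lambda>x. L (f x))"
proof (induction k arbitrary: f)
  case 0
  then show ?case unfolding Ck_on.simps by (rule bounded_linear.continuous_on[OF assms(2)])
next
  case (Suc k)
  have "((\<lambda>x. L (f x)) has_derivative (\<lambda>v. L (frechet_derivative f (at x) v))) (at x)"
    if "x \<in> S" for x
    by (rule bounded_linear.has_derivative[OF assms(2) Ck_on_has_derivative[OF Suc.prems that]])
  then show ?case
    by (rule Ck_on_Suc_deriv[OF _ Suc.IH assms(1)]) (use Suc.prems in auto)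
qed

lemma Ck_on_mult:
  fixes f g :: "'a::euclidean_space \<Rightarrow> real"
  assumes "open S"
  shows "Ck_on k S f \<Longrightarrow> Ck_on k S g \<Longrightarrow> Ck_on k S (\<lambda>x. f x * g x)"
proof (induction k arbitrary: f g)
  case (Suc k)
  have "((\<lambda>x. f x * g x) has_derivative
      (\<lambda>v. f x * frechet_derivative g (at x) v + frechet_derivative f (at x) v * g x)) (at x)"
    if "x \<in> S" for x
    using Suc.prems that by (intro has_derivative_mult Ck_on_has_derivative)
  then show ?case
    \<comment> \<open>The product rule contains the undifferentiated factors, so these are wanted at
      the lower order, which \<open>Ck_on_Suc_D\<close> supplies.\<close>
    by (rule Ck_on_Suc_deriv[OF _ Ck_on_add[OF assms Suc.IH Suc.IH] assms])
      (use Suc.prems Ck_on_Suc_D[OF Suc.prems(1)] Ck_on_Suc_D[OF Suc.prems(2)] in auto)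
qed (auto intro: continuous_on_mult)

lemma Ck_on_inverse:
  fixes f :: "'a::euclidean_space \<Rightarrow> real"
  assumes "open S" "\<And>x. x \<in> S \<Longrightarrow> f x \<noteq> 0"
  shows "Ck_on k S f \<Longrightarrow> Ck_on k S (\<lambda>x. inverse (f x))"
proof (induction k)
  case 0
  then show ?case using assms(2) by (auto intro: continuous_on_inverse)
next
  case (Suc k)
  have d: "((\<lambda>x. inverse (f x)) has_derivative
      (\<lambda>v. (- 1) * (inverse (f x) * frechet_derivative f (at x) v * inverse (f x)))) (at x)" if "x \<in> S" for x
    using Deriv.has_derivative_inverse[OF assms(2)[OF that] Ck_on_has_derivative[OF Suc.prems that]] by simp
  have i: "Ck_on k S (\<lambda>x. inverse (f x))" using Suc Ck_on_Suc_D by blast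
  show ?case
    by (rule Ck_on_Suc_deriv[OF d _ assms(1)])
      (assumption, use Suc.prems in \<open>intro Ck_on_mult Ck_on_const i assms(1), simp\<close>)
qed

lemma frechet_derivative_eq_sum_Basis:
  fixes f :: "'a::euclidean_space \<Rightarrow> 'b::real_normed_vector"
  assumes "f differentiable (at x)"
  shows "frechet_derivative f (at x) v = (\<Sum>b\<in>Basis. (v \<bullet> b) *\<^sub>R frechet_derivative f (at x) b)"
proof -
  have "linear (frechet_derivative f (at x))"
    using assms by (simp add: linear_frechet_derivative)
  then show ?thesis
    by (subst euclidean_representation[of v, symmetric]) (simp only: linear_sum linear_cmul)
qed

text \<open>The chain rule is written in a basis: the derivative is a finite sum of components of
  the derivative of \<open>f\<close> times partial derivatives of \<open>h\<close> at
  \<open>f x\<close>. Only \<open>h\<close> varies in the induction, since its partial derivatives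
  are again composed with the same \<open>f\<close>.\<close>

lemma Ck_on_compose:
  fixes f :: "'a::euclidean_space \<Rightarrow> 'b::euclidean_space" and h :: "'b \<Rightarrow> real"
  assumes "open S" and "f ` S \<subseteq> T"
  shows "Ck_on k S f \<Longrightarrow> Ck_on k T h \<Longrightarrow> Ck_on k S (\<lambda>x. h (f x))"
proof (induction k arbitrary: h)
  case 0
  then show ?case using assms(2) by (auto intro: continuous_on_compose2)
next
  case (Suc k)
  have *: "frechet_derivative h (at (f x)) v = (\<Sum>b\<in>Basis. (v \<bullet> b) * frechet_derivative h (at (f x)) b)"
    if "x \<in> S" for x v
    using Suc.prems(2) that assms(2) by (subst frechet_derivative_eq_sum_Basis) auto
  have "((\<lambda>x. h (f x)) has_derivative
      (\<lambda>v. frechet_derivative h (at (f x)) (frechet_derivative f (at x) v))) (at x)" if "x \<in> S" for x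
    using Suc.prems that assms(2)
    by (intro has_derivative_compose[OF Ck_on_has_derivative Ck_on_has_derivative]) auto
  then have d: "((\<lambda>x. h (f x)) has_derivative
      (\<lambda>v. \<Sum>b\<in>Basis. (frechet_derivative f (at x) v \<bullet> b) * frechet_derivative h (at (f x)) b)) (at x)"
    if "x \<in> S" for x
    unfolding *[OF that, symmetric] using that by blast
  show ?case
  proof (rule Ck_on_Suc_deriv[OF d _ assms(1)])
    fix v
    have "Ck_on k S (\<lambda>x. frechet_derivative f (at x) v \<bullet> b)" for b
      using Ck_on_bounded_linear[OF assms(1) bounded_linear_inner_left] Suc.prems by fastforce
    then show "Ck_on k S (\<lambda>x. \<Sum>b\<in>Basis. (frechet_derivative f (at x) v \<bullet> b) *
        frechet_derivative h (at (f x)) b)"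
      using Suc.IH[OF Ck_on_Suc_D[OF Suc.prems(1)], of "\<lambda>y. frechet_derivative h (at y) b" for b]
        Suc.prems(2)
      by (intro Ck_on_sum[OF assms(1)] Ck_on_mult[OF assms(1)]) simp_all
  qed
qed

text \<open>These are the remainder integrals of Hadamard's lemma. Differentiating under the
  integral sign replaces \<open>f\<close> by a directional derivative and brings out a factor
  \<open>t\<close> from the inner map; the weight \<open>t ^ m\<close> absorbs it, so the induction
  hypothesis applies with \<open>Suc m\<close>.\<close>

lemma Ck_on_ray_integral:
  fixes f :: "'a::euclidean_space \<Rightarrow> real"
  assumes S: "open S" "convex S" "x0 \<in> S"
  shows "Ck_on k S f \<Longrightarrow> Ck_on k S (\<lambda>x. integral (cbox 0 1) (\<lambda>t. t ^ m * f (x0 + t *\<^sub>R (x - x0))))"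
proof (induction k arbitrary: m f)
  case 0
  have in_S: "x0 + t *\<^sub>R (x - x0) \<in> S" if "x \<in> S" "0 \<le> t" "t \<le> 1" for x t
    using convexD_alt[OF S(2) S(3) that(1), of t] that by (simp add: algebra_simps)
  have "continuous_on (S \<times> cbox 0 1) (\<lambda>(x, t). t ^ m * f (x0 + t *\<^sub>R (x - x0)))"
    using 0 in_S by (auto simp: split_beta intro!: continuous_intros continuous_on_compose2[of S f])
  then show ?case unfolding Ck_on.simps by (rule integral_continuous_on_param)
next
  case (Suc k)
  have in_S: "x0 + t *\<^sub>R (x - x0) \<in> S" if "x \<in> S" "0 \<le> t" "t \<le> 1" for x t
    using convexD_alt[OF S(2) S(3) that(1), of t] that by (simp add: algebra_simps)
  \<comment> \<open>The Leibniz rule for parameter integrals wants the derivative as a continuous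
    map into the bounded linear functions. Continuity there follows from continuity in each
    direction, the dimension being finite.\<close>
  define F' where "F' x = Blinfun (frechet_derivative f (at x))" for x
  have F': "blinfun_apply (F' x) = frechet_derivative f (at x)" if "x \<in> S" for x
    unfolding F'_def using Suc.prems that
    by (intro bounded_linear_Blinfun_apply) (auto simp: frechet_derivative_works has_derivative_def)
  have "continuous_on S (\<lambda>x. F' x i)" for i
  proof -
    have "continuous_on S (\<lambda>x. frechet_derivative f (at x) i)"
      using Suc.prems by (auto intro: Ck_on_imp_continuous_on)
    then show ?thesis using F' continuous_on_cong by force
  qed
  then have contF': "continuous_on S F'" by (intro continuous_on_blinfun_componentwise)
  have cont: "continuous_on S f" using Suc.prems by (rule Ck_on_imp_continuous_on)
  have d: "((\<lambda>x. integral (cbox 0 1) (\<lambda>t. t ^ m * f (x0 + t *\<^sub>R (x - x0)))) has_derivative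
      (\<lambda>v. integral (cbox 0 1) (\<lambda>t. t ^ Suc m * frechet_derivative f (at (x0 + t *\<^sub>R (x - x0))) v))) (at x)"
    if x: "x \<in> S" for x
  proof -
    have c: "continuous_on (S \<times> cbox 0 1) (\<lambda>(x, t). t ^ Suc m *\<^sub>R F' (x0 + t *\<^sub>R (x - x0)))"
      using in_S by (auto simp: split_beta intro!: continuous_intros continuous_on_compose2[OF contF'])
    have "((\<lambda>x. integral (cbox 0 1) (\<lambda>t. t ^ m * f (x0 + t *\<^sub>R (x - x0)))) has_derivative
      integral (cbox 0 1) (\<lambda>t. t ^ Suc m *\<^sub>R F' (x0 + t *\<^sub>R (x - x0)))) (at x within S)"
    proof (rule leibniz_rule[OF _ _ c x S(2)])
      fix y and t :: real assume y: "y \<in> S" and t: "t \<in> cbox 0 1"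
      have "((\<lambda>y. f (x0 + t *\<^sub>R (y - x0))) has_derivative
          (\<lambda>v. frechet_derivative f (at (x0 + t *\<^sub>R (y - x0))) (t *\<^sub>R v))) (at y within S)"
        using in_S[OF y] t
        by (intro has_derivative_compose[of "\<lambda>y. x0 + t *\<^sub>R (y - x0)" _ _ _ f]
              Ck_on_has_derivative[OF Suc.prems])
          (auto intro!: derivative_eq_intros)
      moreover have "frechet_derivative f (at (x0 + t *\<^sub>R (y - x0))) (t *\<^sub>R v) =
          t * frechet_derivative f (at (x0 + t *\<^sub>R (y - x0))) v" for v
        using Suc.prems in_S[OF y, of t] t linear_cmul[OF linear_frechet_derivative] by fastforce
      ultimately show "((\<lambda>x. t ^ m * f (x0 + t *\<^sub>R (x - x0))) has_derivative
         blinfun_apply (t ^ Suc m *\<^sub>R F' (x0 + t *\<^sub>R (y - x0)))) (at y within S)"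
        using F'[OF in_S[OF y, of t]] t
        by (auto simp: scaleR_blinfun.rep_eq mult_ac intro!: derivative_eq_intros)
    next
      fix y assume "y \<in> S"
      then show "(\<lambda>t. t ^ m * f (x0 + t *\<^sub>R (y - x0))) integrable_on cbox 0 1"
        using in_S by (intro integrable_continuous continuous_intros continuous_on_compose2[OF cont]) auto
    qed
    moreover have "blinfun_apply (integral (cbox 0 1) (\<lambda>t. t ^ Suc m *\<^sub>R F' (x0 + t *\<^sub>R (x - x0)))) v =
       integral (cbox 0 1) (\<lambda>t. t ^ Suc m * frechet_derivative f (at (x0 + t *\<^sub>R (x - x0))) v)" for v
    proof -
      have "(\<lambda>t. t ^ Suc m *\<^sub>R F' (x0 + t *\<^sub>R (x - x0))) integrable_on cbox 0 1"
        using in_S x by (intro integrable_continuous continuous_intros continuous_on_compose2[OF contF']) auto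
      then have "blinfun_apply (integral (cbox 0 1) (\<lambda>t. t ^ Suc m *\<^sub>R F' (x0 + t *\<^sub>R (x - x0)))) v =
          integral (cbox 0 1) (\<lambda>t. blinfun_apply (t ^ Suc m *\<^sub>R F' (x0 + t *\<^sub>R (x - x0))) v)"
        by (rule blinfun_apply_integral)
      also have "\<dots> = integral (cbox 0 1) (\<lambda>t. t ^ Suc m * frechet_derivative f (at (x0 + t *\<^sub>R (x - x0))) v)"
        using F'[OF in_S[OF x]] by (intro integral_cong) (auto simp: scaleR_blinfun.rep_eq)
      finally show ?thesis .
    qed
    ultimately show ?thesis
      using at_within_open[OF x S(1)] by (metis (no_types, lifting) ext)
  qed
  show ?case
    by (rule Ck_on_Suc_deriv[OF d Suc.IH S(1)]) (use Suc.prems in auto)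
qed

lemma smooth_on_subset: "smooth_on S f \<Longrightarrow> S' \<subseteq> S \<Longrightarrow> smooth_on S' f"
  unfolding smooth_on_def using Ck_on_subset by blast

lemma smooth_on_has_derivative:
  "smooth_on S f \<Longrightarrow> x \<in> S \<Longrightarrow> (f has_derivative frechet_derivative f (at x)) (at x)"
  unfolding smooth_on_def using Ck_on_has_derivative by blast

lemma smooth_on_imp_continuous_on: "smooth_on S f \<Longrightarrow> continuous_on S f"
  unfolding smooth_on_def by (metis Ck_on.simps(1))

lemma smooth_on_derivative: "smooth_on S f \<Longrightarrow> smooth_on S (\<lambda>x. frechet_derivative f (at x) v)"
  unfolding smooth_on_def by (metis Ck_on.simps(2))

lemma smooth_on_cong_imp:
  "open S \<Longrightarrow> smooth_on S f \<Longrightarrow> (\<And>x. x \<in> S \<Longrightarrow> f x = g x) \<Longrightarrow> smooth_on S g"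
  unfolding smooth_on_def by (metis Ck_on_cong_imp)

lemma smooth_on_local:
  "(\<And>x. x \<in> S \<Longrightarrow> \<exists>T. open T \<and> x \<in> T \<and> smooth_on T f) \<Longrightarrow> smooth_on S f"
  unfolding smooth_on_def by (intro allI Ck_on_local) meson

lemma smooth_on_const: "smooth_on S (\<lambda>x. c)"
  unfolding smooth_on_def by (simp add: Ck_on_const)

lemma smooth_on_add:
  "open S \<Longrightarrow> smooth_on S f \<Longrightarrow> smooth_on S g \<Longrightarrow> smooth_on S (\<lambda>x. f x + g x)"
  unfolding smooth_on_def by (simp add: Ck_on_add)

lemma smooth_on_mult:
  fixes f g :: "'a::euclidean_space \<Rightarrow> real"
  shows "open S \<Longrightarrow> smooth_on S f \<Longrightarrow> smooth_on S g \<Longrightarrow> smooth_on S (\<lambda>x. f x * g x)"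
  unfolding smooth_on_def by (simp add: Ck_on_mult)

lemma smooth_on_inverse:
  fixes f :: "'a::euclidean_space \<Rightarrow> real"
  shows "open S \<Longrightarrow> (\<And>x. x \<in> S \<Longrightarrow> f x \<noteq> 0) \<Longrightarrow> smooth_on S f \<Longrightarrow> smooth_on S (\<lambda>x. inverse (f x))"
  unfolding smooth_on_def by (simp add: Ck_on_inverse)

lemma smooth_on_compose:
  fixes f :: "'a::euclidean_space \<Rightarrow> 'b::euclidean_space" and h :: "'b \<Rightarrow> real"
  shows "open S \<Longrightarrow> f ` S \<subseteq> T \<Longrightarrow> smooth_on S f \<Longrightarrow> smooth_on T h \<Longrightarrow> smooth_on S (\<lambda>x. h (f x))"
  unfolding smooth_on_def by (simp add: Ck_on_compose)

lemma smooth_on_bounded_linear: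
  assumes "open S" "bounded_linear L"
  shows "smooth_on S L"
proof -
  have "Ck_on k S L" for k
  proof (cases k)
    case 0
    then show ?thesis using assms(2) by (simp add: linear_continuous_on)
  next
    case (Suc j)
    have "Ck_on (Suc j) S L"
      by (rule Ck_on_Suc_deriv[OF bounded_linear_imp_has_derivative[OF assms(2)] Ck_on_const assms(1)])
    then show ?thesis using Suc by simp
  qed
  then show ?thesis unfolding smooth_on_def by blast
qed

text \<open>Integrating the derivative of \<open>f\<close> along the segment from \<open>x0\<close>
  to \<open>x\<close> gives the increment of \<open>f\<close>; convexity keeps the segment in
  \<open>S\<close>. The coefficient \<open>G b\<close> is the mean of the partial derivative in
  direction \<open>b\<close> over that segment.\<close>

lemma hadamard:
  fixes f :: "'a::euclidean_space \<Rightarrow> real"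
  assumes "open S" "convex S" "x0 \<in> S" "smooth_on S f"
  obtains G where "\<And>b. smooth_on S (G b)"
    and "\<And>x. x \<in> S \<Longrightarrow> f x = f x0 + (\<Sum>b\<in>Basis. ((x - x0) \<bullet> b) * G b x)"
    and "\<And>b. G b x0 = frechet_derivative f (at x0) b"
proof -
  \<comment> \<open>The factor \<open>t ^ 0\<close> is there to match
    \<open>Ck_on_ray_integral\<close> with exponent 0.\<close>
  define G where "G b x = integral (cbox 0 1) (\<lambda>t::real. t ^ 0 * frechet_derivative f (at (x0 + t *\<^sub>R (x - x0))) b)"
    for b x
  have "smooth_on S (G b)" for b
    using assms smooth_on_derivative[OF assms(4), of b] Ck_on_ray_integral[OF assms(1-3), of _ _ 0]
    unfolding smooth_on_def G_def by blast
  moreover have "f x = f x0 + (\<Sum>b\<in>Basis. ((x - x0) \<bullet> b) * G b x)" if x: "x \<in> S" for x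
  proof -
    have in_S: "x0 + t *\<^sub>R (x - x0) \<in> S" if "0 \<le> t" "t \<le> 1" for t
      using convexD_alt[OF assms(2,3) x, of t] that by (simp add: algebra_simps)
    have d: "((\<lambda>t. f (x0 + t *\<^sub>R (x - x0))) has_vector_derivative
        (\<Sum>b\<in>Basis. ((x - x0) \<bullet> b) * frechet_derivative f (at (x0 + t *\<^sub>R (x - x0))) b)) (at t within {0..1})"
      if t: "t \<in> {0..1}" for t
    proof -
      have D: "(f has_derivative frechet_derivative f (at (x0 + t *\<^sub>R (x - x0)))) (at (x0 + t *\<^sub>R (x - x0)))"
        using in_S t assms(4) by (auto intro: smooth_on_has_derivative)
      have "((\<lambda>t. f (x0 + t *\<^sub>R (x - x0))) has_derivative
          (\<lambda>s. frechet_derivative f (at (x0 + t *\<^sub>R (x - x0))) (s *\<^sub>R (x - x0)))) (at t within {0..1})"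
        by (rule has_derivative_compose[where f = "\<lambda>t. x0 + t *\<^sub>R (x - x0)", OF _ D])
          (auto intro!: derivative_eq_intros)
      moreover have "frechet_derivative f (at (x0 + t *\<^sub>R (x - x0))) (s *\<^sub>R (x - x0)) =
         s *\<^sub>R (\<Sum>b\<in>Basis. ((x - x0) \<bullet> b) * frechet_derivative f (at (x0 + t *\<^sub>R (x - x0))) b)" for s
      proof -
        have diff: "f differentiable (at (x0 + t *\<^sub>R (x - x0)))" using D differentiable_def by blast
        show ?thesis
          unfolding linear_cmul[OF linear_frechet_derivative[OF diff]]
          by (subst frechet_derivative_eq_sum_Basis[OF diff]) simp
      qed
      ultimately show ?thesis by (simp add: has_vector_derivative_def)
    qed
    have "((\<lambda>t. \<Sum>b\<in>Basis. ((x - x0) \<bullet> b) * frechet_derivative f (at (x0 + t *\<^sub>R (x - x0))) b)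
        has_integral (f (x0 + 1 *\<^sub>R (x - x0)) - f (x0 + 0 *\<^sub>R (x - x0)))) {0..1}"
      by (rule fundamental_theorem_of_calculus) (use d in auto)
    moreover have "((\<lambda>t. \<Sum>b\<in>Basis. ((x - x0) \<bullet> b) * frechet_derivative f (at (x0 + t *\<^sub>R (x - x0))) b)
        has_integral (\<Sum>b\<in>Basis. ((x - x0) \<bullet> b) * G b x)) {0..1}"
    proof -
      have cont: "continuous_on S (\<lambda>y. frechet_derivative f (at y) b)" for b
        by (rule smooth_on_imp_continuous_on[OF smooth_on_derivative[OF assms(4)]])
      have "continuous_on {0..1} (\<lambda>t. frechet_derivative f (at (x0 + t *\<^sub>R (x - x0))) b)" for b
        by (rule continuous_on_compose2[OF cont, where f = "\<lambda>t. x0 + t *\<^sub>R (x - x0)"])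
          (use in_S in \<open>auto intro!: continuous_intros\<close>)
      then have "((\<lambda>t. frechet_derivative f (at (x0 + t *\<^sub>R (x - x0))) b) has_integral G b x) {0..1}" for b
        unfolding G_def by (simp add: integrable_integral integrable_continuous_interval)
      then show ?thesis
        by (rule has_integral_sum[OF finite_Basis has_integral_mult_right])
    qed
    ultimately show ?thesis by (auto dest: has_integral_unique)
  qed
  moreover have "G b x0 = frechet_derivative f (at x0) b" for b
    unfolding G_def by simp
  ultimately show ?thesis using that by blast
qed

section \<open>Smooth functions and tangent vectors\<close>

lemma sum_fun_apply: "(\<Sum>i\<in>I. f i) x = (\<Sum>i\<in>I. f i x)"
  for f :: "'i \<Rightarrow> 'a \<Rightarrow> 'b::comm_monoid_add"
  by (induction I rule: infinite_finite_induct) auto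

lemma scaleR_fun_apply: "(r *\<^sub>R f) x = r *\<^sub>R f x"
  by (simp add: scaleR_fun_def)

lemma smooth_fun_iff:
  "smooth_fun A S f \<longleftrightarrow> (\<forall>U c. (U, c) \<in> A \<longrightarrow> smooth_on (c ` (U \<inter> S)) (\<lambda>x. f (inv_into U c x)))"
  unfolding smooth_fun_def o_def by fastforce

lemma smooth_fun_subset: "smooth_fun A S f \<Longrightarrow> S' \<subseteq> S \<Longrightarrow> smooth_fun A S' f"
  unfolding smooth_fun_iff by (meson Int_mono image_mono order_refl smooth_on_subset)

lemma smooth_fun_const: "smooth_fun A S (\<lambda>x. r)"
  unfolding smooth_fun_iff by (simp add: smooth_on_const)

text \<open>This is the partial derivative in direction \<open>b\<close> with respect to the chart
  \<open>(U, c)\<close>, as a point derivation; the value 0 on functions that are not smooth near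
  \<open>p\<close> follows the convention of \<open>tangent_space\<close>.\<close>

definition coord_vec :: "('m::topological_space, 'e::euclidean_space) atlas \<Rightarrow> 'm set \<Rightarrow> ('m \<Rightarrow> 'e) \<Rightarrow>
    'e \<Rightarrow> 'm \<Rightarrow> 'm tvec"
  where "coord_vec A U c b p f =
    (if smooth_at A p f then frechet_derivative (\<lambda>x. f (inv_into U c x)) (at (c p)) b else 0)"

locale smooth_manifold =
  fixes A :: "('m::{t2_space,second_countable_topology}, 'e::euclidean_space) atlas"
  assumes atlas: "smooth_atlas A"
begin

lemma chart_at: obtains U c where "(U, c) \<in> A" "p \<in> U"
proof -
  have "p \<in> (\<Union>(U, c)\<in>A. U)" using atlas unfolding smooth_atlas_def by simp
  then show ?thesis using that by auto
qed

lemma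
  assumes "(U, c) \<in> A"
  shows open_chart: "open U" and homeomorphism_chart: "homeomorphism U (c ` U) c (inv_into U c)"
    and open_chart_range: "open (c ` U)"
  using atlas assms unfolding smooth_atlas_def by auto

lemma chart_inverse: "(U, c) \<in> A \<Longrightarrow> p \<in> U \<Longrightarrow> inv_into U c (c p) = p"
  using homeomorphism_chart unfolding homeomorphism_def by metis

lemma open_chart_image:
  assumes "(U, c) \<in> A" "open S"
  shows "open (c ` (U \<inter> S))"
proof -
  have "c ` (U \<inter> S) = c ` U \<inter> inv_into U c -` S"
    using chart_inverse[OF assms(1)] by force
  then show ?thesis
    using homeomorphism_chart[OF assms(1)] open_chart_range[OF assms(1)] assms(2)
    by (metis continuous_on_open_vimage homeomorphism_def inf_commute)
qed

lemma open_chart_preimage: "(U, c) \<in> A \<Longrightarrow> open S \<Longrightarrow> open (U \<inter> c -` S)"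
  using homeomorphism_chart[of U c] open_chart[of U c]
  by (simp add: continuous_open_preimage homeomorphism_def)

lemma smooth_transition:
  "(U, c) \<in> A \<Longrightarrow> (V, d) \<in> A \<Longrightarrow> smooth_on (c ` (U \<inter> V)) (\<lambda>x. d (inv_into U c x))"
  using atlas unfolding smooth_atlas_def o_def by fast

lemma smooth_fun_cong:
  assumes "open S" "smooth_fun A S f" "\<And>p. p \<in> S \<Longrightarrow> f p = f' p"
  shows "smooth_fun A S f'"
  unfolding smooth_fun_iff
proof (intro allI impI)
  fix U c assume U: "(U, c) \<in> A"
  have "smooth_on (c ` (U \<inter> S)) (\<lambda>x. f (inv_into U c x))"
    using assms(2) U unfolding smooth_fun_iff by blast
  then show "smooth_on (c ` (U \<inter> S)) (\<lambda>x. f' (inv_into U c x))"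
    by (rule smooth_on_cong_imp[OF open_chart_image[OF U assms(1)]])
      (use assms(3) chart_inverse[OF U] in auto)
qed

lemma smooth_fun_local:
  assumes "\<And>p. p \<in> S \<Longrightarrow> \<exists>T. open T \<and> p \<in> T \<and> smooth_fun A T f"
  shows "smooth_fun A S f"
  unfolding smooth_fun_iff
proof (intro allI impI)
  fix U c assume U: "(U, c) \<in> A"
  show "smooth_on (c ` (U \<inter> S)) (\<lambda>x. f (inv_into U c x))"
  proof (rule smooth_on_local)
    fix x assume "x \<in> c ` (U \<inter> S)"
    then obtain p where p: "p \<in> U" "p \<in> S" "x = c p" by auto
    from assms[OF p(2)] obtain T where T: "open T" "p \<in> T" "smooth_fun A T f" by auto
    show "\<exists>T. open T \<and> x \<in> T \<and> smooth_on T (\<lambda>x. f (inv_into U c x))"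
    proof (intro exI conjI)
      show "open (c ` (U \<inter> T))" using U T by (simp add: open_chart_image)
      show "x \<in> c ` (U \<inter> T)" using p T by auto
      show "smooth_on (c ` (U \<inter> T)) (\<lambda>x. f (inv_into U c x))"
        using T U unfolding smooth_fun_iff by auto
    qed
  qed
qed

lemma smooth_fun_add:
  "open S \<Longrightarrow> smooth_fun A S f \<Longrightarrow> smooth_fun A S f' \<Longrightarrow> smooth_fun A S (\<lambda>x. f x + f' x)"
  unfolding smooth_fun_iff by (auto intro!: smooth_on_add open_chart_image)

lemma smooth_fun_mult:
  "open S \<Longrightarrow> smooth_fun A S f \<Longrightarrow> smooth_fun A S f' \<Longrightarrow> smooth_fun A S (\<lambda>x. f x * f' x)"
  unfolding smooth_fun_iff by (auto intro!: smooth_on_mult open_chart_image)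

lemma smooth_fun_inverse:
  assumes "open S" "smooth_fun A S f" "\<And>x. x \<in> S \<Longrightarrow> f x \<noteq> 0"
  shows "smooth_fun A S (\<lambda>x. inverse (f x))"
  using assms chart_inverse unfolding smooth_fun_iff
  by (auto intro!: smooth_on_inverse open_chart_image)

text \<open>One chart around \<open>S\<close> suffices because every other coordinate expression
  arises from this one by composition with a smooth transition map.\<close>

lemma smooth_fun_chartI:
  assumes U: "(U, c) \<in> A" and S: "open S" "S \<subseteq> U"
    and f: "smooth_on (c ` S) (\<lambda>x. f (inv_into U c x))"
  shows "smooth_fun A S f"
  unfolding smooth_fun_iff
proof (intro allI impI)
  fix V d assume V: "(V, d) \<in> A"
  have eq: "inv_into V d x \<in> V \<inter> S" "d (inv_into V d x) = x" if "x \<in> d ` (V \<inter> S)" for x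
    using that chart_inverse[OF V] by auto
  have o: "open (d ` (V \<inter> S))" by (rule open_chart_image[OF V S(1)])
  have s: "smooth_on (d ` (V \<inter> S)) (\<lambda>x. c (inv_into V d x))"
    by (rule smooth_on_subset[OF smooth_transition[OF V U]]) (use S in auto)
  have "smooth_on (d ` (V \<inter> S)) (\<lambda>x. f (inv_into U c (c (inv_into V d x))))"
    by (rule smooth_on_compose[OF o _ s f]) (use eq in auto)
  then show "smooth_on (d ` (V \<inter> S)) (\<lambda>x. f (inv_into V d x))"
    by (rule smooth_on_cong_imp[OF o]) (use S chart_inverse[OF U] chart_inverse[OF V] in auto)
qed

lemma smooth_fun_of_coordinates:
  assumes U: "(U, c) \<in> A" and "open S" "open R" "smooth_on R G" and "S \<subseteq> U" "c ` S \<subseteq> R"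
  shows "smooth_fun A S (\<lambda>q. G (c q))"
proof (rule smooth_fun_chartI[OF U \<open>open S\<close> \<open>S \<subseteq> U\<close>])
  have o: "open (c ` S)"
    using open_chart_image[OF U \<open>open S\<close>] \<open>S \<subseteq> U\<close> by (simp add: Int_absorb1)
  have "smooth_on (c ` S) G" using assms by (metis smooth_on_subset)
  then show "smooth_on (c ` S) (\<lambda>x. G (c (inv_into U c x)))"
    by (rule smooth_on_cong_imp[OF o]) (use chart_inverse[OF U] \<open>S \<subseteq> U\<close> in auto)
qed

lemma smooth_fun_coordinate: "(U, c) \<in> A \<Longrightarrow> smooth_fun A U (\<lambda>q. c q \<bullet> b)"
  by (rule smooth_fun_of_coordinates[where G = "\<lambda>x. x \<bullet> b", OF _ _ open_UNIV])
    (auto simp: open_chart intro: smooth_on_bounded_linear bounded_linear_inner_left)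

lemma smooth_atI: "open S \<Longrightarrow> p \<in> S \<Longrightarrow> smooth_fun A S f \<Longrightarrow> smooth_at A p f"
  unfolding smooth_at_def by blast

lemma smooth_at2:
  assumes "smooth_at A p f" "smooth_at A p f'"
  obtains S where "open S" "p \<in> S" "smooth_fun A S f" "smooth_fun A S f'"
proof -
  from assms obtain S S' where S: "open S" "p \<in> S" "smooth_fun A S f" and
    S': "open S'" "p \<in> S'" "smooth_fun A S' f'"
    unfolding smooth_at_def by auto
  show ?thesis
    by (rule that[of "S \<inter> S'"]) (use S S' in \<open>auto intro: smooth_fun_subset\<close>)
qed

lemma smooth_at_add:
  assumes "smooth_at A p f" "smooth_at A p f'"
  shows "smooth_at A p (\<lambda>x. f x + f' x)"
  by (rule smooth_at2[OF assms]) (rule smooth_atI[OF _ _ smooth_fun_add])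

lemma smooth_at_mult:
  assumes "smooth_at A p f" "smooth_at A p f'"
  shows "smooth_at A p (\<lambda>x. f x * f' x)"
  by (rule smooth_at2[OF assms]) (rule smooth_atI[OF _ _ smooth_fun_mult])

lemma smooth_at_const: "smooth_at A p (\<lambda>x. r)"
  by (rule smooth_atI[OF open_UNIV UNIV_I smooth_fun_const])

lemma smooth_at_sum:
  "(\<And>i. i \<in> I \<Longrightarrow> smooth_at A p (f i)) \<Longrightarrow> smooth_at A p (\<lambda>x. \<Sum>i\<in>I. f i x)"
  by (induction I rule: infinite_finite_induct) (simp_all add: smooth_at_const smooth_at_add)

lemma smooth_at_cong:
  assumes "open S" "p \<in> S" "\<And>q. q \<in> S \<Longrightarrow> f q = f' q" "smooth_at A p f"
  shows "smooth_at A p f'"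
proof -
  from assms(4) obtain R where R: "open R" "p \<in> R" "smooth_fun A R f"
    unfolding smooth_at_def by auto
  have "smooth_fun A (S \<inter> R) f'"
    by (rule smooth_fun_cong[of _ f]) (use assms R in \<open>auto intro: smooth_fun_subset\<close>)
  then show ?thesis using assms R by (intro smooth_atI[of "S \<inter> R"]) auto
qed

section \<open>Tangent vectors as point derivations\<close>

lemma tangent_not_smooth: "v \<in> tangent_space A p \<Longrightarrow> \<not> smooth_at A p f \<Longrightarrow> v f = 0"
  unfolding tangent_space_def by auto

lemma tangent_add: "v \<in> tangent_space A p \<Longrightarrow> smooth_at A p f \<Longrightarrow> smooth_at A p f' \<Longrightarrow>
    v (\<lambda>x. f x + f' x) = v f + v f'"
  unfolding tangent_space_def by auto

lemma tangent_mult: "v \<in> tangent_space A p \<Longrightarrow> smooth_at A p f \<Longrightarrow> smooth_at A p f' \<Longrightarrow>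
    v (\<lambda>x. f x * f' x) = f p * v f' + f' p * v f"
  unfolding tangent_space_def by auto

lemma tangent_cmult: "v \<in> tangent_space A p \<Longrightarrow> smooth_at A p f \<Longrightarrow> v (\<lambda>x. r * f x) = r * v f"
  unfolding tangent_space_def by auto

text \<open>The Leibniz rule for the product of 1 with itself makes the value of \<open>v\<close> at
  1 equal to its own double.\<close>

lemma tangent_const:
  assumes "v \<in> tangent_space A p"
  shows "v (\<lambda>x. r) = 0"
  using tangent_mult[OF assms smooth_at_const[of _ 1] smooth_at_const[of _ 1]]
    tangent_cmult[OF assms smooth_at_const[of _ 1], of r] by simp

lemma tangent_sum:
  assumes "v \<in> tangent_space A p"
  shows "(\<And>i. i \<in> I \<Longrightarrow> smooth_at A p (f i)) \<Longrightarrow> v (\<lambda>x. \<Sum>i\<in>I. f i x) = (\<Sum>i\<in>I. v (f i))"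
  by (induction I rule: infinite_finite_induct)
    (simp_all add: tangent_const[OF assms] tangent_add[OF assms] smooth_at_sum)

lemma subspace_tangent_space: "subspace (tangent_space A p)"
  unfolding subspace_def tangent_space_def
  by (auto simp: scaleR_fun_apply algebra_simps)

text \<open>A function that vanishes near \<open>p\<close> is its own product with the indicator function of the
  complement of a neighbourhood, which is smooth near \<open>p\<close>; so no bump functions are needed.\<close>

lemma tangent_germ:
  assumes v: "v \<in> tangent_space A p" and S: "open S" "p \<in> S"
    and eq: "\<And>q. q \<in> S \<Longrightarrow> f q = f' q"
  shows "v f = v f'"
proof (cases "smooth_at A p f")
  case True
  then have f': "smooth_at A p f'" using S eq smooth_at_cong by blast
  define u where "u = (\<lambda>q. f q - f' q)"
  define w :: "'m \<Rightarrow> real" where "w = (\<lambda>q. if q \<in> S then 0 else 1)"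
  have u0: "smooth_at A p u" and w0: "smooth_at A p w"
    by (rule smooth_at_cong[OF S _ smooth_at_const[of _ 0]], simp add: u_def w_def eq)+
  have "u = (\<lambda>q. w q * u q)" by (auto simp: u_def w_def eq)
  then have "v u = w p * v u + u p * v w" using tangent_mult[OF v w0 u0] by simp
  then have "v u = 0" using S eq by (simp add: u_def w_def)
  then show ?thesis using tangent_add[OF v f' u0] by (simp add: u_def)
next
  case False
  moreover have "\<not> smooth_at A p f'" using False S eq smooth_at_cong[of S p f' f] by auto
  ultimately show ?thesis using tangent_not_smooth[OF v] by simp
qed

lemma smooth_at_chart_derivative:
  assumes "(U, c) \<in> A" "p \<in> U" "smooth_at A p f"
  shows "((\<lambda>x. f (inv_into U c x)) has_derivative
    frechet_derivative (\<lambda>x. f (inv_into U c x)) (at (c p))) (at (c p))"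
proof -
  from assms(3) obtain S where S: "open S" "p \<in> S" "smooth_fun A S f"
    unfolding smooth_at_def by auto
  then have "smooth_on (c ` (U \<inter> S)) (\<lambda>x. f (inv_into U c x))"
    using assms unfolding smooth_fun_iff by blast
  then show ?thesis by (rule smooth_on_has_derivative) (use assms S in auto)
qed

lemma coord_vec_eqI:
  assumes "(U, c) \<in> A" "p \<in> U" "smooth_at A p f"
    and "((\<lambda>x. f (inv_into U c x)) has_derivative f') (at (c p))"
  shows "coord_vec A U c b p f = f' b"
  using assms frechet_derivative_at[OF assms(4)] by (simp add: coord_vec_def)

lemma coord_vec_tangent:
  assumes U: "(U, c) \<in> A" "p \<in> U"
  shows "coord_vec A U c b p \<in> tangent_space A p"
proof -
  note d = smooth_at_chart_derivative[OF U]
  have "coord_vec A U c b p (\<lambda>x. r * f x) = r * coord_vec A U c b p f" if "smooth_at A p f" for r f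
    using that
    by (subst coord_vec_eqI[OF U smooth_at_mult[OF smooth_at_const that] has_derivative_mult_right[OF d[OF that]]])
      (simp add: coord_vec_def)
  moreover have "coord_vec A U c b p (\<lambda>x. f x + f' x) = coord_vec A U c b p f + coord_vec A U c b p f'"
    if f: "smooth_at A p f" "smooth_at A p f'" for f f'
    using f by (subst coord_vec_eqI[OF U smooth_at_add[OF f] has_derivative_add[OF d[OF f(1)] d[OF f(2)]]])
      (simp add: coord_vec_def)
  moreover have "coord_vec A U c b p (\<lambda>x. f x * f' x) =
      f p * coord_vec A U c b p f' + f' p * coord_vec A U c b p f"
    if f: "smooth_at A p f" "smooth_at A p f'" for f f'
    using f by (subst coord_vec_eqI[OF U smooth_at_mult[OF f] has_derivative_mult[OF d[OF f(1)] d[OF f(2)]]])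
      (simp add: coord_vec_def chart_inverse[OF U])
  ultimately show ?thesis
    unfolding tangent_space_def by (auto simp: coord_vec_def)
qed

lemma coord_vec_smooth:
  assumes U: "(U, c) \<in> A" and V: "open V" "smooth_fun A V f"
  shows "smooth_fun A (U \<inter> V) (\<lambda>p. coord_vec A U c b p f)"
proof (rule smooth_fun_chartI[OF U])
  show o: "open (U \<inter> V)" using V open_chart[OF U] by auto
  have "smooth_on (c ` (U \<inter> V)) (\<lambda>x. frechet_derivative (\<lambda>x. f (inv_into U c x)) (at x) b)"
    using V U unfolding smooth_fun_iff by (auto intro: smooth_on_derivative)
  then show "smooth_on (c ` (U \<inter> V)) (\<lambda>x. coord_vec A U c b (inv_into U c x) f)"
    by (rule smooth_on_cong_imp[OF open_chart_image[OF U V(1)]])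
      (use smooth_atI[OF V(1) _ V(2)] in \<open>auto simp: coord_vec_def chart_inverse[OF U]\<close>)
qed auto

lemma coord_vec_field: "(U, c) \<in> A \<Longrightarrow> vector_field A U (coord_vec A U c b)"
  unfolding field_along_def by (auto intro: coord_vec_tangent coord_vec_smooth)

text \<open>Read in the chart, the coordinate function is the linear map taking inner products with
  \<open>b'\<close>, which is its own derivative.\<close>

lemma coord_vec_coordinate:
  assumes U: "(U, c) \<in> A" "p \<in> U"
  shows "coord_vec A U c b p (\<lambda>q. c q \<bullet> b') = b \<bullet> b'"
proof (rule coord_vec_eqI[OF U])
  show "smooth_at A p (\<lambda>q. c q \<bullet> b')"
    by (rule smooth_atI[OF open_chart[OF U(1)] U(2) smooth_fun_coordinate[OF U(1)]])
  show "((\<lambda>x. c (inv_into U c x) \<bullet> b') has_derivative (\<lambda>b. b \<bullet> b')) (at (c p))"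
    by (rule has_derivative_transform_within_open[where f = "\<lambda>x. x \<bullet> b'" and s = "c ` U"])
      (use U open_chart_range[OF U(1)] chart_inverse[OF U(1)] in \<open>auto intro!: derivative_eq_intros\<close>)
qed

text \<open>Hadamard's lemma writes \<open>f\<close> near \<open>p\<close> as its value there plus
  coordinate increments times smooth functions. The increments vanish at \<open>p\<close>, so the
  Leibniz rule keeps only the values of those functions at \<open>p\<close>, which are the partial
  derivatives. On functions not smooth at \<open>p\<close> both sides are 0 by convention.\<close>

lemma tangent_expansion:
  assumes v: "v \<in> tangent_space A p" and U: "(U, c) \<in> A" "p \<in> U"
  shows "v = (\<Sum>b\<in>Basis. v (\<lambda>q. c q \<bullet> b) *\<^sub>R coord_vec A U c b p)"
proof
  fix f
  show "v f = (\<Sum>b\<in>Basis. v (\<lambda>q. c q \<bullet> b) *\<^sub>R coord_vec A U c b p) f"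
  proof (cases "smooth_at A p f")
    case False
    then show ?thesis
      using tangent_not_smooth[OF v] by (simp add: sum_fun_apply scaleR_fun_apply coord_vec_def)
  next
    case True
    then obtain S where S: "open S" "p \<in> S" "smooth_fun A S f"
      unfolding smooth_at_def by auto
    define f' where "f' = (\<lambda>x. f (inv_into U c x))"
    have f': "smooth_on (c ` (U \<inter> S)) f'" using S U unfolding smooth_fun_iff f'_def by blast
    have "c p \<in> c ` (U \<inter> S)" using U S by blast
    \<comment> \<open>A ball is chosen because Hadamard's lemma wants a convex domain.\<close>
    with openE[OF open_chart_image[OF U(1) S(1)]]
    obtain r where r: "r > 0" "ball (c p) r \<subseteq> c ` (U \<inter> S)" by metis
    have cp: "c p \<in> ball (c p) r" using r by simp
    obtain G where G: "\<And>b. smooth_on (ball (c p) r) (G b)"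
      "\<And>x. x \<in> ball (c p) r \<Longrightarrow> f' x = f' (c p) + (\<Sum>b\<in>Basis. ((x - c p) \<bullet> b) * G b x)"
      "\<And>b. G b (c p) = frechet_derivative f' (at (c p)) b"
      by (rule hadamard[OF open_ball convex_ball cp smooth_on_subset[OF f' r(2)]]) (rule that)
    define W where "W = U \<inter> c -` ball (c p) r"
    have W: "open W" "p \<in> W" unfolding W_def using U r by (auto intro: open_chart_preimage)
    have sc: "smooth_at A p (\<lambda>q. c q \<bullet> b)" for b
      by (rule smooth_atI[OF open_chart[OF U(1)] U(2) smooth_fun_coordinate[OF U(1)]])
    have sG: "smooth_at A p (\<lambda>q. G b (c q))" for b
      by (rule smooth_atI[OF W smooth_fun_of_coordinates[OF U(1) W(1) open_ball G(1)]])
        (auto simp: W_def)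
    \<comment> \<open>The increment is spelled as a sum with a negated constant, so that the rules
      for sums, products and constants apply directly.\<close>
    have "v f = v (\<lambda>q. f p + (\<Sum>b\<in>Basis. (c q \<bullet> b + - (c p \<bullet> b)) * G b (c q)))"
    proof (rule tangent_germ[OF v W])
      fix q assume "q \<in> W"
      then show "f q = f p + (\<Sum>b\<in>Basis. (c q \<bullet> b + - (c p \<bullet> b)) * G b (c q))"
        using G(2)[of "c q"] chart_inverse[OF U(1)] U by (auto simp: W_def f'_def inner_diff_left)
    qed
    also have "\<dots> = (\<Sum>b\<in>Basis. v (\<lambda>q. c q \<bullet> b) * G b (c p))"
      by (simp add: tangent_add[OF v] tangent_sum[OF v] tangent_mult[OF v] tangent_const[OF v]
          smooth_at_const smooth_at_sum smooth_at_add smooth_at_mult sc sG mult.commute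
          del: add_uminus_conv_diff)
    finally show ?thesis
      using True G(3) by (simp add: sum_fun_apply scaleR_fun_apply coord_vec_def f'_def)
  qed
qed

end

text \<open>Unification may leave tangent vectors eta-expanded; the following rules would then unfold
  their sums and zeros under the abstraction.\<close>

declare zero_fun_apply [simp del] plus_fun_apply [simp del]
  minus_apply [simp del] uminus_apply [simp del]

lemmas tvec_apply = zero_fun_apply plus_fun_apply minus_apply uminus_apply
  scaleR_fun_apply sum_fun_apply

section \<open>Fields and connections along a map\<close>

locale smooth_mapping = dom: smooth_manifold A + cod: smooth_manifold B
  for A :: "('m::{t2_space,second_countable_topology}, 'e::euclidean_space) atlas"
    and B :: "('n::{t2_space,second_countable_topology}, 'd::euclidean_space) atlas" +
  fixes F :: "'m \<Rightarrow> 'n"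
  assumes smooth_F: "smooth_map A B F"
begin

lemma open_preimage: "open V \<Longrightarrow> open (F -` V)"
  using smooth_F unfolding smooth_map_def by (simp add: open_vimage)

text \<open>Smoothness of \<open>F\<close> is given between charts. So \<open>f\<close> is read in a
  chart around \<open>F p\<close>, and the composite on the part of a chart around \<open>p\<close>
  that \<open>F\<close> maps into that chart and into \<open>V\<close>.\<close>

lemma smooth_fun_compose:
  assumes V: "open V" "smooth_fun B V f"
  shows "smooth_fun A (F -` V) (\<lambda>p. f (F p))"
proof (rule dom.smooth_fun_local)
  fix p assume p: "p \<in> F -` V"
  obtain U c where U: "(U, c) \<in> A" "p \<in> U" by (rule dom.chart_at)
  obtain R d where R: "(R, d) \<in> B" "F p \<in> R" by (rule cod.chart_at)
  define S where "S = U \<inter> F -` (R \<inter> V)"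
  have oRV: "open (R \<inter> V)" using cod.open_chart[OF R(1)] V by auto
  have oS: "open S" unfolding S_def using dom.open_chart[OF U(1)] open_preimage[OF oRV] by auto
  have o: "open (c ` S)" unfolding S_def by (rule dom.open_chart_image[OF U(1) open_preimage[OF oRV]])
  have inv: "inv_into U c x \<in> S" if "x \<in> c ` S" for x
    using that dom.chart_inverse[OF U(1)] by (auto simp: S_def)
  have "smooth_on (c ` (U \<inter> F -` R)) (\<lambda>x. d (F (inv_into U c x)))"
    using smooth_F U R unfolding smooth_map_def o_def by fast
  then have s: "smooth_on (c ` S) (\<lambda>x. d (F (inv_into U c x)))"
    by (rule smooth_on_subset) (auto simp: S_def)
  have f: "smooth_on (d ` (R \<inter> V)) (\<lambda>x. f (inv_into R d x))"
    using V R unfolding smooth_fun_iff by blast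
  have "smooth_on (c ` S) (\<lambda>x. f (inv_into R d (d (F (inv_into U c x)))))"
    by (rule smooth_on_compose[OF o _ s f]) (use inv in \<open>auto simp: S_def\<close>)
  then have "smooth_on (c ` S) (\<lambda>x. f (F (inv_into U c x)))"
    by (rule smooth_on_cong_imp[OF o])
      (use inv cod.chart_inverse[OF R(1)] in \<open>auto simp: S_def\<close>)
  then have "smooth_fun A S (\<lambda>p. f (F p))"
    by (rule dom.smooth_fun_chartI[OF U(1) oS, rotated]) (simp add: S_def)
  moreover have "p \<in> S" using p U R by (simp add: S_def)
  ultimately show "\<exists>T. open T \<and> p \<in> T \<and> smooth_fun A T (\<lambda>p. f (F p))" using oS by blast
qed

lemma smooth_at_compose:
  assumes "smooth_at B (F p) f"
  shows "smooth_at A p (\<lambda>x. f (F x))"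
proof -
  from assms obtain V where "open V" "F p \<in> V" "smooth_fun B V f"
    unfolding smooth_at_def by auto
  then show ?thesis by (intro dom.smooth_atI[OF open_preimage _ smooth_fun_compose]) auto
qed

section \<open>The differential of the map\<close>

lemma push_apply: "smooth_at B (F p) f \<Longrightarrow> push B F p v f = v (\<lambda>x. f (F x))"
  by (simp add: push_def o_def)

lemma push_add: "push B F p (v + w) = push B F p v + push B F p w"
  by (simp add: push_def fun_eq_iff tvec_apply)

lemma push_scaleR: "push B F p (r *\<^sub>R v) = r *\<^sub>R push B F p v"
  by (simp add: push_def fun_eq_iff tvec_apply)

lemma push_zero: "push B F p 0 = 0"
  by (simp add: push_def fun_eq_iff tvec_apply)

lemma push_diff: "push B F p (v - w) = push B F p v - push B F p w"
  by (simp add: push_def fun_eq_iff tvec_apply)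

lemma push_sum: "push B F p (\<Sum>i\<in>I. v i) = (\<Sum>i\<in>I. push B F p (v i))"
  by (induction I rule: infinite_finite_induct) (auto simp: push_zero push_add)

lemma push_tangent:
  assumes "v \<in> tangent_space A p"
  shows "push B F p v \<in> tangent_space B (F p)"
  using dom.tangent_add[OF assms] dom.tangent_mult[OF assms] dom.tangent_cmult[OF assms]
  unfolding tangent_space_def
  by (simp add: push_apply smooth_at_compose cod.smooth_at_add cod.smooth_at_mult
      cod.smooth_at_mult[OF cod.smooth_at_const])
    (simp add: push_def)

section \<open>Smooth fields along the map\<close>

lemma field_along_tangent: "field_along A B F S W \<Longrightarrow> p \<in> S \<Longrightarrow> W p \<in> tangent_space B (F p)"
  unfolding field_along_def by auto

lemma field_along_smooth:
  "field_along A B F S W \<Longrightarrow> open V \<Longrightarrow> smooth_fun B V f \<Longrightarrow> smooth_fun A (S \<inter> F -` V) (\<lambda>p. W p f)"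
  unfolding field_along_def by auto

lemma field_along_subset: "field_along A B F S W \<Longrightarrow> S' \<subseteq> S \<Longrightarrow> field_along A B F S' W"
  unfolding field_along_def by (meson Int_mono order_refl smooth_fun_subset subsetD)

lemma open_field_domain: "open S \<Longrightarrow> open V \<Longrightarrow> open (S \<inter> F -` V)"
  using open_preimage by blast

lemma field_along_cong:
  assumes "open S" "field_along A B F S W" "\<And>q. q \<in> S \<Longrightarrow> W q = Z q"
  shows "field_along A B F S Z"
  unfolding field_along_def
proof (intro conjI ballI allI impI)
  fix p assume "p \<in> S"
  then show "Z p \<in> tangent_space B (F p)" using assms(3) field_along_tangent[OF assms(2)] by simp
next
  fix V f assume "open V \<and> smooth_fun B V f"
  then have V: "open V" "smooth_fun B V f" by auto
  show "smooth_fun A (S \<inter> F -` V) (\<lambda>p. Z p f)"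
    by (rule dom.smooth_fun_cong[OF open_field_domain[OF assms(1) V(1)] field_along_smooth[OF assms(2) V]])
      (simp add: assms(3))
qed

lemma field_along_add:
  assumes "open S" "field_along A B F S W" "field_along A B F S Z"
  shows "field_along A B F S (\<lambda>p. W p + Z p)"
  using assms unfolding field_along_def
  by (auto simp: tvec_apply intro!: dom.smooth_fun_add open_field_domain subspace_add[OF cod.subspace_tangent_space])

lemma field_along_scaleR:
  assumes "open S" "field_along A B F S W" "smooth_fun A S f"
  shows "field_along A B F S (\<lambda>p. f p *\<^sub>R W p)"
  using assms unfolding field_along_def
  by (auto simp: tvec_apply intro!: dom.smooth_fun_mult open_field_domain
      subspace_scale[OF cod.subspace_tangent_space] intro: smooth_fun_subset)

lemma field_along_zero: "field_along A B F S (\<lambda>p. 0)"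
  unfolding field_along_def
  by (auto simp: tvec_apply smooth_fun_const subspace_0[OF cod.subspace_tangent_space])

lemma field_along_diff:
  assumes "open S" "field_along A B F S W" "field_along A B F S Z"
  shows "field_along A B F S (\<lambda>p. W p - Z p)"
  using field_along_add[OF assms(1,2) field_along_scaleR[OF assms(1,3) smooth_fun_const[of _ _ "- 1"]]]
  by simp

lemma field_along_compose:
  assumes "open V" "vector_field B V X"
  shows "field_along A B F (F -` V) (\<lambda>p. X (F p))"
  unfolding field_along_def
proof (intro conjI ballI allI impI)
  fix p assume "p \<in> F -` V"
  then show "X (F p) \<in> tangent_space B (F p)" using assms unfolding field_along_def by auto
next
  fix V' f assume V': "open V' \<and> smooth_fun B V' f"
  then have "smooth_fun B (V \<inter> V') (\<lambda>q. X q f)" using assms unfolding field_along_def by auto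
  from smooth_fun_compose[OF _ this] show "smooth_fun A (F -` V \<inter> F -` V') (\<lambda>p. X (F p) f)"
    using assms V' by (auto simp: vimage_Int)
qed

lemma field_along_push:
  assumes "open S" "vector_field A S X"
  shows "field_along A B F S (\<lambda>p. push B F p (X p))"
  unfolding field_along_def
proof (intro conjI ballI allI impI)
  fix p assume "p \<in> S"
  then show "push B F p (X p) \<in> tangent_space B (F p)"
    using assms push_tangent unfolding field_along_def by auto
next
  fix V f assume V: "open V \<and> smooth_fun B V f"
  have "smooth_fun A (S \<inter> F -` V) (\<lambda>p. X p (\<lambda>x. f (F x)))"
    using assms(2) smooth_fun_compose[of V f] open_preimage V unfolding field_along_def by auto
  then show "smooth_fun A (S \<inter> F -` V) (\<lambda>p. push B F p (X p) f)"
    by (rule dom.smooth_fun_cong[rotated])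
      (use V assms(1) open_field_domain cod.smooth_atI[of V] in \<open>auto simp: push_apply\<close>)
qed

lemma field_nearI: "open S \<Longrightarrow> p \<in> S \<Longrightarrow> field_along A B F S W \<Longrightarrow> field_near A B F p W"
  unfolding field_near_def by blast

lemma field_near_tangent: "field_near A B F p W \<Longrightarrow> W p \<in> tangent_space B (F p)"
  unfolding field_near_def by (auto intro: field_along_tangent)

lemma field_near2:
  assumes "field_near A B F p W" "field_near A B F p Z"
  obtains S where "open S" "p \<in> S" "field_along A B F S W" "field_along A B F S Z"
proof -
  from assms obtain S S' where S: "open S" "p \<in> S" "field_along A B F S W" and
    S': "open S'" "p \<in> S'" "field_along A B F S' Z"
    unfolding field_near_def by auto
  show ?thesis
    by (rule that[of "S \<inter> S'"]) (use S S' in \<open>auto intro: field_along_subset\<close>)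
qed

lemma field_near_cong:
  assumes "open S" "p \<in> S" "\<And>q. q \<in> S \<Longrightarrow> W q = Z q" "field_near A B F p W"
  shows "field_near A B F p Z"
proof -
  from assms(4) obtain R where R: "open R" "p \<in> R" "field_along A B F R W"
    unfolding field_near_def by auto
  have "field_along A B F (S \<inter> R) Z"
    by (rule field_along_cong[of _ W]) (use assms R in \<open>auto intro: field_along_subset\<close>)
  then show ?thesis using assms R by (intro field_nearI[of "S \<inter> R"]) auto
qed

lemma field_near_add:
  assumes "field_near A B F p W" "field_near A B F p Z"
  shows "field_near A B F p (\<lambda>q. W q + Z q)"
  by (rule field_near2[OF assms]) (rule field_nearI[OF _ _ field_along_add])

lemma field_near_diff:
  assumes "field_near A B F p W" "field_near A B F p Z"
  shows "field_near A B F p (\<lambda>q. W q - Z q)"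
  by (rule field_near2[OF assms]) (rule field_nearI[OF _ _ field_along_diff])

lemma field_near_scaleR:
  assumes "field_near A B F p W" "smooth_at A p f"
  shows "field_near A B F p (\<lambda>q. f q *\<^sub>R W q)"
proof -
  from assms obtain S S' where S: "open S" "p \<in> S" "field_along A B F S W" and
    S': "open S'" "p \<in> S'" "smooth_fun A S' f"
    unfolding field_near_def smooth_at_def by auto
  show ?thesis
    by (rule field_nearI[of "S \<inter> S'"])
      (use S S' in \<open>auto intro!: field_along_scaleR intro: field_along_subset smooth_fun_subset\<close>)
qed

lemma field_near_zero: "field_near A B F p (\<lambda>q. 0)"
  by (rule field_nearI[OF open_UNIV UNIV_I field_along_zero])

lemma field_near_sum:
  "(\<And>i. i \<in> I \<Longrightarrow> field_near A B F p (W i)) \<Longrightarrow> field_near A B F p (\<lambda>q. \<Sum>i\<in>I. W i q)"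
  by (induction I rule: infinite_finite_induct) (auto simp: field_near_zero field_near_add)

lemma field_near_compose:
  assumes "field_near B B id (F p) X"
  shows "field_near A B F p (\<lambda>q. X (F q))"
proof -
  from assms obtain V where V: "open V" "F p \<in> V" "vector_field B V X"
    unfolding field_near_def by auto
  then show ?thesis by (intro field_nearI[OF open_preimage _ field_along_compose]) auto
qed

lemma field_near_push:
  assumes "field_near A A id p X"
  shows "field_near A B F p (\<lambda>q. push B F q (X q))"
proof -
  from assms obtain S where "open S" "p \<in> S" "vector_field A S X"
    unfolding field_near_def by auto
  then show ?thesis by (intro field_nearI[OF _ _ field_along_push])
qed

lemma field_near_apply:
  assumes "field_near A B F p W" "smooth_at B (F p) f"
  shows "smooth_at A p (\<lambda>q. W q f)"
proof -
  from assms obtain S V where S: "open S" "p \<in> S" "field_along A B F S W" and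
    V: "open V" "F p \<in> V" "smooth_fun B V f"
    unfolding field_near_def smooth_at_def by auto
  show ?thesis
    by (rule dom.smooth_atI[OF open_field_domain[OF S(1) V(1)] _ field_along_smooth[OF S(3) V(1,3)]])
      (use S V in auto)
qed

lemma field_along_local:
  assumes "\<And>p. p \<in> S \<Longrightarrow> field_near A B F p W"
  shows "field_along A B F S W"
  unfolding field_along_def
proof (intro conjI ballI allI impI)
  fix p assume "p \<in> S"
  then show "W p \<in> tangent_space B (F p)" using assms field_near_tangent by blast
next
  fix V f assume V: "open V \<and> smooth_fun B V f"
  show "smooth_fun A (S \<inter> F -` V) (\<lambda>p. W p f)"
  proof (rule dom.smooth_fun_local)
    fix p assume p: "p \<in> S \<inter> F -` V"
    then have "smooth_at A p (\<lambda>p. W p f)"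
      using assms V by (intro field_near_apply cod.smooth_atI[of V]) auto
    then show "\<exists>T. open T \<and> p \<in> T \<and> smooth_fun A T (\<lambda>p. W p f)"
      unfolding smooth_at_def .
  qed
qed

lemma coord_frame_near:
  assumes "(V, d) \<in> B" "F p \<in> V"
  shows "field_near B B id (F p) (coord_vec B V d b)"
  unfolding field_near_def
  using cod.coord_vec_field[OF assms(1)] cod.open_chart[OF assms(1)] assms(2)
  by (intro exI[of _ V]) simp

lemma coordinate_smooth_at:
  assumes "(V, d) \<in> B" "q \<in> V"
  shows "smooth_at B q (\<lambda>x. d x \<bullet> b)"
  by (rule cod.smooth_atI[OF cod.open_chart[OF assms(1)] assms(2) cod.smooth_fun_coordinate[OF assms(1)]])

lemma field_near_expansion:
  assumes "field_near A B F p W" "(V, d) \<in> B" "F p \<in> V"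
  obtains S where "open S" "p \<in> S"
    "\<And>q. q \<in> S \<Longrightarrow> W q = (\<Sum>b\<in>Basis. W q (\<lambda>x. d x \<bullet> b) *\<^sub>R coord_vec B V d b (F q))"
proof -
  from assms(1) obtain S where S: "open S" "p \<in> S" "field_along A B F S W"
    unfolding field_near_def by auto
  show ?thesis
  proof
    show "open (S \<inter> F -` V)" using S assms cod.open_chart open_field_domain by blast
    show "p \<in> S \<inter> F -` V" using S assms by auto
    fix q assume "q \<in> S \<inter> F -` V"
    then show "W q = (\<Sum>b\<in>Basis. W q (\<lambda>x. d x \<bullet> b) *\<^sub>R coord_vec B V d b (F q))"
      using field_along_tangent[OF S(3)] assms(2) by (intro cod.tangent_expansion) auto
  qed
qed

text \<open>Near \<open>p\<close> a field along \<open>F\<close> is a finite sum of coordinate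
  fields of the target, restricted along \<open>F\<close>, with smooth coefficients. It therefore
  suffices to treat restrictions of ambient fields, sums and smooth multiples; the case
  \<open>germ\<close> is there because the expansion holds only near \<open>p\<close>.\<close>

lemma frame_induct [consumes 1, case_names compose add scaleR germ]:
  assumes W: "field_near A B F p W"
    and base: "\<And>X. field_near B B id (F p) X \<Longrightarrow> P (\<lambda>q. X (F q))"
    and add: "\<And>W Z. field_near A B F p W \<Longrightarrow> field_near A B F p Z \<Longrightarrow> P W \<Longrightarrow> P Z \<Longrightarrow> P (\<lambda>q. W q + Z q)"
    and scaleR: "\<And>f W. smooth_at A p f \<Longrightarrow> field_near A B F p W \<Longrightarrow> P W \<Longrightarrow> P (\<lambda>q. f q *\<^sub>R W q)"
    and germ: "\<And>S W Z. open S \<Longrightarrow> p \<in> S \<Longrightarrow> (\<And>q. q \<in> S \<Longrightarrow> W q = Z q) \<Longrightarrow>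
      field_near A B F p W \<Longrightarrow> P W \<Longrightarrow> P Z"
  shows "P W"
proof -
  obtain V d where V: "(V, d) \<in> B" "F p \<in> V" by (rule cod.chart_at)
  obtain S where S: "open S" "p \<in> S"
    "\<And>q. q \<in> S \<Longrightarrow> W q = (\<Sum>b\<in>Basis. W q (\<lambda>x. d x \<bullet> b) *\<^sub>R coord_vec B V d b (F q))"
    by (rule field_near_expansion[OF W V]) (rule that)
  define Z where "Z = (\<lambda>b q. W q (\<lambda>x. d x \<bullet> b) *\<^sub>R coord_vec B V d b (F q))"
  have c: "smooth_at A p (\<lambda>q. W q (\<lambda>x. d x \<bullet> b))" for b
    by (rule field_near_apply[OF W coordinate_smooth_at[OF V]])
  have nc: "field_near A B F p (\<lambda>q. coord_vec B V d b (F q))" for b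
    by (rule field_near_compose[OF coord_frame_near[OF V]])
  have n: "field_near A B F p (Z b)" for b
    unfolding Z_def by (rule field_near_scaleR[OF nc c])
  have PZ: "P (Z b)" for b
    unfolding Z_def by (rule scaleR[OF c nc base[OF coord_frame_near[OF V]]])
  \<comment> \<open>The zero field, wanted for the empty sum, is 0 times one of the
    summands.\<close>
  have P0: "P (\<lambda>q. 0)"
    using scaleR[OF dom.smooth_at_const[of _ 0] n PZ] by simp
  have "P (\<lambda>q. \<Sum>b\<in>I. Z b q)" if "finite I" for I
    using that
  proof (induction I)
    case empty
    then show ?case using P0 by simp
  next
    case (insert b I)
    then show ?case using add[OF n field_near_sum[of I, OF n] PZ] by simp
  qed
  then have PS: "P (\<lambda>q. \<Sum>b\<in>Basis. Z b q)" by simp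
  have eq: "(\<Sum>b\<in>Basis. Z b q) = W q" if "q \<in> S" for q
    unfolding Z_def using S(3)[OF that] by (rule sym)
  show ?thesis
    by (rule germ[OF S(1,2) eq field_near_sum[OF n] PS])
qed

end

lemma smooth_map_id:
  assumes "smooth_atlas A"
  shows "smooth_map A A id"
  using assms unfolding smooth_map_def smooth_atlas_def by auto

lemma smooth_mapping_id:
  assumes "smooth_manifold A"
  shows "smooth_mapping A A id"
  using assms smooth_map_id
  by (auto simp: smooth_mapping_def smooth_mapping_axioms_def smooth_manifold_def)

locale connection = smooth_mapping A B F
  for A :: "('m::{t2_space,second_countable_topology}, 'e::euclidean_space) atlas"
    and B :: "('n::{t2_space,second_countable_topology}, 'd::euclidean_space) atlas" and F +
  fixes D :: "('m, 'n) conn"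
  assumes connection: "connection_along A B F D"
begin

lemma conn_tangent:
  "field_near A B F p W \<Longrightarrow> v \<in> tangent_space A p \<Longrightarrow> D p v W \<in> tangent_space B (F p)"
  using connection unfolding connection_along_def by blast

lemma conn_direction: "field_near A B F p W \<Longrightarrow> v \<in> tangent_space A p \<Longrightarrow> w \<in> tangent_space A p \<Longrightarrow>
    D p (r *\<^sub>R v + s *\<^sub>R w) W = r *\<^sub>R D p v W + s *\<^sub>R D p w W"
  using connection unfolding connection_along_def by blast

lemma conn_direction_scaleR:
  "field_near A B F p W \<Longrightarrow> v \<in> tangent_space A p \<Longrightarrow> D p (r *\<^sub>R v) W = r *\<^sub>R D p v W"
  using conn_direction[of p W v v r 0] by simp

lemma conn_direction_sum:
  assumes "field_near A B F p W" "finite I" "\<And>i. i \<in> I \<Longrightarrow> v i \<in> tangent_space A p"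
  shows "D p (\<Sum>i\<in>I. r i *\<^sub>R v i) W = (\<Sum>i\<in>I. r i *\<^sub>R D p (v i) W)"
  using assms(2,3)
proof (induction I)
  case empty
  then show ?case
    using conn_direction_scaleR[OF assms(1) subspace_0[OF dom.subspace_tangent_space], of 0] by simp
next
  case (insert i I)
  have "(\<Sum>i\<in>I. r i *\<^sub>R v i) \<in> tangent_space A p"
    using insert by (auto intro!: subspace_sum subspace_scale dom.subspace_tangent_space)
  with conn_direction[OF assms(1), of "v i" "\<Sum>i\<in>I. r i *\<^sub>R v i" "r i" 1] insert.prems
  have "D p (r i *\<^sub>R v i + (\<Sum>i\<in>I. r i *\<^sub>R v i)) W =
      r i *\<^sub>R D p (v i) W + D p (\<Sum>i\<in>I. r i *\<^sub>R v i) W" by simp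
  then show ?case
    unfolding sum.insert[OF insert.hyps] using insert.IH insert.prems by simp
qed

lemma conn_add: "field_near A B F p W \<Longrightarrow> field_near A B F p Z \<Longrightarrow> v \<in> tangent_space A p \<Longrightarrow>
    D p v (\<lambda>q. W q + Z q) = D p v W + D p v Z"
  using connection unfolding connection_along_def by blast

lemma conn_scaleR: "field_near A B F p W \<Longrightarrow> smooth_at A p f \<Longrightarrow> v \<in> tangent_space A p \<Longrightarrow>
    D p v (\<lambda>q. f q *\<^sub>R W q) = v f *\<^sub>R W p + f p *\<^sub>R D p v W"
  using connection unfolding connection_along_def by blast

lemma conn_field: "open S \<Longrightarrow> vector_field A S X \<Longrightarrow> field_along A B F S W \<Longrightarrow>
    field_along A B F S (\<lambda>p. D p (X p) W)"
  using connection unfolding connection_along_def by blast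

lemma conn_zero: "v \<in> tangent_space A p \<Longrightarrow> D p v (\<lambda>q. 0) = 0"
  using conn_scaleR[OF field_near_zero dom.smooth_at_const[of _ 0]]
  by (simp add: dom.tangent_const)

lemma conn_sum:
  "(\<And>i. i \<in> I \<Longrightarrow> field_near A B F p (W i)) \<Longrightarrow> v \<in> tangent_space A p \<Longrightarrow>
    D p v (\<lambda>q. \<Sum>i\<in>I. W i q) = (\<Sum>i\<in>I. D p v (W i))"
  by (induction I rule: infinite_finite_induct) (simp_all add: conn_zero conn_add field_near_sum)

text \<open>The Leibniz rule makes a connection local: the difference of the two fields equals its
  product with the indicator function of the complement of \<open>S\<close>, which is smooth at
  \<open>p\<close> and vanishes there together with the difference.\<close>

lemma conn_germ:
  assumes S: "open S" "p \<in> S" and eq: "\<And>q. q \<in> S \<Longrightarrow> W q = Z q"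
    and W: "field_near A B F p W" and v: "v \<in> tangent_space A p"
  shows "D p v W = D p v Z"
proof -
  have Z: "field_near A B F p Z" by (rule field_near_cong[OF S eq W])
  define u where "u = (\<lambda>q. W q - Z q)"
  define w :: "'m \<Rightarrow> real" where "w = (\<lambda>q. if q \<in> S then 0 else 1)"
  have w: "smooth_at A p w"
    by (rule dom.smooth_at_cong[OF S _ dom.smooth_at_const[of _ 0]]) (simp add: w_def)
  have u0: "field_near A B F p u" unfolding u_def by (rule field_near_diff[OF W Z])
  have "u = (\<lambda>q. w q *\<^sub>R u q)" by (auto simp: u_def w_def eq)
  then have "D p v u = v w *\<^sub>R u p + w p *\<^sub>R D p v u" using conn_scaleR[OF u0 w v] by simp
  then have "D p v u = 0" using S eq by (simp add: u_def w_def)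
  then show ?thesis using conn_add[OF Z u0 v] by (simp add: u_def)
qed

end

section \<open>Riemannian submanifolds\<close>

context smooth_mapping
begin

text \<open>Constant coefficients in a coordinate frame around \<open>F p\<close> do; the extension
  is only local, so no cut-off function enters.\<close>

lemma field_near_extension:
  assumes "w \<in> tangent_space B (F p)"
  obtains W where "field_near A B F p W" "W p = w"
proof -
  obtain V d where V: "(V, d) \<in> B" "F p \<in> V" by (rule cod.chart_at)
  show ?thesis
  proof
    show "field_near A B F p (\<lambda>q. \<Sum>b\<in>Basis. w (\<lambda>x. d x \<bullet> b) *\<^sub>R coord_vec B V d b (F q))"
      by (rule field_near_sum, rule field_near_scaleR[OF field_near_compose[OF coord_frame_near[OF V]]])
        (rule dom.smooth_at_const)
    show "(\<Sum>b\<in>Basis. w (\<lambda>x. d x \<bullet> b) *\<^sub>R coord_vec B V d b (F p)) = w"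
      using cod.tangent_expansion[OF assms V] by (rule sym)
  qed
qed

lemma field_near_nbhd:
  assumes "field_near A B F p W"
  obtains S where "open S" "p \<in> S" "\<And>q. q \<in> S \<Longrightarrow> W q \<in> tangent_space B (F q)"
  using assms field_along_tangent unfolding field_near_def by metis

end

locale riemannian = smooth_manifold A
  for A :: "('m::{t2_space,second_countable_topology}, 'e::euclidean_space) atlas" +
  fixes g :: "'m \<Rightarrow> 'm tvec \<Rightarrow> 'm tvec \<Rightarrow> real"
  assumes metric: "riemannian_metric A g"
begin

lemma g_sym: "u \<in> tangent_space A p \<Longrightarrow> v \<in> tangent_space A p \<Longrightarrow> g p u v = g p v u"
  using metric unfolding riemannian_metric_def by blast

lemma g_linear: "u \<in> tangent_space A p \<Longrightarrow> v \<in> tangent_space A p \<Longrightarrow> w \<in> tangent_space A p \<Longrightarrow>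
    g p (r *\<^sub>R u + s *\<^sub>R v) w = r * g p u w + s * g p v w"
  using metric unfolding riemannian_metric_def by blast

lemma g_pos: "u \<in> tangent_space A p \<Longrightarrow> u \<noteq> 0 \<Longrightarrow> g p u u > 0"
  using metric unfolding riemannian_metric_def by blast

lemma g_smooth: "open S \<Longrightarrow> vector_field A S X \<Longrightarrow> vector_field A S Y \<Longrightarrow>
    smooth_fun A S (\<lambda>p. g p (X p) (Y p))"
  using metric unfolding riemannian_metric_def by blast

lemmas tangent_closed =
  subspace_0[OF subspace_tangent_space] subspace_add[OF subspace_tangent_space]
  subspace_diff[OF subspace_tangent_space] subspace_neg[OF subspace_tangent_space]
  subspace_scale[OF subspace_tangent_space]

lemma g_add_left: "u \<in> tangent_space A p \<Longrightarrow> v \<in> tangent_space A p \<Longrightarrow> w \<in> tangent_space A p \<Longrightarrow>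
    g p (u + v) w = g p u w + g p v w"
  using g_linear[of u p v w 1 1] by simp

lemma g_scaleR_left: "u \<in> tangent_space A p \<Longrightarrow> w \<in> tangent_space A p \<Longrightarrow>
    g p (r *\<^sub>R u) w = r * g p u w"
  using g_linear[of u p u w r 0] by simp

lemma g_diff_left: "u \<in> tangent_space A p \<Longrightarrow> v \<in> tangent_space A p \<Longrightarrow> w \<in> tangent_space A p \<Longrightarrow>
    g p (u - v) w = g p u w - g p v w"
  using g_linear[of u p v w 1 "- 1"] by simp

lemma g_minus_left: "u \<in> tangent_space A p \<Longrightarrow> w \<in> tangent_space A p \<Longrightarrow> g p (- u) w = - g p u w"
  using g_scaleR_left[of u p w "- 1"] by simp

lemma g_zero_left: "w \<in> tangent_space A p \<Longrightarrow> g p 0 w = 0"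
  using g_scaleR_left[of w p w 0] by simp

lemmas g_left = g_add_left g_scaleR_left g_diff_left g_minus_left g_zero_left

lemma g_right:
  assumes "w \<in> tangent_space A p" "u \<in> tangent_space A p" "v \<in> tangent_space A p"
  shows "g p w (u + v) = g p w u + g p w v" "g p w (u - v) = g p w u - g p w v"
  using assms g_add_left[of u p v w] g_diff_left[of u p v w]
  by (simp_all add: g_sym[of w] tangent_closed)

lemma g_right1:
  assumes "w \<in> tangent_space A p" "u \<in> tangent_space A p"
  shows "g p w (r *\<^sub>R u) = r * g p w u" "g p w (- u) = - g p w u" "g p w 0 = 0"
  using assms g_scaleR_left[of u p w] g_minus_left[of u p w] g_zero_left[of w p]
  by (simp_all add: g_sym[of w] tangent_closed)

lemma g_nonneg: "u \<in> tangent_space A p \<Longrightarrow> g p u u \<ge> 0"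
  using g_pos[of u p] g_zero_left[OF tangent_closed(1)] by (cases "u = 0") auto

lemma g_eq_0: "u \<in> tangent_space A p \<Longrightarrow> g p u u = 0 \<Longrightarrow> u = 0"
  using g_pos[of u p] by force

lemma g_cauchy_schwarz:
  assumes u: "u \<in> tangent_space A p" and w: "w \<in> tangent_space A p"
  shows "\<bar>g p u w\<bar> \<le> sqrt (g p u u) * sqrt (g p w w)"
proof (cases "w = 0")
  case True
  then show ?thesis using g_right1(3)[OF u u] g_zero_left[OF tangent_closed(1)] by simp
next
  case False
  define r where "r = g p u w / g p w w"
  have pos: "g p w w > 0" using g_pos[OF w False] .
  have "0 \<le> g p (u - r *\<^sub>R w) (u - r *\<^sub>R w)"
    by (rule g_nonneg) (simp add: u w tangent_closed)
  also have "\<dots> = g p u u - 2 * r * g p u w + r * r * g p w w"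
    using u w by (simp add: g_left g_right g_right1 tangent_closed g_sym[of w p u] algebra_simps)
  also have "\<dots> = g p u u - (g p u w)\<^sup>2 / g p w w"
    using pos by (simp add: r_def power2_eq_square field_simps)
  finally have "(g p u w)\<^sup>2 \<le> g p u u * g p w w"
    using pos by (simp add: field_simps)
  then have "sqrt ((g p u w)\<^sup>2) \<le> sqrt (g p u u * g p w w)" by (rule real_sqrt_le_mono)
  then show ?thesis by (simp add: real_sqrt_mult)
qed

end

locale immersed_manifold =
  connection A B F D + riemannian B g +
  ambient: connection B B id nabb + tangent: connection A A id nab
  for A :: "('m::{t2_space,second_countable_topology}, 'e::euclidean_space) atlas"
    and B :: "('n::{t2_space,second_countable_topology}, 'd::euclidean_space) atlas"
    and F D g nabb nab +
  assumes nabb: "levi_civita B g nabb"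
    and nab: "levi_civita A (induced_metric B F g) nab"
    and induced: "induced_connection A B F nabb D"
    and inj_push: "\<And>p. inj_on (push B F p) (tangent_space A p)"
begin

abbreviation "tB p \<equiv> tangent_space B (F p)"
abbreviation "tA p \<equiv> tangent_space A p"
abbreviation "psh \<equiv> push B F"
abbreviation "near \<equiv> field_near A B F"
abbreviation "nearA \<equiv> field_near A A id"
abbreviation "tpart \<equiv> tangent_part A B F g"
abbreviation "npart \<equiv> normal_part A B F g"
abbreviation "nspace \<equiv> normal_space A B F g"
abbreviation "h \<equiv> second_ff B F D nab"

lemmas tA_closed =
  subspace_0[OF dom.subspace_tangent_space] subspace_add[OF dom.subspace_tangent_space]
  subspace_diff[OF dom.subspace_tangent_space] subspace_neg[OF dom.subspace_tangent_space]
  subspace_scale[OF dom.subspace_tangent_space]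

lemma push_eq_0: "v \<in> tA p \<Longrightarrow> psh p v = 0 \<Longrightarrow> v = 0"
  using inj_onD[OF inj_push, of p v 0] push_zero tA_closed(1) by simp

lemma nearA_tangent: "nearA p X \<Longrightarrow> X p \<in> tA p"
  using tangent.field_near_tangent by simp

lemma D_compose: "v \<in> tA p \<Longrightarrow> field_near B B id (F p) Z \<Longrightarrow>
    D p v (\<lambda>q. Z (F q)) = nabb (F p) (psh p v) Z"
  using induced unfolding induced_connection_def by blast

text \<open>Smoothness and the product rule are bundled because each step of
  \<open>frame_induct\<close> differentiates a sum or a product of such functions, and the rules for
  tangent vectors apply to functions smooth at \<open>p\<close>.\<close>

definition metric_rule :: "'m \<Rightarrow> ('m \<Rightarrow> 'n tvec) \<Rightarrow> ('m \<Rightarrow> 'n tvec) \<Rightarrow> bool"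
  where "metric_rule p W Z \<longleftrightarrow> smooth_at A p (\<lambda>q. g (F q) (W q) (Z q)) \<and>
    (\<forall>v\<in>tA p. v (\<lambda>q. g (F q) (W q) (Z q)) = g (F p) (D p v W) (Z p) + g (F p) (W p) (D p v Z))"

lemma metric_rule_eqI:
  assumes "open S" "p \<in> S" "\<And>q. q \<in> S \<Longrightarrow> f q = g (F q) (W q) (Z q)" "smooth_at A p f"
    and "\<And>v. v \<in> tA p \<Longrightarrow> v f = g (F p) (D p v W) (Z p) + g (F p) (W p) (D p v Z)"
  shows "metric_rule p W Z"
  unfolding metric_rule_def
proof (intro conjI ballI)
  show "smooth_at A p (\<lambda>q. g (F q) (W q) (Z q))"
    by (rule dom.smooth_at_cong[OF assms(1,2,3,4)])
  show "v (\<lambda>q. g (F q) (W q) (Z q)) = g (F p) (D p v W) (Z p) + g (F p) (W p) (D p v Z)"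
    if "v \<in> tA p" for v
    using assms(5)[OF that] dom.tangent_germ[OF that assms(1-3)] by simp
qed

lemma metric_ruleD:
  "metric_rule p W Z \<Longrightarrow> v \<in> tA p \<Longrightarrow>
    v (\<lambda>q. g (F q) (W q) (Z q)) = g (F p) (D p v W) (Z p) + g (F p) (W p) (D p v Z)"
  unfolding metric_rule_def by blast

text \<open>The closure rules that follow treat the first argument; symmetry carries them over to
  the second.\<close>

lemma metric_rule_sym:
  assumes W: "near p W" and Z: "near p Z" and WZ: "metric_rule p W Z"
  shows "metric_rule p Z W"
proof -
  obtain S where S: "open S" "p \<in> S" "field_along A B F S W" "field_along A B F S Z"
    by (rule field_near2[OF W Z])
  have sym: "g (F q) (W q) (Z q) = g (F q) (Z q) (W q)" if "q \<in> S" for q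
    using that field_along_tangent[OF S(3)] field_along_tangent[OF S(4)] by (intro g_sym) auto
  show ?thesis
  proof (rule metric_rule_eqI[OF S(1,2) sym])
    show "smooth_at A p (\<lambda>q. g (F q) (W q) (Z q))"
      using WZ unfolding metric_rule_def by blast
    fix v assume v: "v \<in> tA p"
    then have "v (\<lambda>q. g (F q) (W q) (Z q)) = g (F p) (D p v W) (Z p) + g (F p) (W p) (D p v Z)"
      using WZ unfolding metric_rule_def by blast
    then show "v (\<lambda>q. g (F q) (W q) (Z q)) = g (F p) (D p v Z) (W p) + g (F p) (Z p) (D p v W)"
      using g_sym[OF conn_tangent[OF W v] field_near_tangent[OF Z]]
        g_sym[OF conn_tangent[OF Z v] field_near_tangent[OF W]] by simp
  qed
qed

lemma metric_rule_add:
  assumes W: "near p W" "near p W'" and Z: "near p Z"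
    and WZ: "metric_rule p W Z" "metric_rule p W' Z"
  shows "metric_rule p (\<lambda>q. W q + W' q) Z"
proof -
  obtain S where S: "open S" "p \<in> S" "\<And>q. q \<in> S \<Longrightarrow> W q \<in> tB q" by (rule field_near_nbhd[OF W(1)]) (rule that)
  obtain S' where S': "open S'" "p \<in> S'" "\<And>q. q \<in> S' \<Longrightarrow> W' q \<in> tB q" by (rule field_near_nbhd[OF W(2)]) (rule that)
  obtain R where R: "open R" "p \<in> R" "\<And>q. q \<in> R \<Longrightarrow> Z q \<in> tB q" by (rule field_near_nbhd[OF Z]) (rule that)
  have s: "smooth_at A p (\<lambda>q. g (F q) (W q) (Z q))" "smooth_at A p (\<lambda>q. g (F q) (W' q) (Z q))"
    using WZ unfolding metric_rule_def by blast+
  show ?thesis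
  proof (rule metric_rule_eqI[of "S \<inter> S' \<inter> R" _ "\<lambda>q. g (F q) (W q) (Z q) + g (F q) (W' q) (Z q)"])
    fix v assume v: "v \<in> tA p"
    show "v (\<lambda>q. g (F q) (W q) (Z q) + g (F q) (W' q) (Z q)) =
        g (F p) (D p v (\<lambda>q. W q + W' q)) (Z p) + g (F p) (W p + W' p) (D p v Z)"
      using metric_ruleD[OF WZ(1) v] metric_ruleD[OF WZ(2) v] v dom.tangent_add[OF v s] W Z
      by (simp add: conn_add conn_tangent field_near_tangent g_left)
  qed (use S S' R in \<open>auto simp: g_left intro: dom.smooth_at_add[OF s]\<close>)
qed

lemma metric_rule_scaleR:
  assumes f: "smooth_at A p f" and W: "near p W" and Z: "near p Z" and WZ: "metric_rule p W Z"
  shows "metric_rule p (\<lambda>q. f q *\<^sub>R W q) Z"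
proof -
  obtain S where S: "open S" "p \<in> S" "\<And>q. q \<in> S \<Longrightarrow> W q \<in> tB q" by (rule field_near_nbhd[OF W]) (rule that)
  obtain R where R: "open R" "p \<in> R" "\<And>q. q \<in> R \<Longrightarrow> Z q \<in> tB q" by (rule field_near_nbhd[OF Z]) (rule that)
  have s: "smooth_at A p (\<lambda>q. g (F q) (W q) (Z q))"
    using WZ unfolding metric_rule_def by blast
  show ?thesis
  proof (rule metric_rule_eqI[of "S \<inter> R" _ "\<lambda>q. f q * g (F q) (W q) (Z q)"])
    fix v assume v: "v \<in> tA p"
    show "v (\<lambda>q. f q * g (F q) (W q) (Z q)) =
        g (F p) (D p v (\<lambda>q. f q *\<^sub>R W q)) (Z p) + g (F p) (f p *\<^sub>R W p) (D p v Z)"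
      using metric_ruleD[OF WZ v] v dom.tangent_mult[OF v f s] W Z f
      by (simp add: conn_scaleR conn_tangent field_near_tangent g_left tangent_closed algebra_simps)
  qed (use S R in \<open>auto simp: g_left intro: dom.smooth_at_mult[OF f s]\<close>)
qed

lemma metric_rule_germ:
  assumes S: "open S" "p \<in> S" "\<And>q. q \<in> S \<Longrightarrow> W q = W' q" and W: "near p W" and WZ: "metric_rule p W Z"
  shows "metric_rule p W' Z"
proof (rule metric_rule_eqI[OF S(1,2), of "\<lambda>q. g (F q) (W q) (Z q)"])
  fix v assume "v \<in> tA p"
  then show "v (\<lambda>q. g (F q) (W q) (Z q)) = g (F p) (D p v W') (Z p) + g (F p) (W' p) (D p v Z)"
    using WZ conn_germ[OF S W] S(3)[OF S(2)] unfolding metric_rule_def by simp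
qed (use S WZ metric_rule_def in auto)

lemma metric_rule_compose:
  assumes X: "field_near B B id (F p) X" and Y: "field_near B B id (F p) Y"
  shows "metric_rule p (\<lambda>q. X (F q)) (\<lambda>q. Y (F q))"
proof -
  obtain V where V: "open V" "F p \<in> V" "vector_field B V X" "vector_field B V Y"
    by (rule ambient.field_near2[OF X Y])
  have s: "smooth_at B (F p) (\<lambda>x. g x (X x) (Y x))"
    by (rule cod.smooth_atI[OF V(1,2) g_smooth[OF V(1,3,4)]])
  show ?thesis
    unfolding metric_rule_def
  proof (intro conjI ballI)
    show "smooth_at A p (\<lambda>q. g (F q) (X (F q)) (Y (F q)))" by (rule smooth_at_compose[OF s])
    fix v assume v: "v \<in> tA p"
    have "v (\<lambda>q. g (F q) (X (F q)) (Y (F q))) = psh p v (\<lambda>x. g x (X x) (Y x))"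
      by (simp add: push_apply[OF s])
    also have "\<dots> = g (F p) (nabb (F p) (psh p v) X) (Y (F p)) + g (F p) (X (F p)) (nabb (F p) (psh p v) Y)"
      using nabb push_tangent[OF v] X Y unfolding levi_civita_def by blast
    finally show "v (\<lambda>q. g (F q) (X (F q)) (Y (F q))) =
        g (F p) (D p v (\<lambda>q. X (F q))) (Y (F p)) + g (F p) (X (F p)) (D p v (\<lambda>q. Y (F q)))"
      by (simp add: D_compose[OF v X] D_compose[OF v Y])
  qed
qed

text \<open>Two nested frame inductions, one in each argument, reduce the claim to two restrictions
  of ambient fields, where metric compatibility of \<open>nabb\<close> applies in the pushed-forward
  direction.\<close>

lemma metric_rule:
  assumes W: "near p W" and Z: "near p Z"
  shows "metric_rule p W Z"
  using W
proof (induction rule: frame_induct)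
  case (compose X)
  have "metric_rule p Z (\<lambda>q. X (F q))"
    using Z
  proof (induction rule: frame_induct)
    case (compose Y)
    show ?case by (rule metric_rule_compose[OF compose \<open>field_near B B id (F p) X\<close>])
  next
    case (add W Z)
    show ?case by (rule metric_rule_add[OF add(1,2) field_near_compose[OF compose] add(3,4)])
  next
    case (scaleR f W)
    show ?case by (rule metric_rule_scaleR[OF scaleR(1,2) field_near_compose[OF compose] scaleR(3)])
  next
    case (germ S W Z)
    show ?case by (rule metric_rule_germ[OF germ])
  qed
  then show ?case by (rule metric_rule_sym[OF Z field_near_compose[OF compose]])
next
  case (add W W')
  show ?case by (rule metric_rule_add[OF add(1,2) Z add(3,4)])
next
  case (scaleR f W)
  show ?case by (rule metric_rule_scaleR[OF scaleR(1,2) Z scaleR(3)])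
next
  case (germ S W W')
  show ?case by (rule metric_rule_germ[OF germ])
qed

lemma metric_smooth_at: "near p W \<Longrightarrow> near p Z \<Longrightarrow> smooth_at A p (\<lambda>q. g (F q) (W q) (Z q))"
  using metric_rule unfolding metric_rule_def by blast

lemma metric_compatible: "near p W \<Longrightarrow> near p Z \<Longrightarrow> v \<in> tA p \<Longrightarrow>
    v (\<lambda>q. g (F q) (W q) (Z q)) = g (F p) (D p v W) (Z p) + g (F p) (W p) (D p v Z)"
  using metric_rule unfolding metric_rule_def by blast

end

context riemannian
begin

lemma g_right_sum:
  assumes "w \<in> tangent_space A p" "\<And>i. i \<in> I \<Longrightarrow> u i \<in> tangent_space A p"
  shows "g p w (\<Sum>i\<in>I. u i) = (\<Sum>i\<in>I. g p w (u i))"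
  using assms(2)
proof (induction I rule: infinite_finite_induct)
  case (insert i I)
  have "(\<Sum>i\<in>I. u i) \<in> tangent_space A p"
    using insert.prems by (auto intro: subspace_sum subspace_tangent_space)
  then show ?case using insert assms(1) by (simp add: g_right)
qed (simp_all add: g_right1(3)[OF assms(1) assms(1)])

end

section \<open>Symmetry and normality of the second fundamental form\<close>

context immersed_manifold
begin

text \<open>Coordinate fields commute, since applying one of them to a coordinate of another
  differentiates a constant. Torsion-freeness then leaves a vector with vanishing coordinates. This
  is the symmetry of the Christoffel symbols.\<close>

lemma coord_frame_nabb_commute:
  assumes V: "(V, d) \<in> B" "q \<in> V"
  shows "nabb q (coord_vec B V d a q) (coord_vec B V d b) = nabb q (coord_vec B V d b q) (coord_vec B V d a)"
proof -
  let ?e = "coord_vec B V d"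
  have near_e: "field_near B B id q (?e b)" for b
    using ambient.coord_frame_near[of V d q] V by simp
  have e: "?e b q \<in> tangent_space B q" for b by (rule cod.coord_vec_tangent[OF V])
  define u where "u = nabb q (?e a q) (?e b) - nabb q (?e b q) (?e a)"
  have u: "u \<in> tangent_space B q"
    unfolding u_def using ambient.conn_tangent[of q "?e b" for b] near_e e by (simp add: tangent_closed)
  have const: "?e a q (\<lambda>x. ?e b x (\<lambda>x. d x \<bullet> i)) = 0" for a b i
  proof -
    have "?e a q (\<lambda>x. ?e b x (\<lambda>x. d x \<bullet> i)) = ?e a q (\<lambda>x. b \<bullet> i)"
      by (rule cod.tangent_germ[OF e cod.open_chart[OF V(1)] V(2)])
        (rule cod.coord_vec_coordinate[OF V(1)])
    then show ?thesis by (simp add: cod.tangent_const[OF e])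
  qed
  have "u (\<lambda>x. d x \<bullet> i) = 0" for i
  proof -
    have "smooth_at B q (\<lambda>x. d x \<bullet> i)" by (rule coordinate_smooth_at[OF V])
    then have "u (\<lambda>x. d x \<bullet> i) =
        ?e a q (\<lambda>x. ?e b x (\<lambda>x. d x \<bullet> i)) - ?e b q (\<lambda>x. ?e a x (\<lambda>x. d x \<bullet> i))"
      using nabb near_e unfolding levi_civita_def u_def by blast
    then show ?thesis by (simp add: const)
  qed
  then have "u = 0" using cod.tangent_expansion[OF u V] by simp
  then show ?thesis by (simp add: u_def)
qed

text \<open>The Leibniz rule is applied to the frame expansion of \<open>W\<close>, then linearity
  of \<open>nabb\<close> to the pushed-forward direction. The double sum consists of the Christoffel
  terms, whose symmetry is exploited in \<open>torsion_free\<close>.\<close>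

lemma conn_expansion:
  assumes W: "near p W" and v: "v \<in> tA p" and V: "(V, d) \<in> B" "F p \<in> V"
  shows "D p v W = (\<Sum>b\<in>Basis. v (\<lambda>q. W q (\<lambda>x. d x \<bullet> b)) *\<^sub>R coord_vec B V d b (F p)) +
    (\<Sum>b\<in>Basis. \<Sum>a\<in>Basis. (W p (\<lambda>x. d x \<bullet> b) * psh p v (\<lambda>x. d x \<bullet> a)) *\<^sub>R
      nabb (F p) (coord_vec B V d a (F p)) (coord_vec B V d b))"
proof -
  let ?e = "coord_vec B V d"
  obtain S where S: "open S" "p \<in> S"
    "\<And>q. q \<in> S \<Longrightarrow> W q = (\<Sum>b\<in>Basis. W q (\<lambda>x. d x \<bullet> b) *\<^sub>R ?e b (F q))"
    by (rule field_near_expansion[OF W V]) (rule that)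
  have c: "smooth_at A p (\<lambda>q. W q (\<lambda>x. d x \<bullet> b))" for b
    by (rule field_near_apply[OF W coordinate_smooth_at[OF V]])
  have near_e: "field_near B B id (F p) (?e b)" for b by (rule coord_frame_near[OF V])
  have nc: "near p (\<lambda>q. ?e b (F q))" for b by (rule field_near_compose[OF near_e])
  have e: "?e b (F p) \<in> tB p" for b by (rule cod.coord_vec_tangent[OF V])
  have D_e: "D p v (\<lambda>q. ?e b (F q)) =
      (\<Sum>a\<in>Basis. psh p v (\<lambda>x. d x \<bullet> a) *\<^sub>R nabb (F p) (?e a (F p)) (?e b))" for b
  proof -
    have "D p v (\<lambda>q. ?e b (F q)) = nabb (F p) (psh p v) (?e b)" by (rule D_compose[OF v near_e])
    also have "\<dots> = nabb (F p) (\<Sum>a\<in>Basis. psh p v (\<lambda>x. d x \<bullet> a) *\<^sub>R ?e a (F p)) (?e b)"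
      using cod.tangent_expansion[OF push_tangent[OF v] V] by simp
    also have "\<dots> = (\<Sum>a\<in>Basis. psh p v (\<lambda>x. d x \<bullet> a) *\<^sub>R nabb (F p) (?e a (F p)) (?e b))"
      by (rule ambient.conn_direction_sum[OF near_e finite_Basis e])
    finally show ?thesis .
  qed
  have "D p v W = D p v (\<lambda>q. \<Sum>b\<in>Basis. W q (\<lambda>x. d x \<bullet> b) *\<^sub>R ?e b (F q))"
    by (rule conn_germ[OF S W v])
  also have "\<dots> = (\<Sum>b\<in>Basis. D p v (\<lambda>q. W q (\<lambda>x. d x \<bullet> b) *\<^sub>R ?e b (F q)))"
    by (rule conn_sum[OF field_near_scaleR[OF nc c] v])
  also have "\<dots> = (\<Sum>b\<in>Basis. v (\<lambda>q. W q (\<lambda>x. d x \<bullet> b)) *\<^sub>R ?e b (F p) +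
      W p (\<lambda>x. d x \<bullet> b) *\<^sub>R D p v (\<lambda>q. ?e b (F q)))"
    by (intro sum.cong refl conn_scaleR[OF nc c v])
  finally show ?thesis by (simp add: D_e sum.distrib scaleR_sum_right)
qed

text \<open>In coordinates the Christoffel terms of the two derivatives agree after an exchange of
  the summation indices. What remains is the bracket of \<open>X\<close> and \<open>Y\<close>,
  applied to the coordinates of \<open>d\<close> composed with \<open>F\<close>; torsion-freeness of
  \<open>nab\<close> expresses this bracket by \<open>nab\<close>.\<close>

lemma torsion_free:
  assumes X: "nearA p X" and Y: "nearA p Y"
  shows "D p (X p) (\<lambda>q. psh q (Y q)) - D p (Y p) (\<lambda>q. psh q (X q)) =
    psh p (nab p (X p) Y - nab p (Y p) X)"
proof -
  obtain V d where V: "(V, d) \<in> B" "F p \<in> V" by (rule cod.chart_at)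
  let ?e = "coord_vec B V d"
  have Xp: "X p \<in> tA p" and Yp: "Y p \<in> tA p" using X Y by (auto intro: nearA_tangent)
  have y: "smooth_at B (F q) (\<lambda>x. d x \<bullet> b)" if "q \<in> F -` V" for q b
    using coordinate_smooth_at[OF V(1), of "F q"] that by simp
  have coord: "psh p v (\<lambda>x. d x \<bullet> b) = v (\<lambda>x. d (F x) \<bullet> b)" for v b
    using y V by (simp add: push_apply)
  have oV: "open (F -` V)" "p \<in> F -` V" using open_preimage[OF cod.open_chart[OF V(1)]] V by auto
  have coord_deriv: "v (\<lambda>q. psh q (Z q) (\<lambda>x. d x \<bullet> b)) = v (\<lambda>q. Z q (\<lambda>x. d (F x) \<bullet> b))"
    if "v \<in> tA p" for v b Z
    by (rule dom.tangent_germ[OF that oV]) (rule push_apply[OF y])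
  define G where "G a b = nabb (F p) (?e a (F p)) (?e b)" for a b
  define u where "u = nab p (X p) Y - nab p (Y p) X"
  have u: "u \<in> tA p"
    unfolding u_def
    using tangent.conn_tangent[OF X Yp] tangent.conn_tangent[OF Y Xp] by (simp add: tA_closed)
  have u_eq: "u (\<lambda>x. d (F x) \<bullet> b) = X p (\<lambda>q. Y q (\<lambda>x. d (F x) \<bullet> b)) - Y p (\<lambda>q. X q (\<lambda>x. d (F x) \<bullet> b))" for b
    using nab X Y smooth_at_compose[OF y[OF oV(2)]] unfolding levi_civita_def u_def by blast
  have swap: "(\<Sum>b\<in>Basis. \<Sum>a\<in>Basis. (Y p (\<lambda>x. d (F x) \<bullet> b) * X p (\<lambda>x. d (F x) \<bullet> a)) *\<^sub>R G a b) =
      (\<Sum>b\<in>Basis. \<Sum>a\<in>Basis. (X p (\<lambda>x. d (F x) \<bullet> b) * Y p (\<lambda>x. d (F x) \<bullet> a)) *\<^sub>R G a b)"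
    unfolding G_def
    by (subst sum.swap) (simp add: coord_frame_nabb_commute[OF V] mult.commute)
  have "D p (X p) (\<lambda>q. psh q (Y q)) - D p (Y p) (\<lambda>q. psh q (X q)) =
    (\<Sum>b\<in>Basis. X p (\<lambda>q. Y q (\<lambda>x. d (F x) \<bullet> b)) *\<^sub>R ?e b (F p)) -
    (\<Sum>b\<in>Basis. Y p (\<lambda>q. X q (\<lambda>x. d (F x) \<bullet> b)) *\<^sub>R ?e b (F p))"
    using swap
    unfolding conn_expansion[OF field_near_push[OF Y] Xp V] conn_expansion[OF field_near_push[OF X] Yp V]
      coord coord_deriv[OF Xp] coord_deriv[OF Yp] G_def by simp
  also have "\<dots> = (\<Sum>b\<in>Basis. psh p u (\<lambda>x. d x \<bullet> b) *\<^sub>R ?e b (F p))"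
    unfolding coord u_eq by (simp add: sum_subtractf scaleR_diff_left)
  also have "\<dots> = psh p u" using cod.tangent_expansion[OF push_tangent[OF u] V] by simp
  finally show ?thesis by (simp add: u_def)
qed

lemma h_tangent:
  assumes "nearA p X" "nearA p Y"
  shows "h X Y p \<in> tB p"
  using conn_tangent[OF field_near_push[OF assms(2)] nearA_tangent[OF assms(1)]]
    push_tangent[OF tangent.conn_tangent[OF assms(2) nearA_tangent[OF assms(1)], simplified]]
  unfolding second_ff_def by (simp add: tangent_closed)

lemma h_sym:
  assumes "nearA p X" "nearA p Y"
  shows "h X Y p = h Y X p"
  using torsion_free[OF assms] unfolding second_ff_def push_diff by (simp add: algebra_simps)

text \<open>Both \<open>D\<close> and \<open>nab\<close> differentiate the same function, the
  induced metric of \<open>Y\<close> and \<open>Z\<close>: once as the ambient metric of the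
  pushed-forward fields, once intrinsically. Subtracting the two product rules leaves the terms with
  \<open>h\<close>.\<close>

lemma h_skew:
  assumes X: "nearA p X" and Y: "nearA p Y" and Z: "nearA p Z"
  shows "g (F p) (h X Y p) (psh p (Z p)) = - g (F p) (h X Z p) (psh p (Y p))"
proof -
  have v: "X p \<in> tA p" "psh p (Y p) \<in> tB p" "psh p (Z p) \<in> tB p"
    using X Y Z by (auto intro: nearA_tangent push_tangent)
  have DY: "D p (X p) (\<lambda>q. psh q (Y q)) \<in> tB p" and DZ: "D p (X p) (\<lambda>q. psh q (Z q)) \<in> tB p"
    using conn_tangent field_near_push X Y Z v by blast+
  have NY: "psh p (nab p (X p) Y) \<in> tB p" and NZ: "psh p (nab p (X p) Z) \<in> tB p"
    using tangent.conn_tangent[of p _ "X p"] push_tangent X Y Z v by auto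
  have "g (F p) (D p (X p) (\<lambda>q. psh q (Y q))) (psh p (Z p)) + g (F p) (psh p (Y p)) (D p (X p) (\<lambda>q. psh q (Z q)))
      = X p (\<lambda>q. induced_metric B F g q (Y q) (Z q))"
    using metric_compatible[OF field_near_push[OF Y] field_near_push[OF Z] v(1)]
    by (simp add: induced_metric_def)
  also have "\<dots> = g (F p) (psh p (nab p (X p) Y)) (psh p (Z p)) + g (F p) (psh p (Y p)) (psh p (nab p (X p) Z))"
    using nab v Y Z unfolding levi_civita_def by (simp add: induced_metric_def)
  finally show ?thesis
    unfolding second_ff_def
    using v DY DZ NY NZ g_sym[OF v(2) DZ] g_sym[OF v(2) NZ] by (simp add: g_left)
qed

text \<open>The trilinear form \<open>g (h X Y) Z\<close> is symmetric in its first two and skew in its last two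
  arguments, hence zero.\<close>

lemma h_normal:
  assumes X: "nearA p X" and Y: "nearA p Y"
  shows "h X Y p \<in> nspace p"
proof -
  have "g (F p) (h X Y p) (psh p v) = 0" if "v \<in> tA p" for v
  proof -
    have "v \<in> tangent_space A (id p)" using that by simp
    then obtain Z where Z: "nearA p Z" "Z p = v"
      by (rule tangent.field_near_extension) (rule that)
    let ?b = "\<lambda>X Y Z. g (F p) (h X Y p) (psh p (Z p))"
    have "?b X Y Z = ?b Y X Z" using h_sym[OF X Y] by simp
    also have "\<dots> = - ?b Y Z X" by (rule h_skew[OF Y X Z(1)])
    also have "\<dots> = - ?b Z Y X" using h_sym[OF Y Z(1)] by simp
    also have "\<dots> = ?b Z X Y" using h_skew[OF Z(1) Y X] by simp
    also have "\<dots> = ?b X Z Y" using h_sym[OF X Z(1)] by simp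
    also have "\<dots> = - ?b X Y Z" by (rule h_skew[OF X Z(1) Y])
    finally show ?thesis using Z by simp
  qed
  then show ?thesis unfolding normal_space_def using h_tangent[OF X Y] by simp
qed

section \<open>Orthogonal projections and their smoothness\<close>

lemma nspace_tangent: "w \<in> nspace p \<Longrightarrow> w \<in> tB p"
  unfolding normal_space_def by simp

lemma nspaceD: "w \<in> nspace p \<Longrightarrow> v \<in> tA p \<Longrightarrow> g (F p) w (psh p v) = 0"
  unfolding normal_space_def by simp

lemma subspace_nspace: "subspace (nspace p)"
  unfolding subspace_def normal_space_def
  by (auto simp: tangent_closed g_left push_tangent)

text \<open>The image of such a vector is orthogonal to itself, so positivity and injectivity of
  \<open>push\<close> make the vector vanish.\<close>

lemma push_normal_0:
  assumes "v \<in> tA p" "psh p v \<in> nspace p"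
  shows "v = 0"
  using nspaceD[OF assms(2,1)] g_eq_0[OF push_tangent[OF assms(1)]] push_eq_0[OF assms(1)] by simp

text \<open>Two candidates differ by a vector whose image is both tangent and normal, hence by 0;
  this gives the definite description in \<open>tangent_part\<close> its meaning. Existence is
  supplied by \<open>tangent_part_field\<close>.\<close>

lemma tangent_part_eqI:
  assumes v: "v \<in> tA p" and n: "w - psh p v \<in> nspace p"
  shows "tpart p w = v"
  unfolding tangent_part_def
proof (rule the_equality)
  show "v \<in> tA p \<and> w - psh p v \<in> nspace p" using assms by simp
  fix v' assume v': "v' \<in> tA p \<and> w - psh p v' \<in> nspace p"
  have "psh p (v' - v) = (w - psh p v) - (w - psh p v')" by (simp add: push_diff)
  then have "psh p (v' - v) \<in> nspace p"
    using subspace_diff[OF subspace_nspace n] v' by metis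
  then show "v' = v" using push_normal_0[of "v' - v" p] v v' by (simp add: tA_closed)
qed

lemma metric_smooth_fun:
  assumes "open S" "field_along A B F S W" "field_along A B F S Z"
  shows "smooth_fun A S (\<lambda>q. g (F q) (W q) (Z q))"
proof (rule dom.smooth_fun_local)
  fix p assume "p \<in> S"
  then have "near p W" "near p Z" using assms by (auto intro: field_nearI)
  from metric_smooth_at[OF this]
  show "\<exists>T. open T \<and> p \<in> T \<and> smooth_fun A T (\<lambda>q. g (F q) (W q) (Z q))"
    unfolding smooth_at_def .
qed

text \<open>In the frame expansion of \<open>z\<close> only indices from \<open>I\<close> survive,
  and \<open>w\<close> is orthogonal to those frame vectors. With all of \<open>Basis\<close> for
  \<open>I\<close> this yields normality of \<open>w\<close>.\<close>

lemma perp_frame_combination: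
  assumes U: "(U, c) \<in> A" "q \<in> U" and w: "w \<in> tB q" and z: "z \<in> tA q"
    and I: "\<And>b. b \<in> Basis - I \<Longrightarrow> z (\<lambda>x. c x \<bullet> b) = 0"
    and perp: "\<And>b. b \<in> I \<Longrightarrow> g (F q) w (psh q (coord_vec A U c b q)) = 0"
  shows "g (F q) w (psh q z) = 0"
proof -
  let ?e = "\<lambda>b. coord_vec A U c b q"
  have e: "psh q (?e b) \<in> tB q" for b by (rule push_tangent[OF dom.coord_vec_tangent[OF U]])
  have "psh q z = psh q (\<Sum>b\<in>Basis. z (\<lambda>x. c x \<bullet> b) *\<^sub>R ?e b)"
    using dom.tangent_expansion[OF z U] by simp
  also have "\<dots> = (\<Sum>b\<in>Basis. z (\<lambda>x. c x \<bullet> b) *\<^sub>R psh q (?e b))"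
    by (simp add: push_sum push_scaleR)
  finally have "g (F q) w (psh q z) = (\<Sum>b\<in>Basis. z (\<lambda>x. c x \<bullet> b) * g (F q) w (psh q (?e b)))"
    using w e by (simp add: g_right_sum g_right1 tangent_closed)
  also have "\<dots> = 0" by (intro sum.neutral ballI) (metis DiffI I perp mult_eq_0_iff)
  finally show ?thesis .
qed

text \<open>Membership of \<open>Z q\<close> in the span of the frame vectors from \<open>I\<close> is expressed by the vanishing
  of the other coordinates.\<close>

lemma gram_schmidt:
  assumes U: "(U, c) \<in> A" and S: "open S" "S \<subseteq> U"
  shows "finite I \<Longrightarrow> I \<subseteq> Basis \<Longrightarrow> field_along A B F S W \<Longrightarrow>
    \<exists>Z. vector_field A S Z \<and> (\<forall>q\<in>S. (\<forall>b\<in>Basis - I. Z q (\<lambda>x. c x \<bullet> b) = 0) \<and>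
      (\<forall>b\<in>I. g (F q) (W q - psh q (Z q)) (psh q (coord_vec A U c b q)) = 0))"
proof (induction I arbitrary: W rule: finite_induct)
  case empty
  show ?case
  proof (intro exI conjI ballI)
    show "vector_field A S (\<lambda>q. 0)" by (rule tangent.field_along_zero)
  qed (simp_all add: tvec_apply)
next
  case (insert i I)
  let ?e = "coord_vec A U c"
  have I: "I \<subseteq> Basis" "i \<in> Basis" "i \<notin> I" using insert by auto
  have U': "q \<in> U" if "q \<in> S" for q using that S by auto
  have eA: "vector_field A S (?e i)"
    by (rule tangent.field_along_subset[OF dom.coord_vec_field[OF U] S(2)])
  \<comment> \<open>The induction hypothesis is used twice: \<open>Y\<close> is the projection of
    the new frame vector to the span of the earlier ones, and \<open>Z\<close> is that of
    \<open>W\<close>.\<close>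
  obtain Y where Y: "vector_field A S Y" "\<And>q b. q \<in> S \<Longrightarrow> b \<in> Basis - I \<Longrightarrow> Y q (\<lambda>x. c x \<bullet> b) = 0"
    "\<And>q b. q \<in> S \<Longrightarrow> b \<in> I \<Longrightarrow> g (F q) (psh q (?e i q) - psh q (Y q)) (psh q (?e b q)) = 0"
    using insert.IH[OF I(1) field_along_push[OF S(1) eA]] by blast
  obtain Z where Z: "vector_field A S Z" "\<And>q b. q \<in> S \<Longrightarrow> b \<in> Basis - I \<Longrightarrow> Z q (\<lambda>x. c x \<bullet> b) = 0"
    "\<And>q b. q \<in> S \<Longrightarrow> b \<in> I \<Longrightarrow> g (F q) (W q - psh q (Z q)) (psh q (?e b q)) = 0"
    using insert.IH[OF I(1) insert.prems(2)] by blast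
  \<comment> \<open>\<open>E\<close> is the part of the new frame vector orthogonal to the earlier
    ones. Its coordinate in direction \<open>i\<close> is 1, as \<open>Y\<close> has none there, so
    \<open>E\<close> has no zero and division by its squared length stays smooth.\<close>
  define E where "E = (\<lambda>q. ?e i q - Y q)"
  have E: "vector_field A S E" unfolding E_def by (rule tangent.field_along_diff[OF S(1) eA Y(1)])
  have tang: "?e b q \<in> tA q" "Y q \<in> tA q" "Z q \<in> tA q" "E q \<in> tA q" "W q \<in> tB q" if "q \<in> S" for q b
    using tangent.field_along_tangent[OF Y(1) that] tangent.field_along_tangent[OF Z(1) that]
      tangent.field_along_tangent[OF E that] field_along_tangent[OF insert.prems(2) that]
      dom.coord_vec_tangent[OF U U'[OF that]] by simp_all
  note tangB = tang(1-4)[THEN push_tangent] tang(5)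
  have E_coord: "E q (\<lambda>x. c x \<bullet> b) = i \<bullet> b" if "q \<in> S" "b \<in> Basis - I" for q b
    using Y(2)[OF that] dom.coord_vec_coordinate[OF U U'[OF that(1)]] by (simp add: E_def tvec_apply)
  have E0: "E q \<noteq> 0" if "q \<in> S" for q
    using E_coord[OF that, of i] I by (auto simp: tvec_apply)
  have EE: "g (F q) (psh q (E q)) (psh q (E q)) \<noteq> 0" if "q \<in> S" for q
    using g_eq_0[OF tangB(4)[OF that]] push_eq_0[OF tang(4)[OF that]] E0[OF that] by blast
  \<comment> \<open>This is the coefficient of the projection of \<open>W\<close> to
    \<open>E\<close>; since \<open>Z\<close> is orthogonal to \<open>E\<close>, it is also the one
    for the remainder of \<open>W\<close> after subtracting \<open>Z\<close>.\<close>
  define r where "r = (\<lambda>q. g (F q) (W q) (psh q (E q)) * inverse (g (F q) (psh q (E q)) (psh q (E q))))"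
  have r: "smooth_fun A S r"
    unfolding r_def
    by (intro dom.smooth_fun_mult[OF S(1)] dom.smooth_fun_inverse[OF S(1)] metric_smooth_fun[OF S(1)]
        insert.prems field_along_push[OF S(1) E] EE)
  show ?case
  proof (intro exI conjI ballI)
    show "vector_field A S (\<lambda>q. Z q + r q *\<^sub>R E q)"
      by (rule tangent.field_along_add[OF S(1) Z(1) tangent.field_along_scaleR[OF S(1) E r]])
    fix q assume q: "q \<in> S"
    show "(Z q + r q *\<^sub>R E q) (\<lambda>x. c x \<bullet> b) = 0" if "b \<in> Basis - insert i I" for b
      using that I Z(2)[OF q] E_coord[OF q] by (auto simp: tvec_apply inner_Basis)
    note t = tangB[OF q]
    have wt: "W q - psh q (Z q) \<in> tB q" using t by (simp add: tangent_closed)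
    have E_perp: "g (F q) (psh q (E q)) (psh q (?e b q)) = 0" if "b \<in> I" for b
      using Y(3)[OF q that] by (simp add: E_def push_diff)
    have Z_perp: "g (F q) (psh q (E q)) (psh q (Z q)) = 0"
      by (rule perp_frame_combination[OF U U'[OF q] t(4) tang(3)[OF q] Z(2)[OF q] E_perp])
    have Y_perp1: "g (F q) (W q - psh q (Z q)) (psh q (Y q)) = 0"
      by (rule perp_frame_combination[OF U U'[OF q] wt tang(2)[OF q] Y(2)[OF q] Z(3)[OF q]])
    have Y_perp2: "g (F q) (psh q (E q)) (psh q (Y q)) = 0"
      by (rule perp_frame_combination[OF U U'[OF q] t(4) tang(2)[OF q] Y(2)[OF q] E_perp])
    have e_eq: "psh q (?e i q) = psh q (E q) + psh q (Y q)" by (simp add: E_def push_diff)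
    have r_eq: "r q * g (F q) (psh q (E q)) (psh q (E q)) = g (F q) (W q) (psh q (E q))"
      using EE[OF q] by (simp add: r_def)
    have W_eq: "W q - psh q (Z q + r q *\<^sub>R E q) = (W q - psh q (Z q)) - r q *\<^sub>R psh q (E q)"
      by (simp add: push_add push_scaleR)
    have split: "g (F q) (W q - psh q (Z q + r q *\<^sub>R E q)) u =
        g (F q) (W q - psh q (Z q)) u - r q * g (F q) (psh q (E q)) u" if "u \<in> tB q" for u
      unfolding W_eq using t wt that by (simp add: g_left tangent_closed del: diff_diff_eq2 diff_diff_eq)
    fix b assume b: "b \<in> insert i I"
    show "g (F q) (W q - psh q (Z q + r q *\<^sub>R E q)) (psh q (?e b q)) = 0"
    proof (cases "b = i")
      case True
      have "g (F q) (W q - psh q (Z q)) (psh q (E q)) = g (F q) (W q) (psh q (E q))"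
        using t Z_perp g_sym[OF t(3) t(4)] by (simp add: g_left)
      then show ?thesis
        unfolding True split[OF t(1)] unfolding e_eq
        using Y_perp1 Y_perp2 r_eq t wt by (simp add: g_right)
    next
      case False
      then show ?thesis
        using split[OF t(1)] E_perp Z(3)[OF q] b by simp
    qed
  qed
qed

text \<open>On a chart domain, \<open>gram_schmidt\<close> over the whole basis gives a smooth field
  whose difference from \<open>W\<close> is normal. Uniqueness identifies it with the tangent part,
  which settles existence and smoothness at once.\<close>

lemma tangent_part_field:
  assumes W: "near p W"
  obtains S where "open S" "p \<in> S" "field_along A B F S W"
    "vector_field A S (\<lambda>q. tpart q (W q))"
    "\<And>q. q \<in> S \<Longrightarrow> W q - psh q (tpart q (W q)) \<in> nspace q"
proof -
  obtain U c where U: "(U, c) \<in> A" "p \<in> U" by (rule dom.chart_at)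
  obtain R where R: "open R" "p \<in> R" "field_along A B F R W"
    using W unfolding field_near_def by auto
  define S where "S = R \<inter> U"
  have S: "open S" "S \<subseteq> U" "p \<in> S" using R U dom.open_chart unfolding S_def by auto
  have WS: "field_along A B F S W" by (rule field_along_subset[OF R(3)]) (simp add: S_def)
  obtain Z where Z: "vector_field A S Z"
    "\<And>q b. q \<in> S \<Longrightarrow> b \<in> Basis \<Longrightarrow> g (F q) (W q - psh q (Z q)) (psh q (coord_vec A U c b q)) = 0"
    using gram_schmidt[OF U(1) S(1,2) finite_Basis order_refl WS] by blast
  have ZA: "Z q \<in> tA q" if "q \<in> S" for q using tangent.field_along_tangent[OF Z(1) that] by simp
  have n: "W q - psh q (Z q) \<in> nspace q" if q: "q \<in> S" for q
  proof -
    have w: "W q - psh q (Z q) \<in> tB q"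
      using field_along_tangent[OF WS q] push_tangent[OF ZA[OF q]] by (simp add: tangent_closed)
    have "g (F q) (W q - psh q (Z q)) (psh q v) = 0" if "v \<in> tA q" for v
      by (rule perp_frame_combination[OF U(1) _ w that, of Basis]) (use q S Z(2) in auto)
    then show ?thesis unfolding normal_space_def using w by simp
  qed
  have eq: "tpart q (W q) = Z q" if "q \<in> S" for q
    by (rule tangent_part_eqI[OF ZA[OF that] n[OF that]])
  show ?thesis
  proof (rule that[OF S(1,3) WS])
    show "vector_field A S (\<lambda>q. tpart q (W q))"
      by (rule tangent.field_along_cong[OF S(1) Z(1)]) (simp add: eq)
    show "W q - psh q (tpart q (W q)) \<in> nspace q" if "q \<in> S" for q
      using n[OF that] eq[OF that] by simp
  qed
qed

lemma nearA_tangent_part: "near p W \<Longrightarrow> nearA p (\<lambda>q. tpart q (W q))"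
  by (rule tangent_part_field) (auto intro: tangent.field_nearI)

text \<open>The vector \<open>w\<close> is extended to a local field, so that both pointwise facts
  can be read off from \<open>tangent_part_field\<close>.\<close>

lemma tangent_part_tangent: "w \<in> tB p \<Longrightarrow> tpart p w \<in> tA p"
  and normal_part_normal: "w \<in> tB p \<Longrightarrow> npart p w \<in> nspace p"
proof -
  assume w: "w \<in> tB p"
  obtain W where W: "near p W" "W p = w" by (rule field_near_extension[OF w])
  show "tpart p w \<in> tA p" using nearA_tangent[OF nearA_tangent_part[OF W(1)]] W(2) by simp
  show "npart p w \<in> nspace p"
    unfolding normal_part_def by (rule tangent_part_field[OF W(1)]) (use W(2) in metis)
qed

lemma tangent_part_add:
  assumes "w \<in> tB p" "z \<in> tB p"
  shows "tpart p (w + z) = tpart p w + tpart p z"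
  using subspace_add[OF subspace_nspace assms[THEN normal_part_normal, unfolded normal_part_def]]
  by (intro tangent_part_eqI tA_closed assms[THEN tangent_part_tangent]) (simp add: push_add algebra_simps)

lemma tangent_part_scaleR:
  assumes "w \<in> tB p"
  shows "tpart p (r *\<^sub>R w) = r *\<^sub>R tpart p w"
  using subspace_scale[OF subspace_nspace normal_part_normal[OF assms, unfolded normal_part_def], of r]
  by (intro tangent_part_eqI tA_closed tangent_part_tangent[OF assms]) (simp add: push_scaleR algebra_simps)

lemma normal_part_add:
  "w \<in> tB p \<Longrightarrow> z \<in> tB p \<Longrightarrow> npart p (w + z) = npart p w + npart p z"
  by (simp add: normal_part_def tangent_part_add push_add)

lemma tangent_part_push: "v \<in> tA p \<Longrightarrow> tpart p (psh p v) = v"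
  by (rule tangent_part_eqI) (simp_all add: subspace_0[OF subspace_nspace])

lemma normal_part_push: "v \<in> tA p \<Longrightarrow> npart p (psh p v) = 0"
  by (simp add: normal_part_def tangent_part_push)

lemma normal_part_of_normal:
  assumes "w \<in> nspace p"
  shows "npart p w = w"
proof -
  have "tpart p w = 0"
    by (rule tangent_part_eqI) (simp_all add: tA_closed push_zero assms)
  then show ?thesis by (simp add: normal_part_def push_zero)
qed

lemma g_tangent_part: "w \<in> tB p \<Longrightarrow> v \<in> tA p \<Longrightarrow> g (F p) w (psh p v) = g (F p) (psh p (tpart p w)) (psh p v)"
  using nspaceD[OF normal_part_normal, of w p v]
  by (simp add: normal_part_def g_left tangent_part_tangent push_tangent)

text \<open>Both connections are linear in the direction, so the scalar has to be right at
  \<open>p\<close> only. This pointwise homogeneity replaces multiplication by a slant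
  function.\<close>

lemma h_direction:
  assumes "nearA p Y" "X' p \<in> tA p" "X p = r *\<^sub>R X' p"
  shows "h X Y p = r *\<^sub>R h X' Y p"
  using conn_direction_scaleR[OF field_near_push[OF assms(1)] assms(2), of r]
    tangent.conn_direction_scaleR[OF assms(1,2), of r] assms(3)
  by (simp add: second_ff_def push_scaleR scaleR_diff_right)

text \<open>The metric pairing of \<open>V\<close> with the image of \<open>Y\<close> is identically
  0. Differentiating it along \<open>X\<close> trades the derivative of \<open>V\<close> for that of
  \<open>Y\<close>, and normality of \<open>V p\<close> removes the intrinsic part of the
  latter.\<close>

lemma g_shape_op:
  assumes X: "nearA p X" and Y: "nearA p Y" and V: "near p V"
    and n: "\<And>q. V q \<in> nspace q" and YA: "\<And>q. Y q \<in> tA q"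
  shows "g (F p) (psh p (shape_op A B F g D V X p)) (psh p (Y p)) = g (F p) (h X Y p) (V p)"
proof -
  have v: "X p \<in> tA p" "Y p \<in> tA p" using X Y by (auto intro: nearA_tangent)
  have DV: "D p (X p) V \<in> tB p" by (rule conn_tangent[OF V v(1)])
  have DY: "D p (X p) (\<lambda>q. psh q (Y q)) \<in> tB p" by (rule conn_tangent[OF field_near_push[OF Y] v(1)])
  have NY: "nab p (X p) Y \<in> tA p" using tangent.conn_tangent[OF Y] v by simp
  have VB: "V p \<in> tB p" by (rule nspace_tangent[OF n])
  have "(\<lambda>q. g (F q) (V q) (psh q (Y q))) = (\<lambda>q. 0)" using nspaceD[OF n YA] by simp
  then have "g (F p) (D p (X p) V) (psh p (Y p)) + g (F p) (V p) (D p (X p) (\<lambda>q. psh q (Y q))) = 0"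
    using metric_compatible[OF V field_near_push[OF Y] v(1)] dom.tangent_const[OF v(1), of 0] by simp
  moreover have "g (F p) (D p (X p) V) (psh p (Y p)) = g (F p) (psh p (tpart p (D p (X p) V))) (psh p (Y p))"
    by (rule g_tangent_part[OF DV v(2)])
  moreover have "g (F p) (psh p (nab p (X p) Y)) (V p) = 0"
    using nspaceD[OF n NY] g_sym[OF VB push_tangent[OF NY]] by simp
  moreover have "psh p (- tpart p (D p (X p) V)) = - psh p (tpart p (D p (X p) V))"
    using push_scaleR[of p "-1"] by simp
  ultimately show ?thesis
    using g_sym[OF VB DY] tangent_part_tangent[OF DV, THEN push_tangent] push_tangent[OF v(2)] DY VB
      push_tangent[OF NY]
    by (simp add: shape_op_def second_ff_def g_left)
qed

end

section \<open>Submanifolds of Kaehler manifolds\<close>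

locale kaehler_submanifold = immersed_manifold A B F D g nabb nab
  for A :: "('m::{t2_space,second_countable_topology}, 'e::euclidean_space) atlas"
    and B :: "('n::{t2_space,second_countable_topology}, 'd::euclidean_space) atlas"
    and F D g nabb nab +
  fixes \<phi> :: "'n \<Rightarrow> 'n tvec \<Rightarrow> 'n tvec"
  assumes kaehler: "kaehler B \<phi> g nabb"
begin

abbreviation "T \<equiv> T_op A B F \<phi> g"
abbreviation "N \<equiv> N_op A B F \<phi> g"
abbreviation "n \<equiv> n_op A B F \<phi> g"
abbreviation "shape \<equiv> shape_op A B F g D"

section \<open>The complex structure along the immersion\<close>

lemma tensor11_phi: "tensor11 B \<phi>" and almost_hermitian_phi: "almost_hermitian B \<phi> g"
  using kaehler unfolding kaehler_def almost_hermitian_def by simp_all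

lemma phi_tangent: "w \<in> tangent_space B q \<Longrightarrow> \<phi> q w \<in> tangent_space B q"
  using tensor11_phi unfolding tensor11_def by simp

lemma phi_linear: "w \<in> tangent_space B q \<Longrightarrow> z \<in> tangent_space B q \<Longrightarrow>
    \<phi> q (r *\<^sub>R w + s *\<^sub>R z) = r *\<^sub>R \<phi> q w + s *\<^sub>R \<phi> q z"
  using tensor11_phi unfolding tensor11_def by simp

lemma phi_add: "w \<in> tangent_space B q \<Longrightarrow> z \<in> tangent_space B q \<Longrightarrow> \<phi> q (w + z) = \<phi> q w + \<phi> q z"
  using phi_linear[of w q z 1 1] by simp

lemma phi_scaleR: "w \<in> tangent_space B q \<Longrightarrow> \<phi> q (r *\<^sub>R w) = r *\<^sub>R \<phi> q w"
  using phi_linear[of w q w r 0] by simp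

lemma phi_phi: "w \<in> tangent_space B q \<Longrightarrow> \<phi> q (\<phi> q w) = - w"
  using almost_hermitian_phi unfolding almost_hermitian_def by simp

lemma g_phi: "w \<in> tangent_space B q \<Longrightarrow> z \<in> tangent_space B q \<Longrightarrow> g q (\<phi> q w) (\<phi> q z) = g q w z"
  using almost_hermitian_phi unfolding almost_hermitian_def by simp

text \<open>The isometry property is applied to \<open>\<phi> q w\<close> and \<open>z\<close>,
  where the square of \<open>\<phi>\<close> contributes the sign.\<close>

lemma phi_skew:
  assumes "w \<in> tangent_space B q" "z \<in> tangent_space B q"
  shows "g q (\<phi> q w) z = - g q w (\<phi> q z)"
  using g_phi[OF phi_tangent[OF assms(1)] assms(2)] assms
  by (simp add: phi_phi g_left phi_tangent)

lemma phi_field: "open S \<Longrightarrow> vector_field B S X \<Longrightarrow> vector_field B S (\<lambda>q. \<phi> q (X q))"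
  using tensor11_phi unfolding tensor11_def by simp

lemma phi_near_ambient:
  assumes "field_near B B id q X"
  shows "field_near B B id q (\<lambda>q. \<phi> q (X q))"
proof -
  from assms obtain S where S: "open S" "q \<in> S" "vector_field B S X"
    unfolding field_near_def by auto
  show ?thesis by (rule ambient.field_nearI[OF S(1,2) phi_field[OF S(1,3)]])
qed

lemma phi_nabb: "v \<in> tangent_space B q \<Longrightarrow> field_near B B id q Y \<Longrightarrow>
    nabb q v (\<lambda>x. \<phi> x (Y x)) = \<phi> q (nabb q v Y)"
  using kaehler unfolding kaehler_def by simp

text \<open>Smoothness of \<open>\<phi>\<close> is given on ambient fields, so smoothness along the
  immersion has to be carried through the frame induction together with the commutation rule. For
  multiples by \<open>f\<close>, the Leibniz term with \<open>v f\<close> agrees on both sides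
  because \<open>\<phi>\<close> is linear at each point.\<close>

lemma phi_parallel_aux:
  assumes "near p W"
  shows "near p (\<lambda>q. \<phi> (F q) (W q)) \<and> (\<forall>v\<in>tA p. D p v (\<lambda>q. \<phi> (F q) (W q)) = \<phi> (F p) (D p v W))"
  using assms
proof (induction rule: frame_induct)
  case (compose X)
  have nX: "field_near B B id (F p) (\<lambda>q. \<phi> q (X q))" by (rule phi_near_ambient[OF compose])
  show ?case
  proof (intro conjI ballI)
    show "near p (\<lambda>q. \<phi> (F q) (X (F q)))" by (rule field_near_compose[OF nX])
    show "D p v (\<lambda>q. \<phi> (F q) (X (F q))) = \<phi> (F p) (D p v (\<lambda>q. X (F q)))" if v: "v \<in> tA p" for v
      by (simp add: D_compose[OF v nX] D_compose[OF v compose] phi_nabb[OF push_tangent[OF v] compose])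
  qed
next
  case (add W Z)
  obtain S where S: "open S" "p \<in> S" "field_along A B F S W" "field_along A B F S Z"
    by (rule field_near2[OF add(1,2)])
  have eq: "\<phi> (F q) (W q) + \<phi> (F q) (Z q) = \<phi> (F q) (W q + Z q)" if "q \<in> S" for q
    using phi_add field_along_tangent[OF S(3) that] field_along_tangent[OF S(4) that] by simp
  have nW: "near p (\<lambda>q. \<phi> (F q) (W q))" and nZ: "near p (\<lambda>q. \<phi> (F q) (Z q))" using add by auto
  note nWZ = field_near_add[OF nW nZ]
  show ?case
  proof (intro conjI ballI)
    show "near p (\<lambda>q. \<phi> (F q) (W q + Z q))" by (rule field_near_cong[OF S(1,2) eq nWZ])
    fix v assume v: "v \<in> tA p"
    have "D p v (\<lambda>q. \<phi> (F q) (W q + Z q)) = D p v (\<lambda>q. \<phi> (F q) (W q) + \<phi> (F q) (Z q))"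
      by (rule conn_germ[OF S(1,2) eq nWZ v, symmetric])
    also have "\<dots> = \<phi> (F p) (D p v W) + \<phi> (F p) (D p v Z)"
      using add(3,4) v conn_add[OF nW nZ v] by simp
    also have "\<dots> = \<phi> (F p) (D p v (\<lambda>q. W q + Z q))"
      using conn_add[OF add(1,2) v] phi_add[OF conn_tangent[OF add(1) v] conn_tangent[OF add(2) v]] by simp
    finally show "D p v (\<lambda>q. \<phi> (F q) (W q + Z q)) = \<phi> (F p) (D p v (\<lambda>q. W q + Z q))" .
  qed
next
  case (scaleR f W)
  obtain S where S: "open S" "p \<in> S" "\<And>q. q \<in> S \<Longrightarrow> W q \<in> tB q"
    by (rule field_near_nbhd[OF scaleR(2)]) (rule that)
  have eq: "f q *\<^sub>R \<phi> (F q) (W q) = \<phi> (F q) (f q *\<^sub>R W q)" if "q \<in> S" for q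
    using phi_scaleR[OF S(3)[OF that]] by simp
  have nW: "near p (\<lambda>q. \<phi> (F q) (W q))" using scaleR by auto
  note nfW = field_near_scaleR[OF nW scaleR(1)]
  have Wp: "W p \<in> tB p" by (rule S(3)[OF S(2)])
  show ?case
  proof (intro conjI ballI)
    show "near p (\<lambda>q. \<phi> (F q) (f q *\<^sub>R W q))" by (rule field_near_cong[OF S(1,2) eq nfW])
    fix v assume v: "v \<in> tA p"
    have "D p v (\<lambda>q. \<phi> (F q) (f q *\<^sub>R W q)) = D p v (\<lambda>q. f q *\<^sub>R \<phi> (F q) (W q))"
      by (rule conn_germ[OF S(1,2) eq nfW v, symmetric])
    also have "\<dots> = v f *\<^sub>R \<phi> (F p) (W p) + f p *\<^sub>R \<phi> (F p) (D p v W)"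
      using scaleR(3) v conn_scaleR[OF nW scaleR(1) v] by simp
    also have "\<dots> = \<phi> (F p) (D p v (\<lambda>q. f q *\<^sub>R W q))"
      using conn_scaleR[OF scaleR(2,1) v] phi_linear[OF Wp conn_tangent[OF scaleR(2) v]] by simp
    finally show "D p v (\<lambda>q. \<phi> (F q) (f q *\<^sub>R W q)) = \<phi> (F p) (D p v (\<lambda>q. f q *\<^sub>R W q))" .
  qed
next
  case (germ S W Z)
  have eq: "\<phi> (F q) (W q) = \<phi> (F q) (Z q)" if "q \<in> S" for q using germ(3)[OF that] by simp
  have nW: "near p (\<lambda>q. \<phi> (F q) (W q))" using germ by auto
  show ?case
  proof (intro conjI ballI)
    show "near p (\<lambda>q. \<phi> (F q) (Z q))" by (rule field_near_cong[OF germ(1,2) eq nW])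
    show "D p v (\<lambda>q. \<phi> (F q) (Z q)) = \<phi> (F p) (D p v Z)" if v: "v \<in> tA p" for v
      using conn_germ[OF germ(1,2) eq nW v] conn_germ[OF germ(1,2,3,4) v] germ(5) v by simp
  qed
qed

lemma near_phi: "near p W \<Longrightarrow> near p (\<lambda>q. \<phi> (F q) (W q))"
  and phi_parallel: "near p W \<Longrightarrow> v \<in> tA p \<Longrightarrow> D p v (\<lambda>q. \<phi> (F q) (W q)) = \<phi> (F p) (D p v W)"
  using phi_parallel_aux by blast+

section \<open>The operator \<open>T\<close> and the derivative of \<open>N\<close>\<close>

lemma T_tangent: "v \<in> tA p \<Longrightarrow> T p v \<in> tA p"
  unfolding T_op_def by (intro tangent_part_tangent phi_tangent push_tangent)

lemma T_add: "v \<in> tA p \<Longrightarrow> w \<in> tA p \<Longrightarrow> T p (v + w) = T p v + T p w"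
  unfolding T_op_def by (simp add: push_add phi_add tangent_part_add phi_tangent push_tangent)

lemma T_scaleR: "v \<in> tA p \<Longrightarrow> T p (r *\<^sub>R v) = r *\<^sub>R T p v"
  unfolding T_op_def by (simp add: push_scaleR phi_scaleR tangent_part_scaleR phi_tangent push_tangent)

lemma g_T: "v \<in> tA p \<Longrightarrow> w \<in> tA p \<Longrightarrow>
    g (F p) (psh p (T p v)) (psh p w) = g (F p) (\<phi> (F p) (psh p v)) (psh p w)"
  unfolding T_op_def using g_tangent_part[of "\<phi> (F p) (psh p v)" p w] by (simp add: phi_tangent push_tangent)

lemma T_skew:
  assumes v: "v \<in> tA p" and w: "w \<in> tA p"
  shows "g (F p) (psh p (T p v)) (psh p w) = - g (F p) (psh p v) (psh p (T p w))"
  using g_T[OF v w] g_T[OF w v] v w phi_skew[of "psh p v" "F p" "psh p w"]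
    g_sym[of "psh p v" "F p" "psh p (T p w)"] g_sym[of "psh p v" "F p" "\<phi> (F p) (psh p w)"]
  by (simp add: push_tangent phi_tangent T_tangent)

lemma nearA_T: "nearA p X \<Longrightarrow> nearA p (\<lambda>q. T q (X q))"
  unfolding T_op_def by (intro nearA_tangent_part near_phi field_near_push)

lemma nearA_of_field: "vector_field A UNIV X \<Longrightarrow> nearA p X"
  by (rule tangent.field_nearI[OF open_UNIV UNIV_I])

lemma field_T: "vector_field A UNIV X \<Longrightarrow> vector_field A UNIV (\<lambda>q. T q (X q))"
  by (rule tangent.field_along_local) (simp add: nearA_T nearA_of_field)

lemma n_h_eq:
  assumes X: "nearA p X" and Y: "nearA p Y"
    and N0: "nabla_N A B F \<phi> g D nab X Y p = 0"
  shows "n p (h X Y p) = h X (\<lambda>q. T q (Y q)) p"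
proof -
  have v: "X p \<in> tA p" using X by (rule nearA_tangent)
  have nY: "near p (\<lambda>q. psh q (Y q))" by (rule field_near_push[OF Y])
  have nT: "near p (\<lambda>q. psh q (T q (Y q)))" by (rule field_near_push[OF nearA_T[OF Y]])
  have N_eq: "N q (Y q) = \<phi> (F q) (psh q (Y q)) - psh q (T q (Y q))" for q
    by (simp add: N_op_def T_op_def normal_part_def)
  have nN: "near p (\<lambda>q. N q (Y q))"
    unfolding N_eq by (rule field_near_diff[OF near_phi[OF nY] nT])
  have NY: "nab p (X p) Y \<in> tA p" using tangent.conn_tangent[OF Y] v by simp
  have NT: "nab p (X p) (\<lambda>q. T q (Y q)) \<in> tA p" using tangent.conn_tangent[OF nearA_T[OF Y]] v by simp
  have hY: "h X Y p \<in> nspace p" and hT: "h X (\<lambda>q. T q (Y q)) p \<in> nspace p"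
    by (rule h_normal[OF X Y], rule h_normal[OF X nearA_T[OF Y]])
  have "D p (X p) (\<lambda>q. psh q (T q (Y q))) + D p (X p) (\<lambda>q. N q (Y q)) = \<phi> (F p) (D p (X p) (\<lambda>q. psh q (Y q)))"
    using conn_add[OF nT nN v] phi_parallel[OF nY v] by (simp add: N_eq)
  also have "D p (X p) (\<lambda>q. psh q (Y q)) = psh p (nab p (X p) Y) + h X Y p"
    by (simp add: second_ff_def)
  also have "D p (X p) (\<lambda>q. psh q (T q (Y q))) =
      psh p (nab p (X p) (\<lambda>q. T q (Y q))) + h X (\<lambda>q. T q (Y q)) p"
    by (simp add: second_ff_def)
  finally have "npart p (psh p (nab p (X p) (\<lambda>q. T q (Y q))) + h X (\<lambda>q. T q (Y q)) p +
      D p (X p) (\<lambda>q. N q (Y q))) = npart p (\<phi> (F p) (psh p (nab p (X p) Y) + h X Y p))"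
    by simp
  then have "h X (\<lambda>q. T q (Y q)) p + npart p (D p (X p) (\<lambda>q. N q (Y q))) =
      npart p (\<phi> (F p) (psh p (nab p (X p) Y))) + npart p (\<phi> (F p) (h X Y p))"
    using push_tangent[OF NT] push_tangent[OF NY] nspace_tangent[OF hY] nspace_tangent[OF hT]
      conn_tangent[OF nN v]
    by (simp add: normal_part_add phi_add phi_tangent tangent_closed normal_part_push[OF NT]
        normal_part_of_normal[OF hT])
  \<comment> \<open>\<open>N0\<close> equates the normal derivative of \<open>N Y\<close> with
    \<open>N\<close> of the intrinsic derivative of \<open>Y\<close>, so these two terms
    cancel.\<close>
  moreover have "npart p (D p (X p) (\<lambda>q. N q (Y q))) = npart p (\<phi> (F p) (psh p (nab p (X p) Y)))"
    using N0 by (simp add: nabla_N_def normal_conn_def N_op_def)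
  ultimately show ?thesis by (simp add: n_op_def)
qed

lemma normal_field_h:
  assumes "vector_field A UNIV X" "vector_field A UNIV Y"
  shows "normal_field A B F g (h X Y)"
  unfolding normal_field_def
proof (intro conjI allI)
  show "field_along A B F UNIV (h X Y)"
    unfolding second_ff_def
    by (rule field_along_diff[OF open_UNIV conn_field[OF open_UNIV assms(1) field_along_push[OF open_UNIV assms(2)]]
          field_along_push[OF open_UNIV tangent.conn_field[OF open_UNIV assms]]])
  show "h X Y p \<in> nspace p" for p
    using assms by (intro h_normal nearA_of_field)
qed

lemma near_of_normal_field: "normal_field A B F g V \<Longrightarrow> near p V"
  unfolding normal_field_def by (auto intro: field_nearI)

lemma field_shape_op:
  assumes X: "vector_field A UNIV X" and V: "normal_field A B F g V"
  shows "vector_field A UNIV (shape V X)"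
proof -
  have "field_along A B F UNIV (\<lambda>p. D p (X p) V)"
    using conn_field[OF open_UNIV X] V unfolding normal_field_def by blast
  then have "vector_field A UNIV (\<lambda>p. tpart p (D p (X p) V))"
    by (intro tangent.field_along_local nearA_tangent_part) (auto intro: field_nearI)
  from tangent.field_along_diff[OF open_UNIV tangent.field_along_zero this]
  moreover have "shape V X = (\<lambda>p. 0 - tpart p (D p (X p) V))" by (simp add: shape_op_def fun_eq_iff)
  ultimately show ?thesis by (simp only:)
qed

text \<open>Since \<open>T\<close> maps \<open>S\<close> into itself, \<open>T p v\<close>
  represents the orthogonal projection of the rotated vector to \<open>S\<close>. By Cauchy-Schwarz
  the angle is smallest at this projection, so its cosine is the length of \<open>T p v\<close>
  divided by that of the rotated vector, and \<open>\<phi>\<close> preserves lengths.\<close>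

lemma slant_cos:
  assumes S: "subspace S" "S \<subseteq> tA p" "T p ` S \<subseteq> S"
    and angle: "\<And>v. v \<in> S - {0} \<Longrightarrow> subspace_angle (g (F p)) (\<phi> (F p) (psh p v)) (psh p ` S) = \<theta>"
    and v: "v \<in> S"
  shows "g (F p) (psh p (T p v)) (psh p (T p v)) = (cos \<theta>)\<^sup>2 * g (F p) (psh p v) (psh p v)"
proof (cases "v = 0")
  case True
  have "T p 0 = 0" using T_scaleR[OF tA_closed(1), of p 0] by simp
  then show ?thesis using True g_zero_left[OF tangent_closed(1)] by (simp add: push_zero)
next
  case False
  define a where "a = \<phi> (F p) (psh p v)"
  define x where "x = psh p (T p v)"
  have vA: "v \<in> tA p" and TS: "T p v \<in> S" using S v by auto
  have a: "a \<in> tB p" and x: "x \<in> tB p"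
    unfolding a_def x_def by (intro phi_tangent push_tangent T_tangent vA)+
  have v0: "psh p v \<noteq> 0" using push_eq_0[OF vA] False by blast
  have gaa: "g (F p) a a = g (F p) (psh p v) (psh p v)"
    unfolding a_def by (intro g_phi push_tangent vA)
  then have apos: "g (F p) a a > 0" using g_pos[OF push_tangent[OF vA] v0] by simp
  have gax: "g (F p) a (psh p w) = g (F p) x (psh p w)" if "w \<in> S" for w
    unfolding a_def x_def using g_T[OF vA] S that by (metis subsetD)
  have ang: "(INF w\<in>psh p ` S - {0}. vec_angle (g (F p)) a w) = \<theta>"
    using angle[of v] v False unfolding subspace_angle_def a_def by blast
  show ?thesis
  proof (cases "T p v = 0")
    case True
    then have x0: "x = 0" by (simp add: x_def push_zero)
    \<comment> \<open>If the projection is 0, all of \<open>S\<close> is orthogonal to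
      \<open>a\<close> and every angle is a right one. The infimum of this constant is taken over a
      nonempty set because \<open>v\<close> is nonzero.\<close>
    have "vec_angle (g (F p)) a w = pi / 2" if "w \<in> psh p ` S - {0}" for w
    proof -
      have "g (F p) a w = 0"
        using that gax x0 S g_zero_left push_tangent by auto
      then show ?thesis by (simp add: vec_angle_def)
    qed
    then have "(INF w\<in>psh p ` S - {0}. vec_angle (g (F p)) a w) = (INF w\<in>psh p ` S - {0}. pi / 2)"
      by (intro INF_cong refl)
    moreover have "psh p ` S - {0} \<noteq> {}" using v v0 by blast
    ultimately have "\<theta> = pi / 2" unfolding ang by (metis cINF_const)
    then have "cos \<theta> = 0" by (simp only: cos_pi_half)
    then show ?thesis using x0 x_def g_zero_left[OF tangent_closed(1)] by simp
  next
    case False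
    have xne: "x \<noteq> 0" unfolding x_def using push_eq_0[OF T_tangent[OF vA]] False by blast
    define A' where "A' = sqrt (g (F p) a a)"
    define X' where "X' = sqrt (g (F p) x x)"
    have pos: "A' > 0" "X' > 0" unfolding A'_def X'_def using apos g_pos[OF x xne] by simp_all
    \<comment> \<open>As \<open>a\<close> and \<open>x\<close> pair equally with \<open>S\<close>,
      pairing \<open>a\<close> with its projection \<open>x\<close> gives the squared length of
      \<open>x\<close>.\<close>
    have xx: "g (F p) a x = X' * X'"
      using gax[OF TS] g_nonneg[OF x] by (simp add: X'_def x_def)
    have "X' * X' \<le> A' * X'"
      using g_cauchy_schwarz[OF a x] xx by (simp add: A'_def X'_def)
    then have XA: "X' / A' \<le> 1" using pos by simp
    have "(INF w\<in>psh p ` S - {0}. vec_angle (g (F p)) a w) = arccos (X' / A')"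
    proof (rule cInf_eq_minimum)
      have "vec_angle (g (F p)) a x = arccos (X' / A')"
        using pos unfolding vec_angle_def xx A'_def[symmetric] X'_def[symmetric] by simp
      moreover have "x \<in> psh p ` S - {0}" using xne TS by (auto simp: x_def)
      ultimately show "arccos (X' / A') \<in> (\<lambda>w. vec_angle (g (F p)) a w) ` (psh p ` S - {0})"
        by (metis image_eqI)
    next
      fix y assume "y \<in> (\<lambda>w. vec_angle (g (F p)) a w) ` (psh p ` S - {0})"
      then obtain w where w: "w \<in> S" "psh p w \<noteq> 0" "y = vec_angle (g (F p)) a (psh p w)" by auto
      have wB: "psh p w \<in> tB p" using w S push_tangent by blast
      define W' where "W' = sqrt (g (F p) (psh p w) (psh p w))"
      have W': "W' > 0" unfolding W'_def using g_pos[OF wB w(2)] by simp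
      have u: "g (F p) a (psh p w) \<le> X' * W'"
        using gax[OF w(1)] g_cauchy_schwarz[OF x wB] by (simp add: X'_def W'_def)
      have l: "- (A' * W') \<le> g (F p) a (psh p w)"
        using g_cauchy_schwarz[OF a wB] by (simp add: A'_def W'_def)
      \<comment> \<open>Monotonicity of \<open>arccos\<close> is confined to the interval from -1 to
        1, so the quotient also wants a lower bound, which is Cauchy-Schwarz for \<open>a\<close>
        itself.\<close>
      have "g (F p) a (psh p w) / (A' * W') \<le> X' / A'" "- 1 \<le> g (F p) a (psh p w) / (A' * W')"
        using u l pos W' by (simp_all add: field_simps)
      then have "arccos (X' / A') \<le> arccos (g (F p) a (psh p w) / (A' * W'))"
        using XA by (intro arccos_le_arccos) auto
      then show "arccos (X' / A') \<le> y"
        unfolding w(3) vec_angle_def A'_def[symmetric] W'_def[symmetric] by simp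
    qed
    then have "cos \<theta> = X' / A'"
      using ang XA pos by (simp add: cos_arccos order_trans[of "-1" 0])
    then have "(cos \<theta>)\<^sup>2 * (A' * A') = X' * X'" using pos by (simp add: power2_eq_square)
    then show ?thesis
      using g_nonneg[OF x] g_nonneg[OF a] gaa by (simp add: A'_def X'_def x_def)
  qed
qed

text \<open>On \<open>S\<close>, polarization of \<open>slant_cos\<close> gives equality of the
  pairing of \<open>T v\<close> with \<open>T w\<close> and \<open>c\<close> times that of
  \<open>v\<close> with \<open>w\<close>. By skew-symmetry the sum \<open>u\<close> of
  \<open>T (T v)\<close> and \<open>c v\<close> is then orthogonal to \<open>S\<close>; it lies in
  \<open>S\<close> itself, hence vanishes.\<close>

lemma slant_T_square:
  assumes S: "subspace S" "S \<subseteq> tA p" "T p ` S \<subseteq> S"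
    and angle: "\<And>v. v \<in> S - {0} \<Longrightarrow> subspace_angle (g (F p)) (\<phi> (F p) (psh p v)) (psh p ` S) = \<theta>"
    and v: "v \<in> S"
  shows "T p (T p v) = - (cos \<theta>)\<^sup>2 *\<^sub>R v"
proof -
  define c where "c = (cos \<theta>)\<^sup>2"
  let ?q = "\<lambda>v w. g (F p) (psh p v) (psh p w)"
  have norm: "?q (T p v) (T p v) = c * ?q v v" if "v \<in> S" for v
    unfolding c_def by (rule slant_cos[OF S angle that])
  have SA: "w \<in> tA p" "T p w \<in> tA p" "T p w \<in> S" if "w \<in> S" for w
    using S that T_tangent by auto
  have polar: "?q (T p v) (T p w) = c * ?q v w" if vw: "v \<in> S" "w \<in> S" for v w
  proof -
    have t: "psh p v \<in> tB p" "psh p w \<in> tB p" "psh p (T p v) \<in> tB p" "psh p (T p w) \<in> tB p"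
      using vw SA push_tangent by auto
    have "?q (T p (v + w)) (T p (v + w)) = c * ?q (v + w) (v + w)"
      by (rule norm[OF subspace_add[OF S(1) vw]])
    moreover have "T p (v + w) = T p v + T p w" by (rule T_add[OF SA(1)[OF vw(1)] SA(1)[OF vw(2)]])
    ultimately have "?q (T p v) (T p v) + 2 * ?q (T p v) (T p w) + ?q (T p w) (T p w) =
        c * (?q v v + 2 * ?q v w + ?q w w)"
      using t g_sym[OF t(1,2)] g_sym[OF t(3,4)]
      by (simp add: push_add g_left g_right tangent_closed ac_simps)
    then show ?thesis using norm[OF vw(1)] norm[OF vw(2)] by (simp add: algebra_simps)
  qed
  define u where "u = T p (T p v) + c *\<^sub>R v"
  have TT: "T p (T p v) \<in> S" using SA v by blast
  have u: "u \<in> S" unfolding u_def by (intro subspace_add[OF S(1)] TT subspace_scale[OF S(1) v])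
  have uA: "u \<in> tA p" using u S by blast
  have t: "psh p (T p (T p v)) \<in> tB p" "psh p v \<in> tB p" "psh p u \<in> tB p"
    using TT v u SA push_tangent by auto
  have "g (F p) (psh p u) z = g (F p) (psh p (T p (T p v))) z + c * g (F p) (psh p v) z"
    if "z \<in> tB p" for z
    using t that by (simp add: u_def push_add push_scaleR g_left tangent_closed)
  then have "?q u u = ?q (T p (T p v)) u + c * ?q v u" using t(3) .
  also have "\<dots> = 0"
    using T_skew[OF SA(2)[OF v] uA] polar[OF v u] by simp
  finally have "u = 0" using g_eq_0[OF t(3)] push_eq_0[OF uA] by blast
  then show ?thesis by (simp add: u_def c_def eq_neg_iff_add_eq_0)
qed

text \<open>On an invariant fibre \<open>\<phi>\<close> has no normal component, so
  \<open>push\<close> intertwines \<open>T\<close> with \<open>\<phi>\<close>, and the relation for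
  the square of \<open>\<phi>\<close> descends by injectivity of \<open>push\<close>.\<close>

lemma invariant_T_square:
  assumes S: "S \<subseteq> tA p" and inv: "\<phi> (F p) ` psh p ` S \<subseteq> psh p ` S" and v: "v \<in> S"
  shows "T p (T p v) = - v"
proof -
  have phi_T: "psh p (T p w) = \<phi> (F p) (psh p w) \<and> T p w \<in> S" if w: "w \<in> S" for w
  proof -
    from inv w obtain w' where w': "w' \<in> S" "\<phi> (F p) (psh p w) = psh p w'" by blast
    then have "T p w = w'" unfolding T_op_def using tangent_part_push S by auto
    then show ?thesis using w' by simp
  qed
  have vA: "v \<in> tA p" using v S by blast
  have "psh p (T p (T p v)) = \<phi> (F p) (\<phi> (F p) (psh p v))"
    using phi_T v by metis
  also have "\<dots> = - psh p v" by (rule phi_phi[OF push_tangent[OF vA]])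
  finally have "psh p (T p (T p v) + v) = 0" by (simp add: push_add)
  moreover have "T p (T p v) + v \<in> tA p" by (intro tA_closed T_tangent vA)
  ultimately show ?thesis using push_eq_0 by (metis eq_neg_iff_add_eq_0)
qed

end

section \<open>Consequences of a parallel \<open>N\<close>\<close>

locale parallel_normal_submanifold = kaehler_submanifold +
  assumes nabla_N_zero: "\<And>X Y p. vector_field A UNIV X \<Longrightarrow> vector_field A UNIV Y \<Longrightarrow>
    nabla_N A B F \<phi> g D nab X Y p = 0"
begin

lemma n_h: "vector_field A UNIV X \<Longrightarrow> vector_field A UNIV Y \<Longrightarrow>
    n p (h X Y p) = h X (\<lambda>q. T q (Y q)) p"
  by (intro n_h_eq nearA_of_field nabla_N_zero)

lemma n_n_h:
  assumes X: "vector_field A UNIV X" and Y: "vector_field A UNIV Y"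
  shows "n p (n p (h X Y p)) = h X (\<lambda>q. T q (T q (Y q))) p"
  using n_h[OF X Y] n_h[OF X field_T[OF Y]] by simp

text \<open>\<open>T2\<close> is known at \<open>p\<close> alone, while the second slot of
  \<open>h\<close> is differentiated. Symmetry moves the field to the first slot, where only its
  value at \<open>p\<close> counts.\<close>

lemma n_n_h_right:
  assumes X: "vector_field A UNIV X" and Y: "vector_field A UNIV Y"
    and T2: "T p (T p (Y p)) = - c *\<^sub>R Y p"
  shows "n p (n p (h X Y p)) = - c *\<^sub>R h X Y p"
proof -
  let ?Z = "\<lambda>q. T q (T q (Y q))"
  note near = nearA_of_field[OF X] nearA_of_field[OF Y] nearA_of_field[OF field_T[OF field_T[OF Y]]]
  have "n p (n p (h X Y p)) = h ?Z X p" unfolding n_n_h[OF X Y] by (rule h_sym[OF near(1,3)])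
  also have "\<dots> = - c *\<^sub>R h Y X p"
    by (rule h_direction[where X = ?Z and X' = Y and p = p, OF near(1) nearA_tangent[OF near(2)] T2])
  also have "h Y X p = h X Y p" by (rule h_sym[OF near(2,1)])
  finally show ?thesis .
qed

text \<open>By symmetry the factor may equally be taken from the first slot; comparing both slots is
  what forces mixed terms to vanish.\<close>

lemma n_n_h_left:
  assumes X: "vector_field A UNIV X" and Y: "vector_field A UNIV Y"
    and T2: "T p (T p (X p)) = - c *\<^sub>R X p"
  shows "n p (n p (h X Y p)) = - c *\<^sub>R h X Y p"
  using n_n_h_right[OF Y X T2] h_sym[OF nearA_of_field[OF X] nearA_of_field[OF Y]] by metis

text \<open>The constant \<open>c\<close> is the value of the slant factor at \<open>p\<close>, so that \<open>U\<close> below is a smooth field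
  without any smoothness of the slant function, and no extension of tangent vectors is needed.\<close>

lemma T_T_shape:
  assumes X: "vector_field A UNIV X" and V: "normal_field A B F g V"
    and T2: "T p (T p (X p)) = - c *\<^sub>R X p"
  shows "T p (T p (shape V X p)) = - c *\<^sub>R shape V X p"
proof -
  define Q where "Q = shape V X"
  have Q: "vector_field A UNIV Q" unfolding Q_def by (rule field_shape_op[OF X V])
  define U where "U = (\<lambda>q. T q (T q (Q q)) + c *\<^sub>R Q q)"
  have U: "vector_field A UNIV U"
    unfolding U_def
    by (rule tangent.field_along_add[OF open_UNIV field_T[OF field_T[OF Q]]
          tangent.field_along_scaleR[OF open_UNIV Q smooth_fun_const]])
  have TTU: "vector_field A UNIV (\<lambda>q. T q (T q (U q)))" by (intro field_T U)
  have val: "Z q \<in> tA q" if "vector_field A UNIV Z" for Z q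
    by (rule nearA_tangent[OF nearA_of_field[OF that]])
  have Vn: "V q \<in> nspace q" for q using V unfolding normal_field_def by blast
  have shape: "g (F p) (psh p (Q p)) (psh p (Z p)) = g (F p) (h X Z p) (V p)"
    if Z: "vector_field A UNIV Z" for Z
    unfolding Q_def
    by (rule g_shape_op[OF nearA_of_field[OF X] nearA_of_field[OF Z] near_of_normal_field[OF V] Vn val[OF Z]])
  have split: "g (F p) (psh p (U p)) z = g (F p) (psh p (T p (T p (Q p)))) z + c * g (F p) (psh p (Q p)) z"
    if "z \<in> tB p" for z
    using that val[OF Q] by (simp add: U_def push_add push_scaleR g_left tangent_closed push_tangent T_tangent)
  have hB: "h X U p \<in> tB p" by (rule h_tangent[OF nearA_of_field[OF X] nearA_of_field[OF U]])
  \<comment> \<open>Two applications of skew-symmetry move the square of \<open>T\<close> from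
    \<open>Q\<close> to the test field, where \<open>shape\<close> translates it into
    \<open>h\<close>. The test field is \<open>U\<close> itself, so positivity finishes the
    argument.\<close>
  have "g (F p) (psh p (T p (T p (Q p)))) (psh p (U p)) = g (F p) (psh p (Q p)) (psh p (T p (T p (U p))))"
    using T_skew[OF T_tangent[OF val[OF Q]] val[OF U]] T_skew[OF val[OF Q] T_tangent[OF val[OF U]]] by simp
  also have "\<dots> = g (F p) (h X (\<lambda>q. T q (T q (U q))) p) (V p)" by (rule shape[OF TTU])
  also have "\<dots> = - c * g (F p) (h X U p) (V p)"
    using n_n_h[OF X U] n_n_h_left[OF X U T2] hB nspace_tangent[OF Vn]
      g_scaleR_left[of "h X U p" "F p" "V p" "- c"] by simp
  also have "\<dots> = - c * g (F p) (psh p (Q p)) (psh p (U p))" using shape[OF U] by simp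
  finally have "g (F p) (psh p (U p)) (psh p (U p)) = 0"
    using split[OF push_tangent[OF val[OF U]]] by simp
  then have "U p = 0" using g_eq_0[OF push_tangent[OF val[OF U]]] push_eq_0[OF val[OF U]] by blast
  then show ?thesis unfolding U_def Q_def by (simp add: eq_neg_iff_add_eq_0)
qed

end

theorem theorem3p6:
  fixes A :: "('m::{t2_space,second_countable_topology}, 'e::euclidean_space) atlas"
    and B :: "('n::{t2_space,second_countable_topology}, 'd::euclidean_space) atlas"
    and F :: "'m \<Rightarrow> 'n"
    and \<phi> :: "'n \<Rightarrow> 'n tvec \<Rightarrow> 'n tvec"
    and g :: "'n \<Rightarrow> 'n tvec \<Rightarrow> 'n tvec \<Rightarrow> real"
    and nabb :: "('n, 'n) conn" and D :: "('m, 'n) conn" and nab :: "('m, 'm) conn"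
    and k :: nat and \<D> :: "nat \<Rightarrow> 'm \<Rightarrow> 'm tvec set" and \<theta> :: "nat \<Rightarrow> 'm \<Rightarrow> real"
  assumes "kaehler B \<phi> g nabb"
    and "submanifold A B F g nabb D nab"
    and "pointwise_k_slant A B F \<phi> g k \<D> \<theta>"
    and nabla_N_zero: "\<And>X Y p. vector_field A UNIV X \<Longrightarrow> vector_field A UNIV Y \<Longrightarrow>
      nabla_N A B F \<phi> g D nab X Y p = 0"
  shows
    "let h = second_ff B F D nab;
         T = T_op A B F \<phi> g;
         n = n_op A B F \<phi> g;
         A_shape = shape_op A B F g D
     in
     (\<forall>i\<in>{1..k}. \<forall>X Y. section_of A (\<D> 0) X \<and> section_of A (\<D> i) Y \<longrightarrow> (\<forall>p. h X Y p = 0)) \<and>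
     (\<forall>i\<in>{0..k}.
        (\<forall>X Y. section_of A (\<D> i) X \<and> section_of A (\<D> i) Y \<longrightarrow> (\<forall>p. h X Y p = 0)) \<or>
        (eigenvalue_function (Collect (normal_field A B F g)) (\<lambda>p. n p \<circ> n p)
           (\<lambda>p. - (cos (\<theta> i p))\<^sup>2) \<and>
         (\<forall>X Y. section_of A (\<D> i) X \<and> section_of A (\<D> i) Y \<and> (\<exists>p. h X Y p \<noteq> 0) \<longrightarrow>
            eigen_section (Collect (normal_field A B F g)) (\<lambda>p. n p \<circ> n p)
              (\<lambda>p. - (cos (\<theta> i p))\<^sup>2) (h X Y)))) \<and>
     (\<forall>i\<in>{0..k}.
        (\<forall>X Y. section_of A (\<D> i) X \<and> vector_field A UNIV Y \<longrightarrow> (\<forall>p. h X Y p = 0)) \<or>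
        (eigenvalue_function (Collect (vector_field A UNIV)) (\<lambda>p. T p \<circ> T p)
           (\<lambda>p. - (cos (\<theta> i p))\<^sup>2) \<and>
         (\<forall>X V. section_of A (\<D> i) X \<and> normal_field A B F g V \<and>
              (\<exists>p. A_shape V X p \<noteq> 0) \<longrightarrow>
            eigen_section (Collect (vector_field A UNIV)) (\<lambda>p. T p \<circ> T p)
              (\<lambda>p. - (cos (\<theta> i p))\<^sup>2) (A_shape V X))))"
proof -
  have bm: "smooth_manifold B" and am: "smooth_manifold A"
    using assms(1,2) unfolding kaehler_def almost_hermitian_def submanifold_def smooth_manifold_def
    by simp_all
  have "smooth_map A B F" and inj: "\<And>p. inj_on (push B F p) (tangent_space A p)"
    and ind: "induced_connection A B F nabb D" and nab: "levi_civita A (induced_metric B F g) nab"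
    using assms(2) unfolding submanifold_def injective_immersion_def by simp_all
  then have F: "smooth_mapping A B F"
    using am bm by (simp add: smooth_mapping_def smooth_mapping_axioms_def)
  have nabb: "levi_civita B g nabb" and g: "riemannian_metric B g"
    using assms(1) unfolding kaehler_def almost_hermitian_def by simp_all
  have conns: "connection A B F D" "connection B B id nabb" "connection A A id nab"
    using F ind nab nabb smooth_mapping_id[OF am] smooth_mapping_id[OF bm]
    unfolding connection_def connection_axioms_def induced_connection_def levi_civita_def by simp_all
  have riem: "riemannian B g"
    using bm g unfolding riemannian_def riemannian_axioms_def by (rule conjI)
  have "immersed_manifold A B F D g nabb nab"
    by (rule immersed_manifold.intro[OF conns(1) riem conns(2,3)
          immersed_manifold_axioms.intro[OF nabb nab ind inj]])
  then have kae: "kaehler_submanifold A B F D g nabb nab \<phi>"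
    using assms(1) by (rule kaehler_submanifold.intro[OF _ kaehler_submanifold_axioms.intro])
  have par: "parallel_normal_submanifold A B F D g nabb nab \<phi>"
    using nabla_N_zero by (rule parallel_normal_submanifold.intro[OF kae parallel_normal_submanifold_axioms.intro])
  interpret parallel_normal_submanifold A B F D g nabb nab \<phi> by (rule par)
  note slant = assms(3)[unfolded pointwise_k_slant_def, THEN conjunct2]
  note dist = slant[THEN conjunct1]
  note slant' = slant[THEN conjunct2, THEN conjunct2]
  note TM_sum = slant'[THEN conjunct1]
  note T_inv = slant'[THEN conjunct2, THEN conjunct1]
  note slant'' = slant'[THEN conjunct2, THEN conjunct2]
  note D0_inv = slant''[THEN conjunct1]
  note slants = slant''[THEN conjunct2, THEN conjunct1]
  note theta0 = slant''[THEN conjunct2, THEN conjunct2, THEN conjunct2]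
  have sub: "subspace (\<D> i p)" if "i \<le> k" for i p
  proof -
    have "smooth_distribution A (\<D> i)" using dist that by simp
    then obtain r where "\<forall>p. dim (\<D> i p) = r \<and> (\<exists>S (X :: nat \<Rightarrow> 'm \<Rightarrow> 'm tvec). open S \<and> p \<in> S \<and>
        (\<forall>j<r. vector_field A S (X j)) \<and> (\<forall>q\<in>S. \<D> i q = span ((\<lambda>j. X j q) ` {..<r})))"
      unfolding smooth_distribution_def by (rule exE)
    then obtain S and X :: "nat \<Rightarrow> 'm \<Rightarrow> 'm tvec" where
      "p \<in> S" "\<forall>q\<in>S. \<D> i q = span ((\<lambda>j. X j q) ` {..<r})"
      by (elim allE[of _ p] conjE exE)
    then show ?thesis by (simp add: subspace_span)
  qed
  have DA: "\<D> i p \<subseteq> tA p" if i: "i \<le> k" for i p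
  proof
    fix v assume v: "v \<in> \<D> i p"
    \<comment> \<open>The decomposition of \<open>v\<close> is the trivial one; the other fibres
      contain 0, being subspaces.\<close>
    let ?u = "\<lambda>j. if j = i then v else 0"
    have "(\<Sum>j\<le>k. ?u j) = v" using i by (simp add: sum.delta)
    moreover have "\<forall>j\<le>k. ?u j \<in> \<D> j p" using v subspace_0[OF sub] by simp
    ultimately show "v \<in> tA p" unfolding TM_sum[rule_format] by (intro CollectI exI[of _ ?u]) simp
  qed
  have T_square: "T p (T p v) = - (cos (\<theta> i p))\<^sup>2 *\<^sub>R v" if i: "i \<le> k" and v: "v \<in> \<D> i p" for i p v
  proof (cases "i = 0")
    case True
    then show ?thesis
      \<comment> \<open>\<open>\<theta> 0 = 0\<close> makes the factor -1, so the invariant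
        distribution fits the common formula.\<close>
      using invariant_T_square[OF DA[OF le0] D0_inv[rule_format]] v theta0 by simp
  next
    case False
    then have i': "i \<in> {1..k}" using i by simp
    have "pointwise_slant B F \<phi> g (\<D> i) (\<theta> i)" using slants i' by simp
    then have "subspace_angle (g (F p)) (\<phi> (F p) (psh p w)) (psh p ` \<D> i p) = \<theta> i p"
      if "w \<in> \<D> i p - {0}" for w
      using that unfolding pointwise_slant_def by blast
    then show ?thesis by (rule slant_T_square[OF sub[OF i] DA[OF i] T_inv[rule_format, OF i'] _ v])
  qed
  have field: "vector_field A UNIV X" and T_section: "T p (T p (X p)) = - (cos (\<theta> i p))\<^sup>2 *\<^sub>R X p"
    if "i \<le> k" "section_of A (\<D> i) X" for i X p
    using that T_square unfolding section_of_def by auto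
  \<comment> \<open>This separates the eigenvalue of each slant distribution from that of
    \<open>\<D> 0\<close>: the angle is positive and at most a right one, so its cosine is
    nonnegative and below 1.\<close>
  have cos_ne_1: "(cos (\<theta> i p))\<^sup>2 \<noteq> 1" if "i \<in> {1..k}" for i p
  proof -
    have "0 < \<theta> i p" "\<theta> i p \<le> pi / 2" using slants that by simp_all
    then have "0 \<le> cos (\<theta> i p)" "cos (\<theta> i p) < 1"
      using cos_monotone_0_pi[of 0 "\<theta> i p"] by (auto intro: cos_ge_zero)
    then show ?thesis using power_strict_mono[of "cos (\<theta> i p)" 1 2] by simp
  qed
  have mixed: "h X Y p = 0"
    if i: "i \<in> {1..k}" and X: "section_of A (\<D> 0) X" and Y: "section_of A (\<D> i) Y" for i X Y p
  proof -
    have i': "i \<le> k" using i by simp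
    have "T p (T p (X p)) = - 1 *\<^sub>R X p" using T_section[OF le0 X, of p] theta0 by simp
    \<comment> \<open>The value of the second iterate of \<open>n\<close> on \<open>h X Y p\<close>
      is computed from the first slot and from the second; the two factors are distinct.\<close>
    from n_n_h_left[OF field[OF le0 X] field[OF i' Y] this]
    have "- 1 *\<^sub>R h X Y p = - (cos (\<theta> i p))\<^sup>2 *\<^sub>R h X Y p"
      using n_n_h_right[OF field[OF le0 X] field[OF i' Y] T_section[OF i' Y]] by (simp only:)
    then show ?thesis unfolding scaleR_cancel_right using cos_ne_1[OF i, of p] by simp
  qed
  have eigen_h: "eigen_section (Collect (normal_field A B F g)) (\<lambda>p. n p \<circ> n p)
      (\<lambda>p. - (cos (\<theta> i p))\<^sup>2) (h X Y)"
    if "i \<le> k" "section_of A (\<D> i) X" "section_of A (\<D> i) Y" "\<exists>p. h X Y p \<noteq> 0" for i X Y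
    using that normal_field_h[OF field[OF that(1,2)] field[OF that(1,3)]]
      n_n_h_left[OF field[OF that(1,2)] field[OF that(1,3)] T_section[OF that(1,2)]]
    unfolding eigen_section_def by simp
  have eigen_shape: "eigen_section (Collect (vector_field A UNIV)) (\<lambda>p. T p \<circ> T p)
      (\<lambda>p. - (cos (\<theta> i p))\<^sup>2) (shape V X)"
    if "i \<le> k" "section_of A (\<D> i) X" "normal_field A B F g V" "\<exists>p. shape V X p \<noteq> 0" for i X V
    using that field_shape_op[OF field[OF that(1,2)] that(3)]
      T_T_shape[OF field[OF that(1,2)] that(3) T_section[OF that(1,2)]]
    unfolding eigen_section_def by simp
  \<comment> \<open>Pairing this vector with \<open>Y\<close> gives the squared length of
    \<open>h X Y p\<close>. Thus a nonvanishing \<open>h\<close> yields a nonvanishing shape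
    operator, as the second alternative of (iii) demands.\<close>
  have shape_nonzero: "shape (h X Y) X p \<noteq> 0"
    if X: "vector_field A UNIV X" and Y: "vector_field A UNIV Y" and "h X Y p \<noteq> 0" for X Y p
  proof
    assume zero: "shape (h X Y) X p = 0"
    have eq: "g (F p) (psh p (shape (h X Y) X p)) (psh p (Y p)) = g (F p) (h X Y p) (h X Y p)"
    proof (rule g_shape_op[where V = "h X Y" and p = p, OF nearA_of_field[OF X] nearA_of_field[OF Y]])
      show "near p (h X Y)" by (rule near_of_normal_field[OF normal_field_h[OF X Y]])
      show "h X Y q \<in> nspace q" for q by (rule h_normal[OF nearA_of_field[OF X] nearA_of_field[OF Y]])
      show "Y q \<in> tA q" for q by (rule nearA_tangent[OF nearA_of_field[OF Y]])
    qed
    have zero': "g (F p) 0 (psh p (Y p)) = 0"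
      by (rule g_zero_left[OF push_tangent[OF nearA_tangent[OF nearA_of_field[OF Y]]]])
    have "g (F p) (h X Y p) (h X Y p) = 0"
      by (rule trans[OF eq[unfolded zero push_zero, symmetric] zero'])
    then show False
      using g_eq_0[OF h_tangent[OF nearA_of_field[OF X] nearA_of_field[OF Y]]] that(3) by blast
  qed
  have part2: "(\<forall>X Y. section_of A (\<D> i) X \<and> section_of A (\<D> i) Y \<longrightarrow> (\<forall>p. h X Y p = 0)) \<or>
        (eigenvalue_function (Collect (normal_field A B F g)) (\<lambda>p. n p \<circ> n p)
           (\<lambda>p. - (cos (\<theta> i p))\<^sup>2) \<and>
         (\<forall>X Y. section_of A (\<D> i) X \<and> section_of A (\<D> i) Y \<and> (\<exists>p. h X Y p \<noteq> 0) \<longrightarrow>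
            eigen_section (Collect (normal_field A B F g)) (\<lambda>p. n p \<circ> n p)
              (\<lambda>p. - (cos (\<theta> i p))\<^sup>2) (h X Y)))" if i: "i \<le> k" for i
  proof (cases "\<forall>X Y. section_of A (\<D> i) X \<and> section_of A (\<D> i) Y \<longrightarrow> (\<forall>p. h X Y p = 0)")
    case False
    then obtain X Y where X: "section_of A (\<D> i) X" and Y: "section_of A (\<D> i) Y" and "\<exists>p. h X Y p \<noteq> 0"
      by blast
    \<comment> \<open>The nonvanishing \<open>h X Y\<close> is itself the witness for the eigenvalue
      function.\<close>
    from eigen_h[OF i this]
    have "eigenvalue_function (Collect (normal_field A B F g)) (\<lambda>p. n p \<circ> n p) (\<lambda>p. - (cos (\<theta> i p))\<^sup>2)"
      unfolding eigenvalue_function_def by blast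
    then show ?thesis using eigen_h[OF i] by simp
  qed simp
  have part3: "(\<forall>X Y. section_of A (\<D> i) X \<and> vector_field A UNIV Y \<longrightarrow> (\<forall>p. h X Y p = 0)) \<or>
        (eigenvalue_function (Collect (vector_field A UNIV)) (\<lambda>p. T p \<circ> T p)
           (\<lambda>p. - (cos (\<theta> i p))\<^sup>2) \<and>
         (\<forall>X V. section_of A (\<D> i) X \<and> normal_field A B F g V \<and>
              (\<exists>p. shape V X p \<noteq> 0) \<longrightarrow>
            eigen_section (Collect (vector_field A UNIV)) (\<lambda>p. T p \<circ> T p)
              (\<lambda>p. - (cos (\<theta> i p))\<^sup>2) (shape V X)))" if i: "i \<le> k" for i
  proof (cases "\<forall>X Y. section_of A (\<D> i) X \<and> vector_field A UNIV Y \<longrightarrow> (\<forall>p. h X Y p = 0)")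
    case False
    then obtain X Y p where X: "section_of A (\<D> i) X" and Y: "vector_field A UNIV Y" "h X Y p \<noteq> 0"
      by blast
    have "\<exists>p. shape (h X Y) X p \<noteq> 0" using shape_nonzero[OF field[OF i X] Y] by blast
    \<comment> \<open>The normal field in the shape operator is chosen to be \<open>h X Y\<close>,
      for which nonvanishing has just been secured.\<close>
    from eigen_shape[OF i X normal_field_h[OF field[OF i X] Y(1)] this]
    have "eigenvalue_function (Collect (vector_field A UNIV)) (\<lambda>p. T p \<circ> T p) (\<lambda>p. - (cos (\<theta> i p))\<^sup>2)"
      unfolding eigenvalue_function_def by blast
    then show ?thesis using eigen_shape[OF i] by simp
  qed simp
  show ?thesis
    unfolding Let_def using mixed part2 part3 by simp
qed

end
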